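(* Let $i\ge0$ be an integer, let $\mathcal I=(I_n)_{n\ge1}$ be an $\mathrm{Inc}^i$-invariant chain of (not necessarily graded) ideals $I_n\subseteq R_n$, and let $\le$ be any monomial order on $R$ respecting $\mathrm{Inc}^i$. Then $$\dim R_n/I_n=A(\mathcal I)\,n+B(\mathcal I)\quad\text{for all } n\gg0,$$ where $A(\mathcal I)=c-\gamma_i(\mathrm{in}_{\le}(\mathcal I))$ and $B(\mathcal I)=-D(\mathrm{in}_{\le}(\mathcal I))$. In particular, the integers $\gamma_i(\mathcal I):=\gamma_i(\mathrm{in}_{\le}(\mathcal I))$ and $D(\mathcal I):=D(\mathrm{in}_{\le}(\mathcal I))$ are independent of the choice of $\le$.
   Context: Fix an integer $c\ge 1$ and a field $K$; let $\mathbb N$ be the set of positive integers and $[c]=\{1,\dots,c\}$. For $n\ge1$ let $R_n=K[x_{k,j}\mid 1\le k\le c,\ 1\le j\le n]$ and $R=\bigcup_{n\ge1}R_n$. For an integer $i\ge0$ let $\mathrm{Inc}^i$ be the monoid of all strictly increasing maps $\pi:\mathbb N\to\mathbb N$ with $\pi(j)=j$ for all $j\le i$; it acts on $R$ by $K$-algebra endomorphisms via $\pi\cdot x_{k,j}=x_{k,\pi(j)}$. For $m\le n$ put $\mathrm{Inc}^i_{m,n}=\{\pi\in\mathrm{Inc}^i\mid \pi(m)\le n\}$. A chain $\mathcal I=(I_n)_{n\ge1}$ of ideals $I_n\subseteq R_n$ is $\mathrm{Inc}^i$-invariant if $\pi(f)\in I_n$ for all $m\le n$, $f\in I_m$, $\pi\in\mathrm{Inc}^i_{m,n}$.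 For such a chain there is an integer $r\ge1$ such that for all $n\ge r$ the ideal $I_n$ of $R_n$ is generated by $\{\pi(f)\mid f\in I_r,\ \pi\in\mathrm{Inc}^i_{r,n}\}$ (known); the least such $r$ is denoted $\mathrm{ind}^i(\mathcal I)$. A monomial order $\le$ on $R$ respects $\mathrm{Inc}^i$ if $\pi(u)\le\pi(v)$ whenever $\pi\in\mathrm{Inc}^i$ and $u\le v$ are monomials of $R$; its restrictions to the $R_n$ are also denoted $\le$. In that case, for an $\mathrm{Inc}^i$-invariant chain $\mathcal I$, the chain of initial ideals $\mathrm{in}_{\le}(\mathcal I)=(\mathrm{in}_{\le}(I_n))_{n\ge1}$ is again $\mathrm{Inc}^i$-invariant (known). For a monomial $u\ne1$, $\min(u)$ is the smallest index $j$ such that some $x_{k,j}$ divides $u$. For a proper monomial ideal $J\subsetneq R_n$ with minimal set of monomial generators $G(J)$, let $G_i^+(J)=\{u\in G(J)\mid \min(u)>i\}$. A set $C\subseteq[c]$ covers a monomial $u$ if there is $k\in C$ such that $x_{k,j}$ divides $u$ for some $j\ge1$; $C$ is an $i$-cover of $J$ if it covers every element of $G_i^+(J)$. Put $\gamma_i(J)=\min\{\#C\mid C\text{ is an }i\text{-cover of }J\}$, and $\gamma_i(R_n)=\infty$. For an $\mathrm{Inc}^i$-invariant chain $\mathcal J=(J_n)_{n\ge1}$ of monomial ideals, $\gamma_i(J_n)$ is the same for all $n\ge\mathrm{ind}^i(\mathcal J)$, and $\gamma_i(\mathcal J)$ denotes this common value. Moreover, $D(\mathcal J)$ denotes the integer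 with $\operatorname{codim}J_n=\gamma_i(\mathcal J)n+D(\mathcal J)$ for $n\gg0$, which exists for every such chain of monomial ideals. $\operatorname{codim}$ denotes codimension (height); by convention $\operatorname{codim}R_n=\infty$, and the dimension of the zero module is $-\infty$ (so if $I_n=R_n$ for large $n$, the formula reads $-\infty=-\infty$ and $D$ carries no information). *)

theory Defs
  imports
    "HOL-Algebra.QuotRing"
    "HOL-Library.Poly_Mapping"
    "HOL-Library.Extended_Real"
begin

text \<open>
  The variable \<open>x_{k,j}\<close> is the pair \<open>(k, j)\<close>. Monomials are exponent functions and are
  written additively: \<open>0\<close> is the monomial \<open>1\<close> and \<open>u + v\<close> is the product of \<open>u\<close> and \<open>v\<close>.
  The variable \<open>x_{k,j}\<close> divides \<open>u\<close> iff \<open>(k, j) \<in> keys u\<close>. Multiplication of polynomials is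
  the convolution product of \<open>HOL-Library.Poly_Mapping\<close>.
\<close>

type_synonym mon = "(nat \<times> nat) \<Rightarrow>\<^sub>0 nat"
type_synonym 'a mpoly = "mon \<Rightarrow>\<^sub>0 'a"

definition Mons :: "nat \<Rightarrow> mon set" where
  "Mons c = {u. Poly_Mapping.keys u \<subseteq> {1..c} \<times> {1..}}"

definition Mons_upto :: "nat \<Rightarrow> nat \<Rightarrow> mon set" where
  "Mons_upto c n = {u. Poly_Mapping.keys u \<subseteq> {1..c} \<times> {1..n}}"

definition Rn :: "nat \<Rightarrow> nat \<Rightarrow> 'a::field mpoly ring" where
  "Rn c n = \<lparr>carrier = {f. Poly_Mapping.keys f \<subseteq> Mons_upto c n},
    mult = (*), one = 1, zero = 0, add = (+)\<rparr>"

abbreviation mono_poly :: "mon \<Rightarrow> 'a::field mpoly" where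
  "mono_poly u \<equiv> Poly_Mapping.single u 1"

lemma Rn_cring: "cring (Rn c n :: 'a::field mpoly ring)"
proof (rule cringI)
  let ?R = "Rn c n :: 'a mpoly ring"
  have M0: "0 \<in> Mons_upto c n" by (simp add: Mons_upto_def)
  have M_add: "u + v \<in> Mons_upto c n" if "u \<in> Mons_upto c n" "v \<in> Mons_upto c n" for u v
    using that Poly_Mapping.keys_add[of u v] unfolding Mons_upto_def by blast
  have add: "f + g \<in> carrier ?R" if "f \<in> carrier ?R" "g \<in> carrier ?R" for f g
    using that Poly_Mapping.keys_add[of f g] by (auto simp: Rn_def)
  have mult: "f * g \<in> carrier ?R" if "f \<in> carrier ?R" "g \<in> carrier ?R" for f g
    using that keys_mult[of f g] M_add by (fastforce simp: Rn_def)
  have neg: "- f \<in> carrier ?R" if "f \<in> carrier ?R" for f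
    using that by (simp add: Rn_def keys.rep_eq)
  show "abelian_group ?R"
  proof (rule abelian_groupI)
    show "\<exists>y\<in>carrier ?R. y \<oplus>\<^bsub>?R\<^esub> x = \<zero>\<^bsub>?R\<^esub>" if "x \<in> carrier ?R" for x
      using neg[OF that] by (intro bexI[of _ "- x"]) (auto simp: Rn_def)
  qed (use add in \<open>auto simp: Rn_def ac_simps\<close>)
  show "comm_monoid ?R"
    by (rule comm_monoidI) (use mult M0 in \<open>auto simp: Rn_def ac_simps\<close>)
  show "(x \<oplus>\<^bsub>?R\<^esub> y) \<otimes>\<^bsub>?R\<^esub> z = x \<otimes>\<^bsub>?R\<^esub> z \<oplus>\<^bsub>?R\<^esub> y \<otimes>\<^bsub>?R\<^esub> z" for x y z
    by (simp add: Rn_def distrib_right)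
qed


text \<open>
  Suprema and infima are taken in the extended reals, so the zero ring has dimension
  \<open>-\<infinity>\<close> and the unit ideal has codimension \<open>\<infinity>\<close>.
\<close>

definition prime_chain :: "('b, 'm) ring_scheme \<Rightarrow> nat \<Rightarrow> (nat \<Rightarrow> 'b set) \<Rightarrow> bool" where
  "prime_chain A d P \<longleftrightarrow> (\<forall>l\<le>d. primeideal (P l) A) \<and> (\<forall>l<d. P l \<subset> P (Suc l))"

definition krull_dim :: "('b, 'm) ring_scheme \<Rightarrow> ereal" where
  "krull_dim A = (SUP d\<in>{d. \<exists>P. prime_chain A d P}. ereal (real d))"

definition prime_height :: "('b, 'm) ring_scheme \<Rightarrow> 'b set \<Rightarrow> ereal" where
  "prime_height A Q = (SUP d\<in>{d. \<exists>P. prime_chain A d P \<and> P d = Q}. ereal (real d))"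

definition codim :: "('b, 'm) ring_scheme \<Rightarrow> 'b set \<Rightarrow> ereal" where
  "codim A J = (INF Q\<in>{Q. primeideal Q A \<and> J \<subseteq> Q}. prime_height A Q)"


text \<open>Maps on the positive integers; the value of \<open>\<pi>\<close> at \<open>0\<close> is irrelevant.\<close>

definition Inc :: "nat \<Rightarrow> (nat \<Rightarrow> nat) set" where
  "Inc i = {\<pi>. \<pi> ` {1..} \<subseteq> {1..} \<and> strict_mono_on {1..} \<pi> \<and> (\<forall>j\<in>{1..i}. \<pi> j = j)}"

definition Inc_mn :: "nat \<Rightarrow> nat \<Rightarrow> nat \<Rightarrow> (nat \<Rightarrow> nat) set" where
  "Inc_mn i m n = {\<pi> \<in> Inc i. \<pi> m \<le> n}"

definition act_mon :: "(nat \<Rightarrow> nat) \<Rightarrow> mon \<Rightarrow> mon" where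
  "act_mon \<pi> u =
    (\<Sum>(k, j)\<in>Poly_Mapping.keys u. Poly_Mapping.single (k, \<pi> j) (Poly_Mapping.lookup u (k, j)))"

definition act :: "(nat \<Rightarrow> nat) \<Rightarrow> 'a::field mpoly \<Rightarrow> 'a mpoly" where
  "act \<pi> f =
    (\<Sum>u\<in>Poly_Mapping.keys f. Poly_Mapping.single (act_mon \<pi> u) (Poly_Mapping.lookup f u))"


text \<open>Chains are indexed by \<open>n \<ge> 1\<close>; the value of a chain at \<open>0\<close> is irrelevant.\<close>

definition inc_invariant_chain :: "nat \<Rightarrow> nat \<Rightarrow> (nat \<Rightarrow> 'a::field mpoly set) \<Rightarrow> bool" where
  "inc_invariant_chain c i I \<longleftrightarrow>
    (\<forall>n\<ge>1. ideal (I n) (Rn c n)) \<and>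
    (\<forall>m n. 1 \<le> m \<and> m \<le> n \<longrightarrow> (\<forall>f\<in>I m. \<forall>\<pi>\<in>Inc_mn i m n. act \<pi> f \<in> I n))"

definition ind :: "nat \<Rightarrow> nat \<Rightarrow> (nat \<Rightarrow> 'a::field mpoly set) \<Rightarrow> nat" where
  "ind c i I = (LEAST r. 1 \<le> r \<and>
    (\<forall>n\<ge>r. I n = Idl\<^bsub>Rn c n\<^esub> {act \<pi> f | \<pi> f. f \<in> I r \<and> \<pi> \<in> Inc_mn i r n}))"


text \<open>A pair \<open>(u, v) \<in> r\<close> means \<open>u \<le> v\<close>.\<close>

definition monomial_order :: "nat \<Rightarrow> mon rel \<Rightarrow> bool" where
  "monomial_order c r \<longleftrightarrow>
    linear_order_on (Mons c) r \<and>
    (\<forall>u\<in>Mons c. (0, u) \<in> r) \<and>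
    (\<forall>u v. \<forall>w\<in>Mons c. (u, v) \<in> r \<longrightarrow> (u + w, v + w) \<in> r)"

definition respects_Inc :: "nat \<Rightarrow> mon rel \<Rightarrow> bool" where
  "respects_Inc i r \<longleftrightarrow> (\<forall>\<pi>\<in>Inc i. \<forall>(u, v)\<in>r. (act_mon \<pi> u, act_mon \<pi> v) \<in> r)"

definition init_mon :: "mon rel \<Rightarrow> 'a::field mpoly \<Rightarrow> mon" where
  "init_mon r f = (THE u. u \<in> Poly_Mapping.keys f \<and> (\<forall>v\<in>Poly_Mapping.keys f. (v, u) \<in> r))"

definition init_ideal :: "nat \<Rightarrow> mon rel \<Rightarrow> nat \<Rightarrow> 'a::field mpoly set \<Rightarrow> 'a mpoly set" where
  "init_ideal c r n J = Idl\<^bsub>Rn c n\<^esub> {mono_poly (init_mon r f) | f. f \<in> J \<and> f \<noteq> 0}"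

definition init_chain ::
    "nat \<Rightarrow> mon rel \<Rightarrow> (nat \<Rightarrow> 'a::field mpoly set) \<Rightarrow> nat \<Rightarrow> 'a mpoly set" where
  "init_chain c r I n = init_ideal c r n (I n)"


definition min_gens :: "nat \<Rightarrow> nat \<Rightarrow> 'a::field mpoly set \<Rightarrow> mon set" where
  "min_gens c n J = (THE G. G \<subseteq> Mons_upto c n \<and> Idl\<^bsub>Rn c n\<^esub> (mono_poly ` G) = J \<and>
    (\<forall>G'. G' \<subset> G \<longrightarrow> Idl\<^bsub>Rn c n\<^esub> (mono_poly ` G') \<noteq> J))"

definition min_index :: "mon \<Rightarrow> nat" where
  "min_index u = (LEAST j. \<exists>k. (k, j) \<in> Poly_Mapping.keys u)"

definition G_plus :: "nat \<Rightarrow> nat \<Rightarrow> nat \<Rightarrow> 'a::field mpoly set \<Rightarrow> mon set" where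
  "G_plus c i n J = {u \<in> min_gens c n J. min_index u > i}"

definition covers :: "nat set \<Rightarrow> mon \<Rightarrow> bool" where
  "covers C u \<longleftrightarrow> (\<exists>k\<in>C. \<exists>j\<ge>1. (k, j) \<in> Poly_Mapping.keys u)"

definition is_cover :: "nat \<Rightarrow> nat \<Rightarrow> nat \<Rightarrow> 'a::field mpoly set \<Rightarrow> nat set \<Rightarrow> bool" where
  "is_cover c i n J C \<longleftrightarrow> C \<subseteq> {1..c} \<and> (\<forall>u\<in>G_plus c i n J. covers C u)"

definition gamma_ideal :: "nat \<Rightarrow> nat \<Rightarrow> nat \<Rightarrow> 'a::field mpoly set \<Rightarrow> enat" where
  "gamma_ideal c i n J =
    (if J = carrier (Rn c n) then \<infinity> else enat (Min {card C | C. is_cover c i n J C}))"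

definition gamma :: "nat \<Rightarrow> nat \<Rightarrow> (nat \<Rightarrow> 'a::field mpoly set) \<Rightarrow> enat" where
  "gamma c i J = (THE g. \<forall>n\<ge>ind c i J. gamma_ideal c i n (J n) = g)"

text \<open>
  If \<open>gamma c i J = \<infinity>\<close>, i.e. \<open>J n\<close> is the unit ideal for large \<open>n\<close>, every integer satisfies the
  defining property of \<open>D_const\<close>, which then carries no information.
\<close>

definition D_const :: "nat \<Rightarrow> nat \<Rightarrow> (nat \<Rightarrow> 'a::field mpoly set) \<Rightarrow> int" where
  "D_const c i J = (THE d. \<forall>\<^sub>F n in sequentially.
    codim (Rn c n) (J n) = ereal_of_enat (gamma c i J) * ereal (real n) + ereal (real_of_int d))"

end

theory Submission
  imports Defs "HOL-Library.Product_Lexorder" "HOL-Library.Sublist" "HOL-Library.Ramsey"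
begin


text \<open>Call a set S of variables of R_n independent if no initial monomial of I_n is supported
  in S, and let d(n) be the largest size of an independent set. For proper I_n the proof rests on
  two equalities, dim R_n/I_n = d(n) (\<open>krull_dim_quot\<close>) and codim in(I_n) = c n - d(n)
  (\<open>codim_init_ideal\<close>), so that only the growth of d(n) remains to be understood.

  dim >= d: a nonzero element of I_n in K[S] would have its initial monomial supported in S, so I_n
  meets K[S] in 0, and \<open>prime_chain_over_ideal\<close> builds a prime chain of length |S|
  above I_n. dim <= d: a positive integer weight copies the finitely many comparisons of the order
  that matter (\<open>initial_weight\<close>), which is why neither gradedness nor a special order
  enters. Modulo I_n everything reduces to standard monomials without raising the weighted degree,
  and at most const * t^d of these have degree at most t. A prime chain of length l supplies N^l
  products of degree at most const * N that are linearly independent modulo I_n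
  (\<open>pflag_independent\<close>); hence l <= d (\<open>pflag_length_bound\<close>).

  Codimension: a prime that contains a monomial contains one of its variables, so over a monomial
  ideal only the primes generated by complements of independent sets matter.

  Growth: by Higman's lemma the initial monomials of all levels come from one level r
  (\<open>generated_from_exists\<close>), so independence is a condition on r columns of variables
  at a time (\<open>indep_iff\<close>). Let g be the minimum size of an i-cover. The rows outside a
  minimum cover give an independent set of (c - g)(n - i) variables. Conversely, more than c - g
  rows can be the content of fewer than r columns beyond i (\<open>few_repetitions\<close>). Thus
  d(n) = (c - g) n + O(1). For large n some content of size c - g repeats r times in a largest
  independent set with no bigger column in between, and this stretch can be lengthened by one column
  (\<open>extend_block\<close>). So d(n) - (c - g) n is eventually nondecreasing and bounded, hence
  constant (\<open>eventually_affine\<close>).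

  The dimension does not mention the order, and an affine function determines its slope and constant
  term. If I_n is eventually the unit ideal, D has the same default value for every order
  (\<open>D_const_infinite\<close>).\<close>

abbreviation keys :: "('b \<Rightarrow>\<^sub>0 'c::zero) \<Rightarrow> 'b set" where
  "keys \<equiv> Poly_Mapping.keys"

abbreviation lookup :: "('b \<Rightarrow>\<^sub>0 'c::zero) \<Rightarrow> 'b \<Rightarrow> 'c" where
  "lookup \<equiv> Poly_Mapping.lookup"

abbreviation single :: "'b \<Rightarrow> 'c \<Rightarrow> 'b \<Rightarrow>\<^sub>0 'c::zero" where
  "single \<equiv> Poly_Mapping.single"

section \<open>Monomials and the polynomial subrings K[S]\<close>

section \<open>Polynomials in a set of variables\<close>

lemma lookup_add_mon: "lookup (u + v) x = lookup u x + lookup v (x :: nat \<times> nat)" for u v :: mon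
  by (rule Poly_Mapping.lookup_add)

lemma keys_add_mon: "keys (u + v) = keys u \<union> keys v" for u v :: mon
  by (auto simp: in_keys_iff lookup_add_mon)

lemma mon_decomp:
  fixes u :: mon
  obtains a b where "u = a + b" "keys a = keys u \<inter> T" "keys b = keys u - T"
    "\<And>x. x \<in> T \<Longrightarrow> lookup a x = lookup u x" "\<And>x. x \<notin> T \<Longrightarrow> lookup b x = lookup u x"
proof -
  define a :: mon where "a = Abs_poly_mapping (\<lambda>x. lookup u x when x \<in> T)"
  define b :: mon where "b = Abs_poly_mapping (\<lambda>x. lookup u x when x \<notin> T)"
  have f: "finite {x. (lookup u x when P x) \<noteq> 0}" for P
    by (rule finite_subset[OF _ finite_keys[of u]]) (auto simp: in_keys_iff when_def)
  have a: "lookup a x = (lookup u x when x \<in> T)" for x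
    unfolding a_def using f[of "\<lambda>x. x \<in> T"] by simp
  have b: "lookup b x = (lookup u x when x \<notin> T)" for x
    unfolding b_def using f[of "\<lambda>x. x \<notin> T"] by simp
  show ?thesis
    by (rule that[of a b]) (auto intro!: poly_mapping_eqI simp: lookup_add_mon a b in_keys_iff when_def split: if_splits)
qed

lemma mon_le_obtain:
  fixes u v :: mon
  assumes "\<And>x. lookup u x \<le> lookup v x"
  obtains w where "v = u + w"
  using assms by (intro that[of "v - u"]) (auto intro!: poly_mapping_eqI simp: lookup_add lookup_minus)

lemma mon_split_variable:
  fixes u :: mon
  assumes "x \<in> keys u"
  obtains v where "u = single x 1 + v"
  by (rule mon_le_obtain[of "single x 1" u])
    (use assms that in \<open>auto simp: lookup_single in_keys_iff when_def\<close>)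

lemma inj_on_restrict_lookup: "inj_on (\<lambda>m :: mon. restrict (lookup m) X) {m. keys m \<subseteq> X}"
proof (rule inj_onI)
  fix m m' :: mon
  assume m: "m \<in> {m. keys m \<subseteq> X}" "m' \<in> {m. keys m \<subseteq> X}" "restrict (lookup m) X = restrict (lookup m') X"
  have "lookup m x = lookup m' x" for x
  proof (cases "x \<in> X")
    case True then show ?thesis using m(3) by (metis restrict_apply')
  next
    case False
    then have "x \<notin> keys m" "x \<notin> keys m'" using m by auto
    then show ?thesis by (simp add: in_keys_iff)
  qed
  then show "m = m'" by (rule poly_mapping_eqI)
qed

lemma poly_sum_monomials: "f = (\<Sum>u\<in>keys f. single u (lookup f u))"
  for f :: "'b \<Rightarrow>\<^sub>0 'c::comm_monoid_add"
proof (rule poly_mapping_eqI)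
  fix v
  have "(\<Sum>u\<in>keys f. lookup (single u (lookup f u)) v) = (\<Sum>u\<in>keys f. if u = v then lookup f v else 0)"
    by (intro sum.cong) (auto simp: lookup_single)
  also have "\<dots> = lookup f v" by (auto simp: in_keys_iff)
  finally show "lookup f v = lookup (\<Sum>u\<in>keys f. single u (lookup f u)) v"
    by (simp add: lookup_sum)
qed

text \<open>The subring K[S]. An arbitrary \<open>S\<close> puts R_n and all its subrings K[T] into
  one type, so that an ideal can be intersected with K[T].\<close>

definition polys :: "(nat \<times> nat) set \<Rightarrow> 'a::field mpoly set" where
  "polys S = {f. \<forall>u\<in>keys f. keys u \<subseteq> S}"

lemma polys_mono: "S \<subseteq> T \<Longrightarrow> polys S \<subseteq> polys T"
  by (auto simp: polys_def)

lemma polys_keysD: "f \<in> polys S \<Longrightarrow> u \<in> keys f \<Longrightarrow> keys u \<subseteq> S"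
  by (auto simp: polys_def)

lemma polys_zero [simp]: "0 \<in> polys S"
  by (simp add: polys_def)

lemma polys_one [simp]: "1 \<in> polys S"
  by (simp add: polys_def)

lemma polys_single: "keys u \<subseteq> S \<Longrightarrow> single u a \<in> polys S"
  by (simp add: polys_def)

lemma polys_const [simp]: "single 0 a \<in> polys S"
  by (simp add: polys_single)

lemma polys_uminus: "f \<in> polys S \<Longrightarrow> - f \<in> polys S"
  by (auto simp: polys_def in_keys_iff)

lemma polys_add: "f \<in> polys S \<Longrightarrow> g \<in> polys S \<Longrightarrow> f + g \<in> polys S"
  using Poly_Mapping.keys_add[of f g] by (auto simp: polys_def)

lemma polys_diff: "f \<in> polys S \<Longrightarrow> g \<in> polys S \<Longrightarrow> f - g \<in> polys S"
  using polys_add[of f S "- g"] polys_uminus[of g S] by simp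

lemma keys_multE:
  assumes "w \<in> keys (f * g)"
  obtains u v where "w = u + v" "u \<in> keys f" "v \<in> keys g"
  using assms keys_mult[of f g] by blast

lemma polys_mult: "f \<in> polys S \<Longrightarrow> g \<in> polys S \<Longrightarrow> f * g \<in> polys S"
  unfolding polys_def by (force elim!: keys_multE simp: keys_add_mon)

lemma polys_power: "f \<in> polys S \<Longrightarrow> f ^ k \<in> polys S"
  by (induction k) (auto intro: polys_mult)

lemma polys_sum: "(\<And>a. a \<in> A \<Longrightarrow> f a \<in> polys S) \<Longrightarrow> sum f A \<in> polys S"
  by (induction A rule: infinite_finite_induct) (auto intro: polys_add)

lemma polys_prod: "(\<And>a. a \<in> A \<Longrightarrow> f a \<in> polys S) \<Longrightarrow> prod f A \<in> polys S"
  by (induction A rule: infinite_finite_induct) (auto intro: polys_mult)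

lemmas polys_intros = polys_uminus polys_add polys_diff polys_mult polys_power polys_sum polys_prod

definition restr_poly :: "mon set \<Rightarrow> 'a::field mpoly \<Rightarrow> 'a mpoly" where
  "restr_poly A f = Abs_poly_mapping (\<lambda>u. lookup f u when u \<in> A)"

lemma lookup_restr_poly: "lookup (restr_poly A f) u = (lookup f u when u \<in> A)"
proof -
  have "finite {u. (lookup f u when u \<in> A) \<noteq> 0}"
    by (rule finite_subset[OF _ finite_keys[of f]]) (auto simp: in_keys_iff)
  then show ?thesis unfolding restr_poly_def by simp
qed

lemma keys_restr_poly: "keys (restr_poly A f) = keys f \<inter> A"
  by (auto simp: in_keys_iff lookup_restr_poly)

lemma restr_poly_split: "f = restr_poly A f + restr_poly (- A) f"
  by (rule poly_mapping_eqI) (auto simp: lookup_add lookup_restr_poly when_def)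

section \<open>Ideals of K[X] and primes avoiding a multiplicative set\<close>

section \<open>Ideals and prime ideals of polynomial rings\<close>

text \<open>Ideals of K[X] for any set \<open>X\<close> of variables; negation is multiplication by
  the constant -1. \<open>ideal_Rn_iff\<close> and \<open>primeideal_Rn_iff\<close> link these
  predicates to HOL-Algebra.\<close>

definition pideal :: "(nat \<times> nat) set \<Rightarrow> 'a::field mpoly set \<Rightarrow> bool" where
  "pideal X J \<longleftrightarrow> J \<subseteq> polys X \<and> 0 \<in> J \<and> (\<forall>f\<in>J. \<forall>g\<in>J. f + g \<in> J) \<and>
     (\<forall>f\<in>polys X. \<forall>g\<in>J. f * g \<in> J)"

definition pprime :: "(nat \<times> nat) set \<Rightarrow> 'a::field mpoly set \<Rightarrow> bool" where
  "pprime X Q \<longleftrightarrow> pideal X Q \<and> 1 \<notin> Q \<and>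
     (\<forall>f\<in>polys X. \<forall>g\<in>polys X. f * g \<in> Q \<longrightarrow> f \<in> Q \<or> g \<in> Q)"

lemma pideal_subset: "pideal X J \<Longrightarrow> f \<in> J \<Longrightarrow> f \<in> polys X"
  by (auto simp: pideal_def)
lemma pideal_zero: "pideal X J \<Longrightarrow> 0 \<in> J"
  by (auto simp: pideal_def)
lemma pideal_add: "pideal X J \<Longrightarrow> f \<in> J \<Longrightarrow> g \<in> J \<Longrightarrow> f + g \<in> J"
  by (auto simp: pideal_def)
lemma pideal_mult: "pideal X J \<Longrightarrow> f \<in> polys X \<Longrightarrow> g \<in> J \<Longrightarrow> f * g \<in> J"
  by (auto simp: pideal_def)
lemma pideal_mult_right: "pideal X J \<Longrightarrow> f \<in> polys X \<Longrightarrow> g \<in> J \<Longrightarrow> g * f \<in> J"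
  by (auto simp: pideal_def mult.commute[of g f])
lemma pideal_uminus: "pideal X J \<Longrightarrow> f \<in> J \<Longrightarrow> - f \<in> J"
  using pideal_mult[of X J "- 1" f] polys_uminus[OF polys_one, of X] by simp
lemma pideal_diff: "pideal X J \<Longrightarrow> f \<in> J \<Longrightarrow> g \<in> J \<Longrightarrow> f - g \<in> J"
  using pideal_add[of X J f "- g"] pideal_uminus[of X J g] by simp
lemma pideal_sum: "pideal X J \<Longrightarrow> (\<And>a. a \<in> A \<Longrightarrow> f a \<in> J) \<Longrightarrow> sum f A \<in> J"
  by (induction A rule: infinite_finite_induct) (auto intro: pideal_add pideal_zero)

lemma pprime_pideal: "pprime X Q \<Longrightarrow> pideal X Q"
  by (simp add: pprime_def)

lemma pprime_power:
  assumes "pprime X Q" "f \<in> polys X" "f ^ k \<in> Q"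
  shows "f \<in> Q"
  using assms(3)
proof (induction k)
  case 0 then show ?case using assms(1) by (simp add: pprime_def)
next
  case (Suc k)
  then show ?case using assms(1,2) polys_power[OF assms(2), of k] by (auto simp: pprime_def)
qed

lemma pideal_adjoin:
  assumes "pideal X J" "f \<in> polys X"
  shows "pideal X {q + f * a | q a. q \<in> J \<and> a \<in> polys X}" (is "pideal X ?K")
    and "J \<subseteq> {q + f * a | q a. q \<in> J \<and> a \<in> polys X}"
    and "f \<in> {q + f * a | q a. q \<in> J \<and> a \<in> polys X}"
proof -
  show "J \<subseteq> ?K"
  proof
    fix q assume "q \<in> J"
    then show "q \<in> ?K" by (intro CollectI exI[of _ q] exI[of _ 0]) auto
  qed
  show "f \<in> ?K"
    by (intro CollectI exI[of _ 0] exI[of _ 1]) (auto intro: pideal_zero[OF assms(1)])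
  have "g + h \<in> ?K" if gh: "g \<in> ?K" "h \<in> ?K" for g h
  proof -
    obtain q a q' a' where *: "g = q + f * a" "q \<in> J" "a \<in> polys X" "h = q' + f * a'" "q' \<in> J" "a' \<in> polys X"
      using gh by blast
    have "g + h = (q + q') + f * (a + a')" by (simp add: * algebra_simps)
    then show ?thesis using * pideal_add[OF assms(1)] polys_add by blast
  qed
  moreover have "p * g \<in> ?K" if p: "p \<in> polys X" "g \<in> ?K" for p g
  proof -
    obtain q a where *: "g = q + f * a" "q \<in> J" "a \<in> polys X" using p(2) by blast
    have "p * g = p * q + f * (p * a)" by (simp add: * algebra_simps)
    then show ?thesis using * pideal_mult[OF assms(1)] polys_mult p(1) by blast
  qed
  moreover have "?K \<subseteq> polys X"
    using pideal_subset[OF assms(1)] assms(2) by (auto intro!: polys_intros)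
  moreover have "0 \<in> ?K" using \<open>J \<subseteq> ?K\<close> pideal_zero[OF assms(1)] by blast
  ultimately show "pideal X ?K" unfolding pideal_def by blast
qed

lemma pideal_Union_chain:
  assumes "C \<noteq> {}" "\<And>J. J \<in> C \<Longrightarrow> pideal X J" "\<And>J K. J \<in> C \<Longrightarrow> K \<in> C \<Longrightarrow> J \<subseteq> K \<or> K \<subseteq> J"
  shows "pideal X (\<Union>C)"
proof -
  have "f + g \<in> \<Union>C" if fg: "f \<in> \<Union>C" "g \<in> \<Union>C" for f g
  proof -
    obtain J K where "J \<in> C" "f \<in> J" "K \<in> C" "g \<in> K" using fg by blast
    then show ?thesis using assms(3)[of J K] pideal_add[OF assms(2)] by blast
  qed
  then show ?thesis
    using assms(1,2) unfolding pideal_def by blast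
qed

text \<open>An ideal that is maximal among those containing \<open>J\<close> and missing the
  multiplicative set \<open>W\<close> is prime. It is applied to the nonzero elements of a subring
  K[T].\<close>

lemma prime_avoiding_exists:
  assumes J: "pideal X J" and W: "W \<subseteq> polys X" "1 \<in> W" "\<And>v w. v \<in> W \<Longrightarrow> w \<in> W \<Longrightarrow> v * w \<in> W"
    and JW: "J \<inter> W = {}"
  obtains Q where "pprime X Q" "J \<subseteq> Q" "Q \<inter> W = {}"
proof -
  let ?\<A> = "{K. pideal X K \<and> J \<subseteq> K \<and> K \<inter> W = {}}"
  have "\<exists>M\<in>?\<A>. \<forall>K\<in>?\<A>. M \<subseteq> K \<longrightarrow> K = M"
  proof (rule subset_Zorn_nonempty)
    show "?\<A> \<noteq> {}" using J JW by blast
    fix C assume C: "C \<noteq> {}" "subset.chain ?\<A> C"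
    then have "C \<subseteq> ?\<A>" "\<And>J K. J \<in> C \<Longrightarrow> K \<in> C \<Longrightarrow> J \<subseteq> K \<or> K \<subseteq> J"
      unfolding subset.chain_def by blast+
    then show "\<Union>C \<in> ?\<A>" using pideal_Union_chain[of C X] C(1) by blast
  qed
  then obtain Q where QA: "Q \<in> ?\<A>" and "\<forall>K\<in>?\<A>. Q \<subseteq> K \<longrightarrow> K = Q" by (elim bexE)
  moreover have Q: "pideal X Q" "J \<subseteq> Q" "Q \<inter> W = {}" using QA by simp_all
  ultimately have max: "K = Q" if "pideal X K" "Q \<subseteq> K" "K \<inter> W = {}" for K
    using that subset_trans[of J Q K] by simp
  \<comment> \<open>By maximality, adjoining an outside element to \<open>Q\<close> gives an ideal
    that meets \<open>W\<close>.\<close>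
  have meet: "\<exists>q a. q \<in> Q \<and> a \<in> polys X \<and> q + f * a \<in> W" if f: "f \<in> polys X" "f \<notin> Q" for f
  proof (rule ccontr)
    assume "\<not> ?thesis"
    then have "{q + f * a | q a. q \<in> Q \<and> a \<in> polys X} \<inter> W = {}" by blast
    then show False
      using max[OF pideal_adjoin(1,2)[OF Q(1) f(1)]] pideal_adjoin(3)[OF Q(1) f(1)] f(2) by simp
  qed
  have "f \<in> Q \<or> g \<in> Q" if fg: "f \<in> polys X" "g \<in> polys X" "f * g \<in> Q" for f g
  proof (rule ccontr)
    assume "\<not> ?thesis"
    then obtain q a q' a' where *: "q \<in> Q" "a \<in> polys X" "q + f * a \<in> W"
      "q' \<in> Q" "a' \<in> polys X" "q' + g * a' \<in> W" using meet[of f] meet[of g] fg(1,2) by blast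
    \<comment> \<open>A product of two elements of \<open>W\<close> that lies in \<open>Q\<close>:
      each term contains \<open>q\<close>, \<open>q'\<close> or f g.\<close>
    have "(q + f * a) * (q' + g * a') = (q' + g * a') * q + f * a * q' + a * a' * (f * g)"
      by (simp add: algebra_simps)
    also have "\<dots> \<in> Q"
    proof (intro pideal_add[OF Q(1)])
      have qq: "q \<in> polys X" "q' \<in> polys X" using * pideal_subset[OF Q(1)] by auto
      show "(q' + g * a') * q \<in> Q" "f * a * q' \<in> Q" "a * a' * (f * g) \<in> Q"
        using * fg qq by (auto intro!: pideal_mult[OF Q(1), of _ q] pideal_mult[OF Q(1), of _ q']
            pideal_mult[OF Q(1), of _ "f * g"] polys_intros)
    qed
    finally show False using W(3)[OF *(3,6)] Q(3) by blast
  qed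
  then have "pprime X Q" using Q W(2) by (auto simp: pprime_def)
  then show ?thesis using that Q by blast
qed

definition xvars :: "nat \<Rightarrow> nat \<Rightarrow> (nat \<times> nat) set" where
  "xvars c n = {1..c} \<times> {1..n}"

lemma carrier_Rn: "carrier (Rn c n) = polys (xvars c n)"
  by (auto simp: Rn_def polys_def Mons_upto_def xvars_def)

lemma Rn_ops [simp]:
  "mult (Rn c n) = (*)" "add (Rn c n) = (+)" "zero (Rn c n) = 0" "one (Rn c n) = 1"
  by (simp_all add: Rn_def)

lemma Rn_ring: "ring (Rn c n)"
  using Rn_cring cring_def by blast

lemma ideal_Rn_iff: "ideal J (Rn c n) \<longleftrightarrow> pideal (xvars c n) J"
proof
  assume "ideal J (Rn c n)"
  then interpret ideal J "Rn c n" .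
  show "pideal (xvars c n) J"
    using a_subset additive_subgroup.zero_closed[OF additive_subgroup_axioms]
      additive_subgroup.a_closed[OF additive_subgroup_axioms] I_l_closed
    by (auto simp: pideal_def carrier_Rn)
next
  assume J: "pideal (xvars c n) J"
  interpret cring "Rn c n" by (rule Rn_cring)
  have inv: "inv\<^bsub>add_monoid (Rn c n)\<^esub> f = - f" if "f \<in> polys (xvars c n)" for f :: "'a mpoly"
  proof -
    have "\<ominus>\<^bsub>Rn c n\<^esub> f = - f"
      by (rule minus_equality) (use that polys_uminus in \<open>auto simp: carrier_Rn\<close>)
    then show ?thesis by (simp add: a_inv_def)
  qed
  show "ideal J (Rn c n)"
  proof (rule idealI)
    show "ring (Rn c n)" by (rule Rn_ring)
    show "subgroup J (add_monoid (Rn c n))"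
      by (rule subgroup.intro)
        (use J pideal_subset[OF J] inv in \<open>auto simp: carrier_Rn pideal_add[OF J] pideal_zero[OF J] pideal_uminus[OF J]\<close>)
  qed (auto simp: carrier_Rn intro: pideal_mult[OF J] pideal_mult_right[OF J])
qed

lemma pideal_eq_polys_iff: "pideal X J \<Longrightarrow> J = polys X \<longleftrightarrow> 1 \<in> J"
  using pideal_mult_right[of X J _ 1] pideal_subset[of X J] by auto

lemma primeideal_Rn_iff: "primeideal Q (Rn c n) \<longleftrightarrow> pprime (xvars c n) Q"
proof
  assume "primeideal Q (Rn c n)"
  then interpret primeideal Q "Rn c n" .
  show "pprime (xvars c n) Q"
    using I_notcarr I_prime ideal_axioms pideal_eq_polys_iff[of "xvars c n" Q]
    by (auto simp: pprime_def carrier_Rn ideal_Rn_iff)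
next
  assume "pprime (xvars c n) Q"
  then show "primeideal Q (Rn c n)"
    by (intro primeidealI Rn_cring)
      (auto simp: pprime_def ideal_Rn_iff carrier_Rn)
qed

section \<open>Prime chains of a quotient ring\<close>

lemma (in ring) primeideal_quot_image:
  assumes R: "cring R" and I: "ideal I R" and Q: "primeideal Q R" "I \<subseteq> Q"
  shows "primeideal ((+>) I ` Q) (R Quot I)"
proof -
  interpret I: ideal I R by fact
  interpret Q: primeideal Q R by fact
  interpret h: ring_hom_ring R "R Quot I" "(+>) I" by (rule I.rcos_ring_hom_ring)
  have U: "\<Union>((+>) I ` Q) = Q"
    using ideal_incl_iff[OF I Q.is_ideal] Q(2) by auto
  have im: "ideal ((+>) I ` Q) (R Quot I)" by (rule ring_ideal_imp_quot_ideal[OF I Q.is_ideal])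
  have sub: "(+>) I ` Q \<subseteq> carrier (R Quot I)"
    using ideal.axioms(1)[OF im] additive_subgroup.a_subset by blast
  have mem: "a \<in> Q \<longleftrightarrow> I +> a \<in> (+>) I ` Q" if "a \<in> carrier R" for a
    using canonical_proj_vimage_mem_iff[OF I sub that] U by simp
  have rep: "\<exists>a\<in>carrier R. A = I +> a" if "A \<in> carrier (R Quot I)" for A
    using that unfolding FactRing_def A_RCOSETS_def'[of R I] by auto
  show ?thesis
  proof (rule primeidealI)
    show "cring (R Quot I)" by (rule I.quotient_is_cring[OF R])
    show "carrier (R Quot I) \<noteq> (+>) I ` Q"
    proof
      assume eq: "carrier (R Quot I) = (+>) I ` Q"
      have "a \<in> Q" if "a \<in> carrier R" for a
        using mem[OF that] h.hom_closed[OF that] unfolding eq by blast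
      then show False using Q.I_notcarr Q.a_subset by blast
    qed
    fix A B assume A: "A \<in> carrier (R Quot I)" "B \<in> carrier (R Quot I)" "A \<otimes>\<^bsub>R Quot I\<^esub> B \<in> (+>) I ` Q"
    obtain a b where ab: "a \<in> carrier R" "b \<in> carrier R" "A = I +> a" "B = I +> b"
      using rep[OF A(1)] rep[OF A(2)] by metis
    have "I +> (a \<otimes> b) \<in> (+>) I ` Q" 
      using A(3) unfolding ab(3,4) h.hom_mult[OF ab(1,2)] .
    then have "a \<otimes> b \<in> Q" using mem[OF m_closed[OF ab(1,2)]] by blast
    then show "A \<in> (+>) I ` Q \<or> B \<in> (+>) I ` Q"
      using Q.I_prime[OF ab(1,2)] unfolding ab(3,4) by blast
  qed (rule im)
qed

lemma (in ring) primeideal_quot_Union: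
  assumes R: "cring R" and I: "ideal I R" and P: "primeideal P (R Quot I)"
  shows "primeideal (\<Union>P) R" "I \<subseteq> \<Union>P"
proof -
  have "I \<in> P"
    using additive_subgroup.zero_closed[OF ideal.axioms(1)[OF primeideal.axioms(1)[OF P]]]
    by (simp only: FactRing_def ring.simps)
  interpret I: ideal I R by fact
  interpret P: primeideal P "R Quot I" by fact
  interpret h: ring_hom_ring R "R Quot I" "(+>) I" by (rule I.rcos_ring_hom_ring)
  have mem: "a \<in> \<Union>P \<longleftrightarrow> I +> a \<in> P" if "a \<in> carrier R" for a
    using canonical_proj_vimage_mem_iff[OF I P.a_subset that] .
  show "I \<subseteq> \<Union>P" using \<open>I \<in> P\<close> by blast
  show "primeideal (\<Union>P) R"
  proof (rule primeidealI)
    show "ideal (\<Union>P) R" by (rule quot_ideal_imp_ring_ideal[OF I P.is_ideal])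
    show "carrier R \<noteq> \<Union>P"
    proof
      assume eq: "carrier R = \<Union>P"
      have "\<one>\<^bsub>R Quot I\<^esub> \<in> P" 
        using mem[OF one_closed] one_closed unfolding eq h.hom_one by blast
      then show False using P.one_imp_carrier P.I_notcarr by metis
    qed
    fix a b assume ab: "a \<in> carrier R" "b \<in> carrier R" "a \<otimes> b \<in> \<Union>P"
    then have "(I +> a) \<otimes>\<^bsub>R Quot I\<^esub> (I +> b) \<in> P"
      using mem[OF m_closed[OF ab(1,2)]] unfolding h.hom_mult[OF ab(1,2)] by blast
    then show "a \<in> \<Union>P \<or> b \<in> \<Union>P"
      using P.I_prime[OF h.hom_closed[OF ab(1)] h.hom_closed[OF ab(2)]] mem[OF ab(1)] mem[OF ab(2)] by blast
  qed (rule R)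
qed

text \<open>Primes are lifted by the union of cosets and pushed down by the projection. On ideals
  above \<open>I\<close> the two are inverse to each other, so strict inclusions stay
  strict.\<close>

lemma (in ring) prime_chain_quot_iff:
  assumes R: "cring R" and I: "ideal I R"
  shows "(\<exists>P. prime_chain (R Quot I) d P) \<longleftrightarrow> (\<exists>Q. prime_chain R d Q \<and> I \<subseteq> Q 0)"
proof
  assume "\<exists>P. prime_chain (R Quot I) d P"
  then obtain P where P: "\<And>l. l \<le> d \<Longrightarrow> primeideal (P l) (R Quot I)" "\<And>l. l < d \<Longrightarrow> P l \<subset> P (Suc l)"
    by (auto simp: prime_chain_def)
  have sub: "P l \<subseteq> carrier (R Quot I)" if "l \<le> d" for l
    using P(1)[OF that] by (meson additive_subgroup.a_subset ideal.axioms(1) primeideal.axioms(1))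
  have im: "(+>) I ` (\<Union>(P l)) = P l" if l: "l \<le> d" for l
  proof
    show "(+>) I ` (\<Union>(P l)) \<subseteq> P l"
    proof
      fix x assume "x \<in> (+>) I ` (\<Union>(P l))"
      then obtain a where a: "a \<in> \<Union>(P l)" "x = I +> a" by (elim imageE)
      then have "a \<in> carrier R" using canonical_proj_vimage_in_carrier[OF I sub[OF l]] by (rule_tac subsetD)
      then show "x \<in> P l" using canonical_proj_vimage_mem_iff[OF I sub[OF l]] a by metis
    qed
    show "P l \<subseteq> (+>) I ` (\<Union>(P l))"
    proof
      fix x assume x: "x \<in> P l"
      then obtain a where "a \<in> carrier R" "x = I +> a"
        using sub[OF l] unfolding FactRing_def A_RCOSETS_def'[of R I] by auto
      then show "x \<in> (+>) I ` (\<Union>(P l))"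
        using canonical_proj_vimage_mem_iff[OF I sub[OF l]] x by blast
    qed
  qed
  have "\<Union>(P l) \<subset> \<Union>(P (Suc l))" if "l < d" for l
    using P(2)[OF that] im[of l] im[of "Suc l"] that by (metis Sup_subset_mono Suc_leI less_imp_le psubsetE psubsetI)
  then have "prime_chain R d (\<lambda>l. \<Union>(P l))" "I \<subseteq> \<Union>(P 0)"
    using primeideal_quot_Union[OF R I P(1)] by (auto simp: prime_chain_def)
  then show "\<exists>Q. prime_chain R d Q \<and> I \<subseteq> Q 0" by blast
next
  assume "\<exists>Q. prime_chain R d Q \<and> I \<subseteq> Q 0"
  then obtain Q where Q: "\<And>l. l \<le> d \<Longrightarrow> primeideal (Q l) R" "\<And>l. l < d \<Longrightarrow> Q l \<subset> Q (Suc l)" "I \<subseteq> Q 0"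
    by (auto simp: prime_chain_def)
  have IQ: "I \<subseteq> Q l" if "l \<le> d" for l
    using that
  proof (induction l)
    case (Suc l) then show ?case using Q(2)[of l] by auto
  qed (use Q(3) in auto)
  have U: "\<Union>((+>) I ` Q l) = Q l" if "l \<le> d" for l
    using ideal_incl_iff[OF I primeideal.axioms(1)[OF Q(1)[OF that]]] IQ[OF that] by auto
  have "(+>) I ` Q l \<subset> (+>) I ` Q (Suc l)" if "l < d" for l
    using Q(2)[OF that] U[of l] U[of "Suc l"] that by (metis image_mono Suc_leI less_imp_le psubsetE psubsetI)
  then have "prime_chain (R Quot I) d (\<lambda>l. (+>) I ` Q l)"
    using primeideal_quot_image[OF R I Q(1) IQ] by (auto simp: prime_chain_def)
  then show "\<exists>P. prime_chain (R Quot I) d P" by blast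
qed


section \<open>Chain length against the growth of standard monomials\<close>

section \<open>An upper bound for lengths of prime chains\<close>

text \<open>Gaussian elimination, with one unknown for each element of \<open>A\<close> and one
  equation for each element of \<open>B\<close>.\<close>

lemma homogeneous_system_nontrivial:
  fixes M :: "'b \<Rightarrow> 'c \<Rightarrow> 'a::field"
  assumes "finite B" "finite A" "card B < card A"
  shows "\<exists>l. (\<exists>a\<in>A. l a \<noteq> 0) \<and> (\<forall>b\<in>B. (\<Sum>a\<in>A. l a * M a b) = 0)"
  using assms
proof (induction B arbitrary: A M rule: finite_induct)
  case empty
  then obtain a where "a \<in> A" by fastforce
  then show ?case by (intro exI[of _ "\<lambda>_. 1"]) auto
next
  case (insert b B)
  show ?case
  proof (cases "\<forall>a\<in>A. M a b = 0")
    case True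
    have "card B < card A" using insert by simp
    then obtain l where "\<exists>a\<in>A. l a \<noteq> 0" "\<forall>b\<in>B. (\<Sum>a\<in>A. l a * M a b) = 0"
      using insert.IH[OF insert.prems(1), of M] by blast
    then show ?thesis using True by (intro exI[of _ l]) auto
  next
    case False
    then obtain p where p: "p \<in> A" "M p b \<noteq> 0" by blast
    \<comment> \<open>Equation \<open>b\<close> is solved for the unknown \<open>p\<close>.
      \<open>M'\<close> holds the other equations after substitution, and \<open>l'\<close> below
      restores the value of \<open>p\<close>.\<close>
    define M' where "M' a d = M a d - M a b / M p b * M p d" for a d
    have "card B < card (A - {p})" "finite (A - {p})" using insert p by auto
    then obtain l where l: "\<exists>a\<in>A - {p}. l a \<noteq> 0" "\<forall>d\<in>B. (\<Sum>a\<in>A - {p}. l a * M' a d) = 0"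
      using insert.IH[of "A - {p}" M'] by blast
    define s where "s = (\<Sum>a\<in>A - {p}. l a * (M a b / M p b))"
    define l' where "l' = l(p := - s)"
    have eq: "(\<Sum>a\<in>A. l' a * M a d) = (\<Sum>a\<in>A - {p}. l a * M' a d)" for d
    proof -
      have "(\<Sum>a\<in>A. l' a * M a d) = - s * M p d + (\<Sum>a\<in>A - {p}. l a * M a d)"
        using p(1) insert.prems(1) by (subst sum.remove[of _ p]) (auto simp: l'_def intro!: sum.cong)
      also have "\<dots> = (\<Sum>a\<in>A - {p}. l a * M a d) - (\<Sum>a\<in>A - {p}. l a * (M a b / M p b) * M p d)"
        by (simp add: s_def sum_distrib_right)
      also have "\<dots> = (\<Sum>a\<in>A - {p}. l a * M' a d)"
        by (simp add: M'_def sum_subtractf[symmetric] algebra_simps)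
      finally show ?thesis .
    qed
    have "M' a b = 0" for a using p(2) by (simp add: M'_def)
    then have "\<forall>d\<in>insert b B. (\<Sum>a\<in>A. l' a * M a d) = 0"
      using l(2) by (simp add: eq)
    moreover have "\<exists>a\<in>A. l' a \<noteq> 0" using l(1) by (auto simp: l'_def)
    ultimately show ?thesis by blast
  qed
qed

text \<open>
  \<open>pflag X Q ys\<close> holds for \<open>ys = [y\<^sub>1, \<dots>, y\<^sub>d]\<close> if there are primes
  \<open>Q = Q\<^sub>0 \<subset> \<dots> \<subset> Q\<^sub>d\<close> with \<open>y\<^sub>l \<in> Q\<^sub>l - Q\<^sub>l\<^sub>-\<^sub>1\<close>.
\<close>

fun pflag :: "(nat \<times> nat) set \<Rightarrow> 'a::field mpoly set \<Rightarrow> 'a mpoly list \<Rightarrow> bool" where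
  "pflag X Q [] = pprime X Q"
| "pflag X Q (y # ys) = (pprime X Q \<and> y \<in> polys X \<and> y \<notin> Q \<and>
     (\<exists>Q'. Q \<subseteq> Q' \<and> y \<in> Q' \<and> pflag X Q' ys))"

fun ppow :: "'b::comm_monoid_mult list \<Rightarrow> nat list \<Rightarrow> 'b" where
  "ppow (y # ys) (a # as) = y ^ a * ppow ys as"
| "ppow _ _ = 1"

lemma pflag_pprime: "pflag X Q ys \<Longrightarrow> pprime X Q"
  by (cases ys) auto

lemma pflag_polys: "pflag X Q ys \<Longrightarrow> y \<in> set ys \<Longrightarrow> y \<in> polys X"
  by (induction ys arbitrary: Q) auto

lemma ppow_polys: "(\<And>y. y \<in> set ys \<Longrightarrow> y \<in> polys X) \<Longrightarrow> ppow ys as \<in> polys X"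
  by (induction ys as rule: ppow.induct) (auto intro!: polys_mult polys_power)

lemma pflag_of_chain:
  assumes "\<And>l. l \<le> d \<Longrightarrow> pprime X (Q l)" "\<And>l. l < d \<Longrightarrow> Q l \<subset> Q (Suc l)"
  shows "\<exists>ys. length ys = d \<and> pflag X (Q 0) ys"
  using assms
proof (induction d arbitrary: Q)
  case 0
  then show ?case by simp
next
  case (Suc d)
  obtain ys where ys: "length ys = d" "pflag X (Q (Suc 0)) ys"
    using Suc.IH[of "\<lambda>l. Q (Suc l)", OF Suc.prems(1)[OF iffD2[OF Suc_le_mono]] Suc.prems(2)[OF iffD2[OF Suc_less_eq]]]
    by blast
  obtain y where y: "y \<in> Q (Suc 0)" "y \<notin> Q 0" using Suc.prems(2)[of 0] by auto
  have "y \<in> polys X" 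
    using pideal_subset[OF pprime_pideal[OF Suc.prems(1)[of "Suc 0"]] y(1)] by simp
  then have "pflag X (Q 0) (y # ys)" using Suc.prems(1)[of 0] Suc.prems(2)[of 0] ys(2) y by auto
  then show ?case using ys(1) by (intro exI[of _ "y # ys"]) simp
qed

text \<open>
  The coefficient of the lowest power of \<open>y\<^sub>1\<close> in an algebraic relation modulo \<open>Q\<^sub>0\<close> is a relation
  between \<open>y\<^sub>2, \<dots>, y\<^sub>d\<close> modulo \<open>Q\<^sub>1\<close>.
\<close>

lemma pflag_independent:
  fixes l :: "nat list \<Rightarrow> 'a::field"
  assumes "pflag X Q ys" "finite E" "\<And>as. as \<in> E \<Longrightarrow> length as = length ys"
    "(\<Sum>as\<in>E. single 0 (l as) * ppow ys as) \<in> Q" "as \<in> E"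
  shows "l as = 0"
  using assms
proof (induction ys arbitrary: Q E l as)
  case Nil
  then have E: "E = {[]}" "as = []" by force+
  have Q: "pprime X Q" using Nil by simp
  show ?case
  proof (rule ccontr)
    assume "l as \<noteq> 0"
    then have "single 0 (1 / l []) * single 0 (l []) = (1 :: 'a mpoly)"
      by (simp add: mult_single E)
    moreover have "single 0 (l []) \<in> Q" using Nil.prems(4) E by simp
    ultimately have "1 \<in> Q" using pideal_mult[OF pprime_pideal[OF Q] polys_const] by metis
    then show False using Q by (simp add: pprime_def)
  qed
next
  case (Cons y ys)
  from Cons.prems(1) obtain Q' where Q: "pprime X Q" "y \<in> polys X" "y \<notin> Q"
    and Q': "Q \<subseteq> Q'" "y \<in> Q'" "pflag X Q' ys" by auto
  have id': "pideal X Q'" using pflag_pprime[OF Q'(3)] pprime_pideal by blast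
  have yp: "ppow ys as \<in> polys X" for as
    by (rule ppow_polys) (rule pflag_polys[OF Q'(3)])
  have dec: "\<exists>a bs. as = a # bs \<and> length bs = length ys" if "as \<in> E" for as
    using Cons.prems(3)[OF that] by (cases as) auto
  show ?case
  proof (rule ccontr)
    assume las: "l as \<noteq> 0"
    define F where "F = {as \<in> E. l as \<noteq> 0}"
    have F: "finite F" "as \<in> F" "F \<subseteq> E" using Cons.prems las by (auto simp: F_def)
    \<comment> \<open>The lowest exponent of \<open>y\<close> among the terms with nonzero
      coefficient. As \<open>Q\<close> is prime and \<open>y\<close> is outside \<open>Q\<close>,
      the factor y^m can be cancelled.\<close>
    define m where "m = Min (hd ` F)"
    have m: "m \<le> hd bs" if "bs \<in> F" for bs using F(1) that by (simp add: m_def)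
    let ?t = "\<lambda>as. single 0 (l as) * (y ^ (hd as - m) * ppow ys (tl as))"
    define S where "S = (\<Sum>as\<in>F. ?t as)"
    have "(\<Sum>as\<in>E. single 0 (l as) * ppow (y # ys) as) = (\<Sum>as\<in>F. single 0 (l as) * ppow (y # ys) as)"
      using Cons.prems(2) by (intro sum.mono_neutral_right) (auto simp: F_def)
    also have "\<dots> = (\<Sum>as\<in>F. y ^ m * (single 0 (l as) * (y ^ (hd as - m) * ppow ys (tl as))))"
    proof (rule sum.cong[OF refl])
      fix as assume as: "as \<in> F"
      obtain a bs where ab: "as = a # bs" using dec F(3) as by blast
      have "y ^ a = y ^ m * y ^ (a - m)" using m[OF as] ab by (simp add: power_add[symmetric])
      then show "single 0 (l as) * ppow (y # ys) as =
        y ^ m * (single 0 (l as) * (y ^ (hd as - m) * ppow ys (tl as)))"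
        by (simp add: ab mult_ac)
    qed
    also have "\<dots> = y ^ m * S" by (simp add: S_def sum_distrib_left)
    finally have "y ^ m * S \<in> Q" using Cons.prems(4) by simp
    moreover have "S \<in> polys X" unfolding S_def
      by (intro polys_sum polys_mult polys_const polys_power Q(2) yp)
    ultimately have "S \<in> Q"
      using Q pprime_power[OF Q(1,2)] polys_power[OF Q(2)] unfolding pprime_def by blast
    then have SQ': "S \<in> Q'" using Q'(1) by blast
    define G where "G = {as \<in> F. hd as = m}"
    have GF: "G \<subseteq> F" "finite G" using F(1) by (auto simp: G_def)
    have S_eq: "S = (\<Sum>as\<in>G. ?t as)
        + (\<Sum>as\<in>F - G. ?t as)"
      unfolding S_def using sum.subset_diff[OF GF(1) F(1)] by (simp add: add.commute)
    \<comment> \<open>Terms with a higher power of \<open>y\<close> lie in \<open>Q'\<close>. What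
      survives modulo \<open>Q'\<close> are the terms with exponent exactly \<open>m\<close>, a
      relation between \<open>ys\<close> alone.\<close>
    have rest: "(\<Sum>as\<in>F - G. ?t as) \<in> Q'"
    proof (rule pideal_sum[OF id'])
      fix as assume as: "as \<in> F - G"
      then obtain j where j: "hd as - m = Suc j" using m[of as] by (cases "hd as - m") (auto simp: G_def)
      have "single 0 (l as) * (y ^ j * ppow ys (tl as)) * y \<in> Q'"
        by (intro pideal_mult[OF id' _ Q'(2)] polys_mult polys_const polys_power Q(2) yp)
      then show "single 0 (l as) * (y ^ (hd as - m) * ppow ys (tl as)) \<in> Q'"
        by (simp add: j mult_ac)
    qed
    have "(\<Sum>as\<in>G. ?t as) \<in> Q'"
      using pideal_diff[OF id' SQ' rest] unfolding S_eq add_diff_cancel_right' .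
    also have "(\<Sum>as\<in>G. ?t as) =
      (\<Sum>as\<in>G. single 0 (l (m # tl as)) * ppow ys (tl as))"
      using dec GF F by (intro sum.cong) (force simp: G_def)+
    also have "\<dots> = (\<Sum>bs\<in>tl ` G. single 0 (l (m # bs)) * ppow ys bs)"
    proof (rule sum.reindex[symmetric, unfolded o_def])
      show "inj_on tl G"
      proof (rule inj_onI)
        fix as bs assume "as \<in> G" "bs \<in> G" "tl as = tl bs"
        then show "as = bs" using dec[of as] dec[of bs] GF F(3) by (force simp: G_def)
      qed
    qed
    finally have *: "(\<Sum>bs\<in>tl ` G. single 0 (l (m # bs)) * ppow ys bs) \<in> Q'" .
    have "m \<in> hd ` F" unfolding m_def using F by (intro Min_in) auto
    then obtain bs where bs: "bs \<in> F" "hd bs = m" by auto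
    then have bsG: "bs \<in> G" by (simp add: G_def)
    have len: "length cs = length ys" if "cs \<in> tl ` G" for cs
      using that dec GF F(3) by force
    have "l (m # tl bs) = 0"
      by (rule Cons.IH[OF Q'(3) _ len *]) (use GF bsG in auto)
    moreover have "m # tl bs = bs" using dec[of bs] bs F(3) by fastforce
    ultimately show False using bs by (simp add: F_def)
  qed
qed

definition wdeg :: "(nat \<times> nat) set \<Rightarrow> ((nat \<times> nat) \<Rightarrow> nat) \<Rightarrow> mon \<Rightarrow> nat" where
  "wdeg X w u = (\<Sum>x\<in>X. lookup u x * w x)"

lemma wdeg_add: "wdeg X w (u + v) = wdeg X w u + wdeg X w v"
  by (simp add: wdeg_def lookup_add_mon algebra_simps sum.distrib)

definition standard_mons :: "(nat \<times> nat) set \<Rightarrow> ((nat \<times> nat) \<Rightarrow> nat) \<Rightarrow> mon set \<Rightarrow> nat \<Rightarrow> mon set" where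
  "standard_mons X w U t = {m. keys m \<subseteq> X \<and> (\<forall>u\<in>U. \<forall>v. m \<noteq> u + v) \<and> wdeg X w m \<le> t}"

lemma polys_spanned:
  fixes f :: "'a::field mpoly"
  assumes J: "pideal X J"
    and "\<And>k. k \<in> keys f \<Longrightarrow> \<exists>h. single k 1 - h \<in> J \<and> keys h \<subseteq> S"
  shows "\<exists>h. f - h \<in> J \<and> keys h \<subseteq> S"
proof -
  obtain h where h: "\<And>k. k \<in> keys f \<Longrightarrow> single k 1 - h k \<in> J \<and> keys (h k) \<subseteq> S"
    using assms(2) by metis
  let ?h = "\<Sum>k\<in>keys f. single 0 (lookup f k) * h k"
  have "f - ?h = (\<Sum>k\<in>keys f. single 0 (lookup f k) * (single k 1 - h k))"
    by (subst poly_sum_monomials[of f]) (simp add: sum_subtractf right_diff_distrib mult_single)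
  also have "\<dots> \<in> J"
    using h by (intro pideal_sum[OF J] pideal_mult[OF J] polys_const) auto
  finally have 1: "f - ?h \<in> J" .
  have "keys (single 0 a * g) \<subseteq> keys g" for a and g :: "'a mpoly"
    by (auto elim!: keys_multE split: if_splits)
  then have "keys ?h \<subseteq> S"
    using h by (intro order_trans[OF Poly_Mapping.keys_sum]) blast
  then show ?thesis using 1 by blast
qed

text \<open>Division with remainder: if \<open>u\<close> divides \<open>m\<close>, a multiple of the
  element of \<open>J\<close> led by \<open>u\<close> trades \<open>m\<close> for monomials of
  smaller weighted degree. The degree is a natural number, so this ends, and it never exceeds that
  of \<open>m\<close>.\<close>

lemma normal_form_monomial:
  assumes J: "pideal X J"
    and red: "\<And>u. u \<in> U \<Longrightarrow> \<exists>g\<in>J. u \<in> keys g \<and> (\<forall>v\<in>keys g - {u}. wdeg X w v < wdeg X w u)"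
    and "keys m \<subseteq> X"
  shows "\<exists>h :: 'a::field mpoly. single m 1 - h \<in> J \<and> keys h \<subseteq> standard_mons X w U (wdeg X w m)"
  using assms(3)
proof (induction "wdeg X w m" arbitrary: m rule: less_induct)
  case less
  show ?case
  proof (cases "\<exists>u\<in>U. \<exists>v. m = u + v")
    case False
    then have "m \<in> standard_mons X w U (wdeg X w m)"
      using less.prems by (auto simp: standard_mons_def)
    then show ?thesis using pideal_zero[OF J] by (intro exI[of _ "single m 1"]) simp
  next
    case True
    then obtain u v where uv: "u \<in> U" "m = u + v" by blast
    obtain g where g: "g \<in> J" "u \<in> keys g" "\<forall>v\<in>keys g - {u}. wdeg X w v < wdeg X w u"
      using red[OF uv(1)] by blast
    define c where "c = lookup g u"
    have c: "c \<noteq> 0" using g(2) by (simp add: c_def in_keys_iff)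
    define p where "p = single v (1 / c) * g"
    define q where "q = single v (1 / c) * (g - single u c)"
    have pq: "p = single m 1 + q"
      using c by (simp add: p_def q_def algebra_simps mult_single uv add.commute)
    have kv: "keys v \<subseteq> X" using less.prems by (simp add: uv keys_add_mon)
    have p: "p \<in> J" unfolding p_def by (intro pideal_mult[OF J] polys_single g kv)
    have keyg: "keys (g - single u c) \<subseteq> keys g - {u}"
      by (auto simp: in_keys_iff lookup_minus lookup_single c_def when_def split: if_splits)
    have small: "wdeg X w k < wdeg X w m \<and> keys k \<subseteq> X" if k: "k \<in> keys q" for k
    proof -
      obtain v' k' where "k = v' + k'" "v' \<in> keys (single v (1 / c))" "k' \<in> keys (g - single u c)"
        using k unfolding q_def by (rule keys_multE)
      then have k': "k = v + k'" "k' \<in> keys g - {u}" using keyg by (auto split: if_splits)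
      have "keys k' \<subseteq> X" using k' pideal_subset[OF J g(1)] polys_keysD by blast
      then show ?thesis using g(3) k' kv by (auto simp: wdeg_add uv keys_add_mon)
    qed
    have "\<exists>h. single k 1 - h \<in> J \<and> keys h \<subseteq> standard_mons X w U (wdeg X w m)"
      if k: "k \<in> keys q" for k
    proof -
      have "standard_mons X w U (wdeg X w k) \<subseteq> standard_mons X w U (wdeg X w m)"
        using small[OF k] by (auto simp: standard_mons_def)
      then show ?thesis using less.hyps[of k] small[OF k] by blast
    qed
    from polys_spanned[OF J this] obtain h where
      h: "q - h \<in> J" "keys h \<subseteq> standard_mons X w U (wdeg X w m)" by blast
    have "single m 1 - (- h) = p - (q - h)" by (simp add: pq)
    also have "\<dots> \<in> J" by (rule pideal_diff[OF J p h(1)])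
    finally show ?thesis using h(2) by (intro exI[of _ "- h"]) simp
  qed
qed

text \<open>Let \<open>e\<close> bound all exponents in \<open>U\<close>. The variables with
  exponent at least \<open>e\<close> in a standard monomial form a set S that supports no element of
  \<open>U\<close>, since such an element would divide the monomial. So S has at most
  \<open>d\<close> elements, with at most t + 1 exponents each, and every other variable has fewer
  than e + 1 choices.\<close>

lemma card_standard_mons:
  assumes X: "finite X" and w: "\<And>x. x \<in> X \<Longrightarrow> w x \<ge> 1"
    and e: "e \<ge> 1" "\<And>u x. u \<in> U \<Longrightarrow> lookup u x \<le> e"
    and indep: "\<And>S. S \<subseteq> X \<Longrightarrow> (\<And>u. u \<in> U \<Longrightarrow> \<not> keys u \<subseteq> S) \<Longrightarrow> card S \<le> d"
  shows "finite (standard_mons X w U t)"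
    and "card (standard_mons X w U t) \<le> 2 ^ card X * (e ^ card X * (t + 1) ^ d)"
proof -
  define I where "I = {S. S \<subseteq> X \<and> (\<forall>u\<in>U. \<not> keys u \<subseteq> S)}"
  define box where "box S x = (if x \<in> S then {..t} else {..<e})" for S and x :: "nat \<times> nat"
  define B where "B S = {m :: mon. keys m \<subseteq> X \<and> (\<forall>x\<in>X. lookup m x \<in> box S x)}" for S
  have finI: "finite I" using X by (auto simp: I_def)
  have inj: "inj_on (\<lambda>m :: mon. restrict (lookup m) X) (B S)" for S
    by (rule inj_on_subset[OF inj_on_restrict_lookup]) (auto simp: B_def)
  have im: "(\<lambda>m :: mon. restrict (lookup m) X) ` B S \<subseteq> PiE X (box S)" for S
    by (auto simp: B_def)
  have finP: "finite (PiE X (box S))" for S using X by (intro finite_PiE) (auto simp: box_def)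
  have finB: "finite (B S)" for S
    using finite_subset[OF im finP] inj finite_image_iff by blast
  have cardB: "card (B S) \<le> e ^ card X * (t + 1) ^ d" if S: "S \<in> I" for S
  proof -
    have SX: "S \<subseteq> X" "card S \<le> d" using S indep by (auto simp: I_def)
    have "card (B S) \<le> card (PiE X (box S))" by (rule card_inj_on_le[OF inj im finP])
    also have "\<dots> = (\<Prod>x\<in>X. card (box S x))" using X by (rule card_PiE)
    also have "\<dots> = (\<Prod>x\<in>X. if x \<in> S then t + 1 else e)"
      by (intro prod.cong) (auto simp: box_def)
    also have "\<dots> \<le> (\<Prod>x\<in>X. e * (if x \<in> S then t + 1 else 1))"
    proof (rule prod_mono)
      show "0 \<le> (if x \<in> S then t + 1 else e) \<and> (if x \<in> S then t + 1 else e) \<le> e * (if x \<in> S then t + 1 else 1)"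
        for x using mult_right_mono[OF e(1), of "t + 1"] by simp
    qed
    also have "\<dots> = e ^ card X * (\<Prod>x\<in>X. if x \<in> S then t + 1 else 1)"
      by (simp add: prod.distrib)
    also have "(\<Prod>x\<in>X. if x \<in> S then t + 1 else 1) = (t + 1) ^ card S"
      using X SX(1) by (simp add: prod.If_cases Int_absorb1 Int_def[symmetric] Collect_mem_eq)
    also have "(t + 1) ^ card S \<le> (t + 1) ^ d" using SX(2) by (intro power_increasing) auto
    finally show ?thesis by simp
  qed
  have sub: "standard_mons X w U t \<subseteq> (\<Union>S\<in>I. B S)"
  proof
    fix m assume m: "m \<in> standard_mons X w U t"
    define S where "S = {x \<in> X. lookup m x \<ge> e}"
    have le: "lookup m x \<le> t" if x: "x \<in> X" for x
    proof -
      have "lookup m x \<le> lookup m x * w x" using w[OF x] by simp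
      also have "\<dots> \<le> wdeg X w m" unfolding wdeg_def
        by (rule member_le_sum) (use x X in auto)
      finally show ?thesis using m by (simp add: standard_mons_def)
    qed
    have "\<not> keys u \<subseteq> S" if u: "u \<in> U" for u
    proof
      assume uS: "keys u \<subseteq> S"
      have "lookup u x \<le> lookup m x" for x
      proof (cases "x \<in> keys u")
        case True then show ?thesis using uS e(2)[OF u, of x] by (auto simp: S_def)
      qed (simp add: in_keys_iff)
      then obtain v where "m = u + v" using mon_le_obtain[of u m] by blast
      then show False using m u by (auto simp: standard_mons_def)
    qed
    then have "S \<in> I" by (auto simp: I_def S_def)
    moreover have "m \<in> B S" using m le by (auto simp: B_def S_def box_def standard_mons_def)
    ultimately show "m \<in> (\<Union>S\<in>I. B S)" by blast
  qed
  show "finite (standard_mons X w U t)"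
    using finite_subset[OF sub] finI finB by blast
  have "card (standard_mons X w U t) \<le> card (\<Union>S\<in>I. B S)"
    using sub finI finB by (intro card_mono) auto
  also have "\<dots> \<le> (\<Sum>S\<in>I. card (B S))" by (rule card_UN_le[OF finI])
  also have "\<dots> \<le> (\<Sum>S\<in>I. e ^ card X * (t + 1) ^ d)" by (intro sum_mono cardB)
  also have "\<dots> = card I * (e ^ card X * (t + 1) ^ d)" by simp
  also have "card I \<le> card (Pow X)" using X by (intro card_mono) (auto simp: I_def)
  also have "card (Pow X) = 2 ^ card X" using X by (rule card_Pow)
  finally show "card (standard_mons X w U t) \<le> 2 ^ card X * (e ^ card X * (t + 1) ^ d)" by simp
qed

lemma wdeg_power:
  assumes "\<And>k. k \<in> keys f \<Longrightarrow> wdeg X w k \<le> W" "k \<in> keys (f ^ n)"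
  shows "wdeg X w k \<le> n * W"
  using assms(2)
proof (induction n arbitrary: k)
  case 0 then show ?case by (simp add: wdeg_def)
next
  case (Suc n)
  then obtain a b where "k = a + b" "a \<in> keys f" "b \<in> keys (f ^ n)" by (auto elim!: keys_multE)
  then show ?case using Suc.IH[of b] assms(1)[of a] by (simp add: wdeg_add)
qed

lemma wdeg_ppow:
  assumes "\<And>y k. y \<in> set ys \<Longrightarrow> k \<in> keys y \<Longrightarrow> wdeg X w k \<le> W" "\<And>a. a \<in> set as \<Longrightarrow> a \<le> n"
    "k \<in> keys (ppow ys as)"
  shows "wdeg X w k \<le> length ys * (n * W)"
  using assms
proof (induction ys as arbitrary: k rule: ppow.induct)
  case (1 y ys a as)
  then obtain p q where k: "k = p + q" "p \<in> keys (y ^ a)" "q \<in> keys (ppow ys as)"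
    by (auto elim!: keys_multE)
  have "wdeg X w p \<le> a * W" by (rule wdeg_power[OF _ k(2)]) (use 1(2) in auto)
  also have "a * W \<le> n * W" using 1 by simp
  finally have "wdeg X w p \<le> n * W" .
  moreover have "wdeg X w q \<le> length ys * (n * W)"
    by (rule 1(1)[OF _ _ k(3)]) (use 1(2,3) in auto)
  ultimately show ?case by (simp add: k(1) wdeg_add)
qed (auto simp: wdeg_def)

text \<open>The products of the \<open>ys\<close> with all exponents below \<open>n\<close> reduce
  to combinations of the standard monomials in question. With fewer standard monomials than
  products, some nontrivial combination of the products would lie in \<open>J\<close>, against
  \<open>pflag_independent\<close>.\<close>

lemma pflag_card_standard_mons:
  fixes J :: "'a::field mpoly set"
  assumes J: "pideal X J" and flag: "pflag X Q ys" "J \<subseteq> Q"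
    and red: "\<And>u. u \<in> U \<Longrightarrow> \<exists>g\<in>J. u \<in> keys g \<and> (\<forall>v\<in>keys g - {u}. wdeg X w v < wdeg X w u)"
    and W: "\<And>y k. y \<in> set ys \<Longrightarrow> k \<in> keys y \<Longrightarrow> wdeg X w k \<le> W"
    and fin: "finite (standard_mons X w U (length ys * (n * W)))"
  shows "n ^ length ys \<le> card (standard_mons X w U (length ys * (n * W)))"
proof (rule ccontr)
  let ?B = "standard_mons X w U (length ys * (n * W))"
  assume less: "\<not> ?thesis"
  define E where "E = {as. set as \<subseteq> {..<n} \<and> length as = length ys}"
  have E: "finite E" "card E = n ^ length ys"
    unfolding E_def by (simp_all add: finite_lists_length_eq card_lists_length_eq)
  have poly: "ppow ys as \<in> polys X" for as
    by (rule ppow_polys) (rule pflag_polys[OF flag(1)])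
  have "\<exists>h. ppow ys as - h \<in> J \<and> keys h \<subseteq> ?B" if as: "as \<in> E" for as
  proof (rule polys_spanned[OF J])
    fix k assume k: "k \<in> keys (ppow ys as)"
    have "wdeg X w k \<le> length ys * (n * W)"
      by (rule wdeg_ppow[OF W _ k]) (use as in \<open>auto simp: E_def intro: less_imp_le\<close>)
    then have "standard_mons X w U (wdeg X w k) \<subseteq> ?B" by (auto simp: standard_mons_def)
    moreover have "\<exists>h :: 'a mpoly. single k 1 - h \<in> J \<and> keys h \<subseteq> standard_mons X w U (wdeg X w k)"
      by (rule normal_form_monomial[OF J red polys_keysD[OF poly k]])
    ultimately show "\<exists>h :: 'a mpoly. single k 1 - h \<in> J \<and> keys h \<subseteq> ?B" by blast
  qed
  then obtain h where h: "\<And>as. as \<in> E \<Longrightarrow> ppow ys as - h as \<in> J \<and> keys (h as) \<subseteq> ?B"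
    by metis
  have "\<exists>l. (\<exists>as\<in>E. l as \<noteq> 0) \<and> (\<forall>b\<in>?B. (\<Sum>as\<in>E. l as * lookup (h as) b) = 0)"
    by (rule homogeneous_system_nontrivial) (use fin E less in auto)
  then obtain l where l: "\<exists>as\<in>E. l as \<noteq> 0" "\<And>b. b \<in> ?B \<Longrightarrow> (\<Sum>as\<in>E. l as * lookup (h as) b) = 0"
    by blast
  have lk: "lookup (single 0 a * f) k = a * lookup f k" for a :: 'a and f and k :: mon
    by (simp add: mult_map_scale_conv_mult[symmetric] Poly_Mapping.map.rep_eq when_def)
  have "(\<Sum>as\<in>E. single 0 (l as) * h as) = 0"
  proof (rule poly_mapping_eqI)
    fix k
    show "lookup (\<Sum>as\<in>E. single 0 (l as) * h as) k = lookup 0 k"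
    proof (cases "k \<in> ?B")
      case True then show ?thesis using l(2) by (simp add: lookup_sum lk)
    next
      case False
      then have "lookup (h as) k = 0" if "as \<in> E" for as
        using h[OF that] by (auto simp: in_keys_iff)
      then show ?thesis by (simp add: lookup_sum lk)
    qed
  qed
  then have "(\<Sum>as\<in>E. single 0 (l as) * ppow ys as) = (\<Sum>as\<in>E. single 0 (l as) * (ppow ys as - h as))"
    by (simp add: right_diff_distrib sum_subtractf)
  also have "\<dots> \<in> J" using h by (intro pideal_sum[OF J] pideal_mult[OF J] polys_const) auto
  finally have "(\<Sum>as\<in>E. single 0 (l as) * ppow ys as) \<in> Q" using flag(2) by blast
  then have "l as = 0" if "as \<in> E" for as
    using pflag_independent[OF flag(1) E(1) _ _ that] by (auto simp: E_def)
  then show False using l(1) by blast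
qed

text \<open>Lower and upper counts of standard monomials, n^l and const * n^d, are compared for a
  suitable \<open>n\<close>; here l is the length of \<open>ys\<close>. With \<open>d\<close> the
  maximal size of an independent set this bounds the dimension from above.\<close>

lemma pflag_length_bound:
  fixes J :: "'a::field mpoly set"
  assumes X: "finite X" and w: "\<And>x. x \<in> X \<Longrightarrow> w x \<ge> 1"
    and J: "pideal X J" and flag: "pflag X Q ys" "J \<subseteq> Q"
    and U: "finite U"
    and red: "\<And>u. u \<in> U \<Longrightarrow> \<exists>g\<in>J. u \<in> keys g \<and> (\<forall>v\<in>keys g - {u}. wdeg X w v < wdeg X w u)"
    and indep: "\<And>S. S \<subseteq> X \<Longrightarrow> (\<And>u. u \<in> U \<Longrightarrow> \<not> keys u \<subseteq> S) \<Longrightarrow> card S \<le> d"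
  shows "length ys \<le> d"
proof (rule ccontr)
  assume d: "\<not> ?thesis"
  define e where "e = (\<Sum>u\<in>U. \<Sum>x\<in>keys u. lookup u x) + 1"
  have e: "lookup u x \<le> e" if u: "u \<in> U" for u x
  proof (cases "x \<in> keys u")
    case True
    then have "lookup u x \<le> (\<Sum>x\<in>keys u. lookup u x)" by (intro member_le_sum) auto
    also have "\<dots> \<le> (\<Sum>u\<in>U. \<Sum>x\<in>keys u. lookup u x)"
      by (rule member_le_sum[where f = "\<lambda>u. \<Sum>x\<in>keys u. lookup u x"]) (use u U in auto)
    finally show ?thesis by (simp add: e_def)
  qed (simp add: in_keys_iff)
  have e1: "e \<ge> 1" by (simp add: e_def)
  note card = card_standard_mons[OF X w e1 e indep]
  define W where "W = (\<Sum>y\<in>set ys. \<Sum>k\<in>keys y. wdeg X w k)"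
  have W: "wdeg X w k \<le> W" if "y \<in> set ys" "k \<in> keys y" for y k
  proof -
    have "wdeg X w k \<le> (\<Sum>k\<in>keys y. wdeg X w k)" using that by (intro member_le_sum) auto
    also have "\<dots> \<le> W" unfolding W_def
      by (rule member_le_sum[where f = "\<lambda>y. \<Sum>k\<in>keys y. wdeg X w k"]) (use that in auto)
    finally show ?thesis .
  qed
  \<comment> \<open>As l n W + 1 <= n (l W + 1) for n >= 1, the upper count is at most n^d C, which
    n = C + 1 contradicts.\<close>
  define C where "C = 2 ^ card X * e ^ card X * (length ys * W + 1) ^ d"
  define n where "n = C + 1"
  have n: "n \<ge> 1" by (simp add: n_def)
  have "n ^ d * n \<le> n ^ length ys"
    using d n power_increasing[of "Suc d" "length ys" n] by (simp add: mult.commute)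
  also have "\<dots> \<le> card (standard_mons X w U (length ys * (n * W)))"
    by (rule pflag_card_standard_mons[OF J flag red W card(1)])
  also have "\<dots> \<le> 2 ^ card X * (e ^ card X * (length ys * (n * W) + 1) ^ d)" by (rule card(2))
  also have "\<dots> \<le> 2 ^ card X * (e ^ card X * (n * (length ys * W + 1)) ^ d)"
    using n by (intro mult_left_mono power_mono) (auto simp: algebra_simps)
  also have "\<dots> = n ^ d * C" by (simp only: C_def power_mult_distrib mult_ac)
  finally have "n \<le> C" using n by simp
  then show False by (simp add: n_def)
qed

section \<open>Integer weights satisfying finitely many strict inequalities\<close>

section \<open>Weights realizing finitely many comparisons\<close>

lemma finite_separation:
  fixes A B :: "'a::{linordered_field} set"
  assumes "finite A" "finite B" "\<And>a b. a \<in> A \<Longrightarrow> b \<in> B \<Longrightarrow> a < b"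
  shows "\<exists>q. (\<forall>a\<in>A. a < q) \<and> (\<forall>b\<in>B. q < b)"
proof -
  consider "A = {}" "B = {}" | "A = {}" "B \<noteq> {}" | "A \<noteq> {}" "B = {}" | "A \<noteq> {}" "B \<noteq> {}" by blast
  then show ?thesis
  proof cases
    case 1 then show ?thesis by simp
  next
    case 2
    have "Min B - 1 < b" if "b \<in> B" for b
      using Min_le[OF assms(2) that] by (metis diff_add_cancel le_less_trans less_add_one not_le add_le_cancel_right leD less_le_trans linorder_not_le)
    then show ?thesis using 2 by (intro exI[of _ "Min B - 1"]) auto
  next
    case 3
    have "a < Max A + 1" if "a \<in> A" for a
      using Max_ge[OF assms(1) that] by (rule le_less_trans) simp
    then show ?thesis using 3 by (intro exI[of _ "Max A + 1"]) auto
  next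
    case 4
    then have "Max A < Min B" using assms by simp
    then obtain q where "Max A < q" "q < Min B" using dense by blast
    then show ?thesis using 4 assms(1,2) by (intro exI[of _ q]) auto
  qed
qed

lemma additive_closed_multiple:
  fixes P :: "('x \<Rightarrow> int) set"
  assumes P: "\<And>d e. d \<in> P \<Longrightarrow> e \<in> P \<Longrightarrow> (\<lambda>x. d x + e x) \<in> P"
    and "d \<in> P" "k > 0"
  shows "(\<lambda>x. k * d x) \<in> P"
proof -
  have "(\<lambda>x. int (Suc n) * d x) \<in> P" for n
  proof (induction n)
    case 0 then show ?case using assms(2) by simp
  next
    case (Suc n)
    then show ?case using P[OF Suc assms(2)] by (simp add: algebra_simps)
  qed
  from this[of "nat (k - 1)"] show ?thesis using assms(3) by simp
qed

text \<open>Fourier-Motzkin elimination of the variable \<open>x\<close>.\<close>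

lemma positive_functional_exists:
  fixes P :: "('x \<Rightarrow> int) set"
  assumes "finite X" "finite D" "D \<subseteq> P" "\<And>d e. d \<in> P \<Longrightarrow> e \<in> P \<Longrightarrow> (\<lambda>x. d x + e x) \<in> P"
    "\<And>d. d \<in> P \<Longrightarrow> \<exists>x\<in>X. d x \<noteq> 0"
  shows "\<exists>w. \<forall>d\<in>D. (\<Sum>x\<in>X. w x * d x) > 0"
  using assms
proof (induction X arbitrary: D P rule: finite_induct)
  case empty
  then show ?case by blast
next
  case (insert x X)
  define Dp where "Dp = {d \<in> D. d x > 0}"
  define Dn where "Dn = {d \<in> D. d x < 0}"
  \<comment> \<open>A positive combination in which the coefficient of \<open>x\<close> cancels. It
    stays in \<open>P\<close>, so it is nonzero on the remaining variables; this is what excludes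
    contradictory constraints.\<close>
  define cmb :: "('x \<Rightarrow> int) \<Rightarrow> ('x \<Rightarrow> int) \<Rightarrow> 'x \<Rightarrow> int"
    where "cmb d e = (\<lambda>y. d x * e y + - e x * d y)" for d e
  define D' where "D' = {d \<in> D. d x = 0} \<union> (\<lambda>(d, e). cmb d e) ` (Dp \<times> Dn)"
  define P' where "P' = {p \<in> P. p x = 0}"
  have fin: "finite Dp" "finite Dn" using insert.prems(1) by (auto simp: Dp_def Dn_def)
  have "cmb d e \<in> P'" if de: "d \<in> Dp" "e \<in> Dn" for d e
  proof -
    have "cmb d e \<in> P" unfolding cmb_def
      by (intro insert.prems(3) additive_closed_multiple[OF insert.prems(3)])
        (use de insert.prems(2) in \<open>auto simp: Dp_def Dn_def\<close>)
    then show ?thesis by (simp add: P'_def cmb_def)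
  qed
  then have "D' \<subseteq> P'" using insert.prems(2) by (auto simp: D'_def P'_def)
  moreover have "finite D'" using fin insert.prems(1) by (auto simp: D'_def)
  moreover have "\<exists>y\<in>X. p y \<noteq> 0" if "p \<in> P'" for p
    using that insert.prems(4)[of p] by (auto simp: P'_def)
  moreover have "(\<lambda>x. d x + e x) \<in> P'" if "d \<in> P'" "e \<in> P'" for d e
    using that insert.prems(3) by (auto simp: P'_def)
  ultimately obtain w where w: "\<And>d. d \<in> D' \<Longrightarrow> (\<Sum>y\<in>X. w y * d y) > 0"
    using insert.IH[of D' P'] by blast
  define s where "s d = (\<Sum>y\<in>X. w y * d y)" for d
  \<comment> \<open>The value of the weight at \<open>x\<close> at which the constraint of
    \<open>d\<close> becomes an equality: a lower bound if d x > 0, an upper bound if d x <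
    0.\<close>
  define lo where "lo d = - rat_of_int (s d) / rat_of_int (d x)" for d
  have lt: "lo d < lo e" if de: "d \<in> Dp" "e \<in> Dn" for d e
  proof -
    have "0 < s (cmb d e)"
      unfolding s_def by (rule w) (use de in \<open>auto simp: D'_def\<close>)
    also have "s (cmb d e) = d x * s e + - e x * s d"
      by (simp add: s_def cmb_def sum_distrib_left sum.distrib[symmetric] algebra_simps flip: sum_subtractf)
    finally have "0 < d x * s e - e x * s d" by simp
    then have "0 < rat_of_int (d x) * rat_of_int (s e) - rat_of_int (e x) * rat_of_int (s d)"
      by (metis of_int_0_less_iff of_int_diff of_int_mult)
    then show ?thesis using de by (simp add: lo_def Dp_def Dn_def field_simps)
  qed
  obtain q where q: "\<And>d. d \<in> Dp \<Longrightarrow> lo d < q" "\<And>e. e \<in> Dn \<Longrightarrow> q < lo e"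
    using finite_separation[OF finite_imageI[OF fin(1)] finite_imageI[OF fin(2)], of lo lo] lt by fastforce
  obtain a k where ak: "quotient_of q = (a, k)" by fastforce
  have k: "k > 0" using quotient_of_denom_pos[OF ak] .
  have qk: "q = rat_of_int a / rat_of_int k" using quotient_of_div[OF ak] .
  \<comment> \<open>Scaling by the denominator \<open>k\<close> of the rational value
    \<open>q\<close> makes the weight integral.\<close>
  define v where "v y = (if y = x then a else k * w y)" for y
  have sum: "(\<Sum>y\<in>insert x X. v y * d y) = a * d x + k * s d" for d
  proof -
    have "(\<Sum>y\<in>X. v y * d y) = (\<Sum>y\<in>X. k * (w y * d y))"
      using insert.hyps by (intro sum.cong) (auto simp: v_def)
    then show ?thesis using insert.hyps by (simp add: s_def sum_distrib_left v_def)
  qed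
  have "a * d x + k * s d > 0" if d: "d \<in> D" for d
  proof -
    consider "d x = 0" | "d \<in> Dp" | "d \<in> Dn" using d by (force simp: Dp_def Dn_def)
    then show ?thesis
    proof cases
      case 1
      then have "d \<in> D'" using d by (simp add: D'_def)
      then show ?thesis using w[of d] k 1 by (simp add: s_def)
    next
      case 2
      then have "0 < rat_of_int (d x)" by (simp add: Dp_def)
      then have "0 < rat_of_int a * rat_of_int (d x) + rat_of_int k * rat_of_int (s d)"
        using q(1)[OF 2] k by (simp add: lo_def qk field_simps)
      then show ?thesis by (metis of_int_0_less_iff of_int_add of_int_mult)
    next
      case 3
      then have "rat_of_int (d x) < 0" by (simp add: Dn_def)
      then have "0 < rat_of_int a * rat_of_int (d x) + rat_of_int k * rat_of_int (s d)"
        using q(2)[OF 3] k by (simp add: lo_def qk field_simps)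
      then show ?thesis by (metis of_int_0_less_iff of_int_add of_int_mult)
    qed
  qed
  then show ?case by (intro exI[of _ v]) (simp add: sum)
qed


section \<open>Generic freeness and long prime chains\<close>

section \<open>Prime chains over an ideal avoiding a polynomial subring\<close>

abbreviation var_poly :: "nat \<times> nat \<Rightarrow> 'a::field mpoly" where
  "var_poly x \<equiv> single (single x 1) 1"

lemma single_one_nonzero: "single u (1 :: 'a::zero_neq_one) \<noteq> 0"
  by (metis lookup_single_eq lookup_zero zero_neq_one)

lemma polys_var: "x \<in> X \<Longrightarrow> var_poly x \<in> polys X"
  by (rule polys_single) simp

text \<open>
  Products of nonzero polynomials are nonzero by the \<open>idom\<close> instance for \<open>mpoly\<close>, which needs the
  linear order on variables from \<open>Product_Lexorder\<close>.
\<close>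

lemma degree_in_variable_mult:
  fixes p q :: "'a::field mpoly"
  assumes u: "u \<in> keys p" and q: "q \<noteq> 0"
  shows "\<exists>v\<in>keys (p * q). lookup u t \<le> lookup v t"
proof -
  define deg :: "'a mpoly \<Rightarrow> nat" where "deg f = Max ((\<lambda>u. lookup u t) ` keys f)" for f
  define top where "top f = restr_poly {u. lookup u t = deg f} f" for f
  define low where "low f = restr_poly (- {u. lookup u t = deg f}) f" for f
  have split: "f = top f + low f" for f unfolding top_def low_def by (rule restr_poly_split)
  have le: "lookup v t \<le> deg f" if "v \<in> keys f" for v f
    unfolding deg_def using that by (intro Max_ge) auto
  have low: "lookup v t < deg f" if "v \<in> keys (low f)" for v f
    using that le[of v f] by (auto simp: low_def keys_restr_poly)
  have top: "lookup v t = deg f" if "v \<in> keys (top f)" for v f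
    using that by (auto simp: top_def keys_restr_poly)
  have top_nz: "top f \<noteq> 0" if "f \<noteq> 0" for f
  proof -
    have "deg f \<in> (\<lambda>u. lookup u t) ` keys f" unfolding deg_def using that by (intro Max_in) auto
    then obtain v where v: "v \<in> keys f" "lookup v t = deg f" by auto
    then have "v \<in> keys (top f)" by (simp add: top_def keys_restr_poly)
    then show ?thesis by auto
  qed
  have "p \<noteq> 0" using u by auto
  then have "top p * top q \<noteq> 0" using top_nz q by simp
  then obtain v where v: "v \<in> keys (top p * top q)" by (metis keys_eq_empty all_not_in_conv)
  have vdeg: "lookup v t = deg p + deg q"
    using v by (auto elim!: keys_multE simp: lookup_add_mon top)
  \<comment> \<open>Only the first summand reaches degree deg p + deg q in \<open>t\<close>, and it
    is nonzero because the polynomials form a domain.\<close>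
  have "p * q = top p * top q + (low p * q + top p * low q)"
  proof -
    have "p * q = (top p + low p) * q" "top p * q = top p * (top q + low q)"
      using split by simp_all
    then show ?thesis by (simp add: algebra_simps)
  qed
  moreover have "v \<notin> keys (low p * q)"
  proof
    assume "v \<in> keys (low p * q)"
    then obtain a b where "v = a + b" "a \<in> keys (low p)" "b \<in> keys q" by (rule keys_multE)
    then show False using vdeg low[of a p] le[of b q] by (simp add: lookup_add_mon)
  qed
  moreover have "v \<notin> keys (top p * low q)"
  proof
    assume "v \<in> keys (top p * low q)"
    then obtain a b where "v = a + b" "a \<in> keys (top p)" "b \<in> keys (low q)" by (rule keys_multE)
    then show False using vdeg top[of a p] low[of b q] by (simp add: lookup_add_mon)
  qed
  ultimately have "v \<in> keys (p * q)" using v by (simp add: in_keys_iff lookup_add)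
  then show ?thesis using vdeg le[OF u] by (intro bexI[of _ v]) auto
qed

text \<open>Read \<open>f\<close> as a polynomial in \<open>x\<close> over K[T]: \<open>h\<close> is
  the leading coefficient, \<open>e\<close> the degree, and -\<open>q\<close> collects the lower
  terms.\<close>

lemma leading_coefficient_relation:
  fixes f :: "'a::field mpoly"
  assumes f: "f \<in> polys (insert x T)" "f \<noteq> 0" and x: "x \<notin> T"
  obtains h e q where "h \<in> polys T" "h \<noteq> 0" "q \<in> polys (insert x T)"
    "\<And>k. k \<in> keys q \<Longrightarrow> lookup k x < e" "f = h * single (single x e) 1 - q"
proof -
  define e where "e = Max ((\<lambda>u. lookup u x) ` keys f)"
  define A where "A = {u :: mon. lookup u x = e}"
  define h where "h = (\<Sum>u\<in>keys f \<inter> A. single (u - single x e) (lookup f u))"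
  define q where "q = - restr_poly (- A) f"
  have dec: "u = (u - single x e) + single x e" if "u \<in> A" for u
    using that by (intro poly_mapping_eqI) (auto simp: A_def lookup_add lookup_minus lookup_single when_def)
  have keyu: "keys (u - single x e) \<subseteq> T" if "u \<in> keys f \<inter> A" for u
  proof
    fix y assume "y \<in> keys (u - single x e)"
    then have "y \<noteq> x" "y \<in> keys u"
      using that by (auto simp: in_keys_iff lookup_minus lookup_single A_def when_def split: if_splits)
    then show "y \<in> T" using that polys_keysD[OF f(1), of u] by blast
  qed
  have "h * single (single x e) 1 = (\<Sum>u\<in>keys f \<inter> A. single u (lookup f u))"
    unfolding h_def sum_distrib_right by (intro sum.cong) (auto simp: mult_single dec[symmetric])
  also have "\<dots> = restr_poly A f"
    by (subst (3) poly_sum_monomials)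
      (auto simp: keys_restr_poly lookup_restr_poly intro!: sum.cong)
  finally have hA: "h * single (single x e) 1 = restr_poly A f" .
  have "e \<in> (\<lambda>u. lookup u x) ` keys f" unfolding e_def using f by (intro Max_in) auto
  then obtain v where "v \<in> keys (restr_poly A f)" by (auto simp: A_def keys_restr_poly)
  then have "h \<noteq> 0" using hA by auto
  have "h \<in> polys T" unfolding h_def by (intro polys_sum polys_single keyu)
  moreover note \<open>h \<noteq> 0\<close>
  moreover have "q \<in> polys (insert x T)"
    using f(1) by (auto simp: q_def polys_def keys_restr_poly)
  moreover have "lookup k x < e" if "k \<in> keys q" for k
  proof -
    have "k \<in> keys f" "lookup k x \<noteq> e" using that by (auto simp: q_def keys_restr_poly A_def)
    moreover from this have "lookup k x \<le> e" unfolding e_def by (intro Max_ge) auto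
    ultimately show ?thesis by simp
  qed
  moreover have "f = h * single (single x e) 1 - q"
    using restr_poly_split[of f A] by (simp add: hA q_def)
  ultimately show ?thesis by (rule that)
qed

definition tmodule :: "(nat \<times> nat) set \<Rightarrow> 'a::field mpoly set \<Rightarrow> bool" where
  "tmodule T M \<longleftrightarrow> 0 \<in> M \<and> (\<forall>f\<in>M. \<forall>g\<in>M. f + g \<in> M) \<and> (\<forall>p\<in>polys T. \<forall>g\<in>M. p * g \<in> M)"

text \<open>For a K[T]-module \<open>M\<close> and \<open>h\<close> in K[T]: the class of
  \<open>f\<close> lies in the image of \<open>M\<close> in the localization (K[X]/J)_h, written
  without denominators.\<close>

definition loc_in :: "'a::field mpoly \<Rightarrow> 'a mpoly set \<Rightarrow> 'a mpoly set \<Rightarrow> 'a mpoly \<Rightarrow> bool" where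
  "loc_in h J M f \<longleftrightarrow> (\<exists>k. \<exists>g\<in>M. h ^ k * f - g \<in> J)"

lemma loc_in_cancel:
  assumes "loc_in h J M (h * f)"
  shows "loc_in h J M f"
proof -
  obtain k a where ab: "a \<in> M" "h ^ k * (h * f) - a \<in> J"
    using assms unfolding loc_in_def by blast
  then have "h ^ Suc k * f - a \<in> J" by (simp add: mult_ac)
  then show ?thesis using ab(1) unfolding loc_in_def by blast
qed

context
  fixes X T :: "(nat \<times> nat) set" and J M :: "'a::field mpoly set" and h :: "'a mpoly"
  assumes J: "pideal X J" and M: "tmodule T M" and T: "T \<subseteq> X" and h: "h \<in> polys T"
begin

lemma TX: "p \<in> polys T \<Longrightarrow> p \<in> polys X"
  using polys_mono[OF T] by blast

lemma loc_in_zero: "loc_in h J M 0"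
  using M pideal_zero[OF J] unfolding loc_in_def tmodule_def by (intro exI[of _ 0] bexI[of _ 0]) auto

lemma loc_in_add:
  assumes "loc_in h J M f" "loc_in h J M g"
  shows "loc_in h J M (f + g)"
proof -
  obtain k a l b where ab: "a \<in> M" "h ^ k * f - a \<in> J" "b \<in> M" "h ^ l * g - b \<in> J"
    using assms unfolding loc_in_def by blast
  have "h ^ (k + l) * (f + g) - (h ^ l * a + h ^ k * b) = h ^ l * (h ^ k * f - a) + h ^ k * (h ^ l * g - b)"
    by (simp add: algebra_simps power_add)
  also have "\<dots> \<in> J" using ab h TX by (intro pideal_add[OF J] pideal_mult[OF J] polys_power) auto
  finally show ?thesis
    using ab M h polys_power[OF h] unfolding loc_in_def tmodule_def by blast
qed

lemma loc_in_sum: "(\<And>a. a \<in> A \<Longrightarrow> loc_in h J M (f a)) \<Longrightarrow> loc_in h J M (sum f A)"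
  by (induction A rule: infinite_finite_induct) (auto intro: loc_in_add loc_in_zero)

lemma loc_in_scale:
  assumes "loc_in h J M f" "p \<in> polys T"
  shows "loc_in h J M (p * f)"
proof -
  obtain k a where ab: "a \<in> M" "h ^ k * f - a \<in> J"
    using assms unfolding loc_in_def by blast
  have "h ^ k * (p * f) - p * a = p * (h ^ k * f - a)" by (simp add: algebra_simps)
  also have "\<dots> \<in> J" using ab assms TX by (intro pideal_mult[OF J]) auto
  finally show ?thesis
    using ab M assms(2) unfolding loc_in_def tmodule_def by blast
qed

lemma loc_in_cong:
  assumes "loc_in h J M f" "g - f \<in> J"
  shows "loc_in h J M g"
proof -
  obtain k a where ab: "a \<in> M" "h ^ k * f - a \<in> J"
    using assms unfolding loc_in_def by blast
  have "h ^ k * g - a = h ^ k * (g - f) + (h ^ k * f - a)" by (simp add: algebra_simps)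
  also have "\<dots> \<in> J"
    using ab assms TX[OF polys_power[OF h]] by (intro pideal_add[OF J] pideal_mult[OF J]) auto
  finally show ?thesis using ab(1) unfolding loc_in_def by blast
qed

lemma loc_in_monomials:
  assumes "\<And>u. u \<in> keys f \<Longrightarrow> loc_in h J M (single u 1)"
  shows "loc_in h J M f"
proof -
  have "loc_in h J M (\<Sum>u\<in>keys f. single 0 (lookup f u) * single u 1)"
    by (intro loc_in_sum loc_in_scale assms polys_const)
  then show ?thesis by (subst poly_sum_monomials) (simp add: mult_single)
qed

end

definition monomials_independent ::
    "(nat \<times> nat) set \<Rightarrow> 'a::field mpoly set \<Rightarrow> mon set \<Rightarrow> bool" where
  "monomials_independent T J B \<longleftrightarrow> (\<forall>p. (\<forall>b\<in>B. p b \<in> polys T) \<longrightarrow>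
     (\<Sum>b\<in>B. p b * single b 1) \<in> J \<longrightarrow> (\<forall>b\<in>B. p b = 0))"

definition monomials_span :: "(nat \<times> nat) set \<Rightarrow> mon set \<Rightarrow> 'a::field mpoly set" where
  "monomials_span T B = {\<Sum>b\<in>B. p b * single b 1 | p. \<forall>b\<in>B. p b \<in> polys T}"

lemma tmodule_monomials_span: "tmodule T (monomials_span T B)"
proof -
  have "0 \<in> monomials_span T B"
    unfolding monomials_span_def by (intro CollectI exI[of _ "\<lambda>_. 0"]) auto
  moreover have "f + g \<in> monomials_span T B"
    if fg: "f \<in> monomials_span T B" "g \<in> monomials_span T B" for f g
  proof -
    obtain p q where "f = (\<Sum>b\<in>B. p b * single b 1)" "\<forall>b\<in>B. p b \<in> polys T"
      "g = (\<Sum>b\<in>B. q b * single b 1)" "\<forall>b\<in>B. q b \<in> polys T"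
      using fg unfolding monomials_span_def by blast
    then show ?thesis unfolding monomials_span_def
      by (intro CollectI exI[of _ "\<lambda>b. p b + q b"]) (auto simp: sum.distrib distrib_right polys_add)
  qed
  moreover have "p * g \<in> monomials_span T B" if pg: "p \<in> polys T" "g \<in> monomials_span T B" for p g
  proof -
    obtain q where "g = (\<Sum>b\<in>B. q b * single b 1)" "\<forall>b\<in>B. q b \<in> polys T"
      using pg unfolding monomials_span_def by blast
    then show ?thesis unfolding monomials_span_def using pg(1)
      by (intro CollectI exI[of _ "\<lambda>b. p * q b"]) (auto simp: sum_distrib_left mult.assoc polys_mult)
  qed
  ultimately show ?thesis by (auto simp: tmodule_def)
qed

text \<open>
  The variables outside a maximal \<open>T\<close> with \<open>J \<inter> K[T] = 0\<close> are algebraic over \<open>K[T]\<close> modulo \<open>J\<close>.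
\<close>

lemma generic_finiteness:
  fixes J :: "'a::field mpoly set"
  assumes X: "finite X" and J: "pideal X J" and T: "T \<subseteq> X"
    and JT: "J \<inter> polys T = {0}"
    and max: "\<And>x. x \<in> X - T \<Longrightarrow> J \<inter> polys (insert x T) \<noteq> {0}"
  obtains h e where "h \<in> polys T" "h \<noteq> 0" "\<And>x. x \<in> X - T \<Longrightarrow> e x \<ge> (1 :: nat)"
    "\<And>f. f \<in> polys X \<Longrightarrow> loc_in h J {g \<in> polys X. \<forall>u\<in>keys g. \<forall>x\<in>X - T. lookup u x < e x} f"
proof -
  have "\<exists>h e q. h \<in> polys T \<and> h \<noteq> 0 \<and> q \<in> polys (insert x T) \<and> (\<forall>k\<in>keys q. lookup k x < e) \<and>
    h * single (single x e) 1 - q \<in> J" if x: "x \<in> X - T" for x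
  proof -
    obtain f where f: "f \<in> J" "f \<in> polys (insert x T)" "f \<noteq> 0"
      using max[OF x] pideal_zero[OF J] by fastforce
    have "x \<notin> T" using x by simp
    from leading_coefficient_relation[OF f(2,3) this] f(1) show ?thesis by metis
  qed
  then obtain h e q where heq: "\<And>x. x \<in> X - T \<Longrightarrow> h x \<in> polys T \<and> h x \<noteq> 0 \<and> q x \<in> polys (insert x T) \<and>
    (\<forall>k\<in>keys (q x). lookup k x < e x) \<and> h x * single (single x (e x)) 1 - q x \<in> J" by metis
  \<comment> \<open>Inverting all leading coefficients at once makes each variable outside
    \<open>T\<close> integral modulo \<open>J\<close>.\<close>
  define H where "H = (\<Prod>x\<in>X - T. h x)"
  have H: "H \<in> polys T" "H \<noteq> 0"
    using heq X by (auto simp: H_def intro!: polys_prod)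
  \<comment> \<open>An exponent 0 would put the nonzero \<open>h x\<close> into both
    \<open>J\<close> and K[T].\<close>
  have e: "e x \<ge> 1" if x: "x \<in> X - T" for x
  proof (rule ccontr)
    assume "\<not> ?thesis"
    then have e0: "e x = 0" by simp
    then have "q x = 0" using heq[OF x] by (metis keys_eq_empty all_not_in_conv not_less_zero)
    then have "h x \<in> J" using heq[OF x] e0 by simp
    then show False using JT heq[OF x] by blast
  qed
  define M :: "'a mpoly set" where "M = {g \<in> polys X. \<forall>u\<in>keys g. \<forall>x\<in>X - T. lookup u x < e x}"
  have M: "tmodule T M"
    unfolding tmodule_def
  proof (intro conjI ballI)
    show "0 \<in> M" by (simp add: M_def)
    show "f + g \<in> M" if "f \<in> M" "g \<in> M" for f g
      using that Poly_Mapping.keys_add[of f g] by (auto simp: M_def polys_add)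
    show "p * g \<in> M" if p: "p \<in> polys T" "g \<in> M" for p g
    proof -
      have "lookup u x < e x" if u: "u \<in> keys (p * g)" and x: "x \<in> X - T" for u x
      proof -
        obtain a b where ab: "u = a + b" "a \<in> keys p" "b \<in> keys g" using u by (rule keys_multE)
        have "lookup a x = 0" using polys_keysD[OF p(1) ab(2)] x by (auto simp: in_keys_iff)
        then show ?thesis using p(2) ab x by (auto simp: M_def lookup_add_mon)
      qed
      moreover have "p * g \<in> polys X" using p polys_mono[OF T] by (auto simp: M_def intro!: polys_mult)
      ultimately show ?thesis by (auto simp: M_def)
    qed
  qed
  note li = J M T H(1)
  \<comment> \<open>Replacing x^(e x) by means of \<open>q x\<close> lowers this degree, because
    \<open>q x\<close> involves no variable outside \<open>T\<close> except \<open>x\<close>, and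
    that to a lower power.\<close>
  define D where "D u = (\<Sum>x\<in>X - T. lookup u x)" for u :: mon
  have mono: "loc_in H J M (single u 1)" if "keys u \<subseteq> X" for u
    using that
  proof (induction "D u" arbitrary: u rule: less_induct)
    case less
    show ?case
    proof (cases "\<forall>x\<in>X - T. lookup u x < e x")
      case True
      then have "single u 1 \<in> M" using less.prems by (auto simp: M_def intro: polys_single)
      then show ?thesis unfolding loc_in_def using pideal_zero[OF J]
        by (intro exI[of _ 0] bexI[of _ "single u 1"]) auto
    next
      case False
      then obtain x where x: "x \<in> X - T" "lookup u x \<ge> e x" by force
      have "lookup (single x (e x)) y \<le> lookup u y" for y
        using x(2) by (auto simp: lookup_single when_def)
      from mon_le_obtain[OF this] obtain v where v: "u = single x (e x) + v" by metis
      have vX: "keys v \<subseteq> X" using less.prems by (simp add: v keys_add_mon)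
      \<comment> \<open>The relation for \<open>x\<close> supplies only the factor
        \<open>h x\<close> of \<open>H\<close>; \<open>?P\<close> supplies the others.\<close>
      let ?P = "\<Prod>y\<in>X - T - {x}. h y"
      have P: "?P \<in> polys T" using heq by (intro polys_prod) auto
      have "loc_in H J M (single v 1 * q x)"
      proof (rule loc_in_monomials[OF li])
        fix k assume "k \<in> keys (single v 1 * q x)"
        then obtain a b where ab: "k = a + b" "a \<in> keys (single v (1::'a))" "b \<in> keys (q x)"
          by (rule keys_multE)
        then have k: "k = v + b" by (auto split: if_splits)
        have bT: "keys b \<subseteq> insert x T" using heq[OF x(1)] ab(3) polys_keysD by blast
        have D1: "D w = lookup w x + (\<Sum>y\<in>X - T - {x}. lookup w y)" for w
          unfolding D_def using X x(1) by (intro sum.remove) auto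
        have "(\<Sum>y\<in>X - T - {x}. lookup b y) = 0"
        proof (intro sum.neutral ballI)
          fix y assume "y \<in> X - T - {x}"
          then have "y \<notin> keys b" using bT by blast
          then show "lookup b y = 0" by (simp add: in_keys_iff)
        qed
        then have Db: "D b < e x" using D1[of b] heq[OF x(1)] ab(3) by auto
        have "(\<Sum>y\<in>X - T - {x}. lookup (single x (e x)) y) = 0"
          by (intro sum.neutral) (auto simp: lookup_single when_def)
        then have "D (single x (e x)) = e x" using D1[of "single x (e x)"] by simp
        then have "D k < D u" using Db by (simp add: k v D_def lookup_add_mon sum.distrib)
        moreover have "keys k \<subseteq> X" using vX bT x(1) T by (auto simp: k keys_add_mon)
        ultimately show "loc_in H J M (single k 1)" by (rule less.hyps)
      qed
      then have "loc_in H J M (?P * (single v 1 * q x))" by (rule loc_in_scale[OF li _ P])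
      moreover have "H * single u 1 - ?P * (single v 1 * q x) =
        ?P * single v 1 * (h x * single (single x (e x)) 1 - q x)"
      proof -
        have "H = h x * ?P" unfolding H_def using X x(1) by (intro prod.remove) auto
        moreover have "(single u 1 :: 'a mpoly) = single v 1 * single (single x (e x)) 1"
          by (simp add: v mult_single add.commute)
        ultimately show ?thesis by (simp add: algebra_simps)
      qed
      moreover have "\<dots> \<in> J"
        using heq[OF x(1)] P vX polys_mono[OF T]
        by (intro pideal_mult[OF J] polys_mult polys_single) auto
      ultimately have "loc_in H J M (H * single u 1)" using loc_in_cong[OF li] by metis
      then show ?thesis by (rule loc_in_cancel)
    qed
  qed
  show ?thesis
  proof (rule that[OF H e])
    fix f :: "'a mpoly" assume f: "f \<in> polys X"
    have "loc_in H J M f"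
      by (rule loc_in_monomials[OF li]) (use f mono polys_keysD in blast)
    then show "loc_in H J {g \<in> polys X. \<forall>u\<in>keys g. \<forall>x\<in>X - T. lookup u x < e x} f"
      by (simp add: M_def)
  qed
qed

text \<open>By \<open>generic_finiteness\<close>, finitely many monomials in the variables outside
  \<open>T\<close> generate after localization. Choose \<open>B\<close> as a maximal independent
  subset of them: every other one has a nonzero K[T]-multiple in the span of \<open>B\<close>, and
  \<open>H\<close> also inverts these multipliers. The monomial 1 is kept in \<open>B\<close> so
  that coefficients at 1 can be compared later.\<close>

lemma generic_freeness:
  fixes J :: "'a::field mpoly set"
  assumes X: "finite X" and J: "pideal X J" and T: "T \<subseteq> X"
    and JT: "J \<inter> polys T = {0}"
    and max: "\<And>x. x \<in> X - T \<Longrightarrow> J \<inter> polys (insert x T) \<noteq> {0}"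
  obtains H B where "H \<in> polys T" "H \<noteq> 0" "finite B" "0 \<in> B" "monomials_independent T J B"
    "\<And>f. f \<in> polys X \<Longrightarrow> loc_in H J (monomials_span T B) f"
proof -
  obtain h e where h: "h \<in> polys T" "h \<noteq> 0" and e: "\<And>x. x \<in> X - T \<Longrightarrow> e x \<ge> (1 :: nat)"
    and fin: "\<And>f. f \<in> polys X \<Longrightarrow> loc_in h J {g \<in> polys X. \<forall>u\<in>keys g. \<forall>x\<in>X - T. lookup u x < e x} f"
    by (rule generic_finiteness[OF X J T JT max], assumption, rule that)
  define E where "E = {m :: mon. keys m \<subseteq> X - T \<and> (\<forall>x\<in>X - T. lookup m x < e x)}"
  have finE: "finite E"
  proof (rule finite_imageD)
    have "(\<lambda>m. restrict (lookup m) (X - T)) ` E \<subseteq> PiE (X - T) (\<lambda>x. {..<e x})"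
      by (rule image_subsetI) (simp add: E_def restrict_PiE_iff)
    then show "finite ((\<lambda>m. restrict (lookup m) (X - T)) ` E)"
      using X by (rule_tac finite_subset) (auto intro!: finite_PiE)
    show "inj_on (\<lambda>m. restrict (lookup m) (X - T)) E"
      by (rule inj_on_subset[OF inj_on_restrict_lookup]) (auto simp: E_def)
  qed
  have 0: "0 \<in> E" using e by (force simp: E_def)
  let ?\<B> = "{B. B \<subseteq> E \<and> 0 \<in> B \<and> monomials_independent T J B}"
  \<comment> \<open>Independence of the monomial 1 says that \<open>J\<close> meets K[T] only in
    0.\<close>
  have "monomials_independent T J {0}"
    using JT by (auto simp: monomials_independent_def)
  then have "{0} \<in> ?\<B>" using 0 by simp
  then obtain B where B: "B \<in> ?\<B>" and Bmax: "\<And>C. C \<in> ?\<B> \<Longrightarrow> B \<subseteq> C \<Longrightarrow> B = C"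
    using finite_has_maximal2[of ?\<B> "{0}"] finE by auto
  have finB: "finite B" using B finE finite_subset by blast
  let ?N = "monomials_span T B :: 'a mpoly set"
  have N: "tmodule T ?N" by (rule tmodule_monomials_span)
  have "\<exists>g. g \<in> polys T \<and> g \<noteq> 0 \<and> (\<exists>s\<in>?N. g * single m 1 - s \<in> J)" if m: "m \<in> E" for m
  proof (cases "m \<in> B")
    case True
    have "(\<Sum>b\<in>B. (if b = m then 1 else 0) * single b 1) = (single m 1 :: 'a mpoly)"
      using True finB by (simp add: if_distrib[of "\<lambda>x. x * _"] cong: if_cong)
    then have "single m 1 = (\<Sum>b\<in>B. (if b = m then 1 else 0) * (single b 1 :: 'a mpoly))" by (rule sym)
    then have "single m 1 \<in> ?N" unfolding monomials_span_def
      by (intro CollectI exI[of _ "\<lambda>b. if b = m then 1 else 0"] conjI) auto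
    then show ?thesis using pideal_zero[OF J] by (intro exI[of _ 1] conjI bexI[of _ "single m 1"]) auto
  next
    case False
    then have "\<not> monomials_independent T J (insert m B)"
      using Bmax[of "insert m B"] B m by auto
    then obtain p where p: "\<forall>b\<in>insert m B. p b \<in> polys T" "(\<Sum>b\<in>insert m B. p b * single b 1) \<in> J"
      "\<exists>b\<in>insert m B. p b \<noteq> 0" unfolding monomials_independent_def by blast
    define s where "s = (\<Sum>b\<in>B. p b * single b 1)"
    have s: "(\<Sum>b\<in>insert m B. p b * single b 1) = p m * single m 1 + s"
      using finB False by (simp add: s_def)
    have "p m \<noteq> 0"
    proof
      assume pm: "p m = 0"
      then have "s \<in> J" using p(2) s by simp
      then have "\<forall>b\<in>B. p b = 0"
        using B p(1) unfolding s_def monomials_independent_def by blast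
      then show False using p(3) pm by auto
    qed
    moreover have "- s \<in> ?N"
    proof -
      have "s \<in> ?N" using p(1) unfolding s_def monomials_span_def by blast
      then have "(- 1) * s \<in> ?N" using N polys_uminus[OF polys_one] unfolding tmodule_def by blast
      then show ?thesis by simp
    qed
    moreover have "p m * single m 1 - (- s) \<in> J" using p(2) s by simp
    ultimately show ?thesis using p(1) by blast
  qed
  then obtain g where g: "\<And>m. m \<in> E \<Longrightarrow> g m \<in> polys T \<and> g m \<noteq> 0 \<and> (\<exists>s\<in>?N. g m * single m 1 - s \<in> J)"
    by metis
  define P where "P = (\<Prod>m\<in>E. g m)"
  have P: "P \<in> polys T" "P \<noteq> 0" using g finE by (auto simp: P_def intro!: polys_prod)
  define H where "H = h * P"
  have H: "H \<in> polys T" "H \<noteq> 0" using P h by (auto simp: H_def intro: polys_mult)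
  note li = J N T H(1)
  have TX: "p \<in> polys X" if "p \<in> polys T" for p :: "'a mpoly" using that polys_mono[OF T] by blast
  show ?thesis
  proof (rule that[OF H finB])
    show "0 \<in> B" "monomials_independent T J B" using B by auto
    fix f :: "'a mpoly" assume f: "f \<in> polys X"
    obtain k b where b: "b \<in> polys X" "\<forall>u\<in>keys b. \<forall>x\<in>X - T. lookup u x < e x" "h ^ k * f - b \<in> J"
      using fin[OF f] unfolding loc_in_def by blast
    have "loc_in H J ?N b"
    proof (rule loc_in_monomials[OF li])
      fix u assume u: "u \<in> keys b"
      obtain a m where am: "u = a + m" "keys a = keys u \<inter> T" "keys m = keys u - T"
        "\<And>x. x \<notin> T \<Longrightarrow> lookup m x = lookup u x"
        using mon_decomp[of u T] by metis
      have "keys u \<subseteq> X" using b(1) u polys_keysD by blast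
      then have m: "m \<in> E" using b(2) u am by (auto simp: E_def)
      obtain s where s: "s \<in> ?N" "g m * single m 1 - s \<in> J" using g[OF m] by blast
      let ?c = "h * (\<Prod>m\<in>E - {m}. g m) * single a 1"
      have c: "?c \<in> polys T" using h g am(2) by (intro polys_mult polys_prod polys_single) auto
      have "P = g m * (\<Prod>m\<in>E - {m}. g m)" unfolding P_def using finE m by (rule prod.remove)
      moreover have "single u 1 = single a 1 * (single m 1 :: 'a mpoly)" by (simp add: am(1) mult_single)
      ultimately have "H * single u 1 - ?c * s = ?c * (g m * single m 1 - s)"
        by (simp add: H_def algebra_simps)
      also have "\<dots> \<in> J" using s(2) TX[OF c] by (intro pideal_mult[OF J])
      finally have "H ^ 1 * single u 1 - ?c * s \<in> J" by simp
      moreover have "?c * s \<in> ?N" using N c s(1) unfolding tmodule_def by blast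
      ultimately show "loc_in H J ?N (single u 1)" unfolding loc_in_def by blast
    qed
    then have "loc_in H J ?N (P ^ k * b)" by (rule loc_in_scale[OF li]) (rule polys_power[OF P(1)])
    moreover have "H ^ k * f - P ^ k * b \<in> J"
    proof -
      have "H ^ k * f - P ^ k * b = P ^ k * (h ^ k * f - b)"
        by (simp add: H_def algebra_simps power_mult_distrib)
      also have "\<dots> \<in> J" using b(3) TX[OF polys_power[OF P(1)]] by (intro pideal_mult[OF J])
      finally show ?thesis .
    qed
    ultimately have "loc_in H J ?N (H ^ k * f)" by (rule loc_in_cong[OF li])
    then show "loc_in H J ?N f"
    proof (induction k)
      case (Suc k)
      have "loc_in H J ?N (H * (H ^ k * f))" using Suc.prems by (simp add: mult.assoc)
      then show ?case using Suc.IH loc_in_cancel by blast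
    qed simp
  qed
qed


text \<open>
  With \<open>B\<close> and \<open>H\<close> as in the previous lemma, \<open>f = 1 + t H\<close> divides no nonzero element of
  \<open>K[T - {t}]\<close> modulo \<open>J\<close>: comparing coefficients at \<open>1 \<in> B\<close> the divisibility would hold in
  \<open>K[T]\<close> up to a power of \<open>H\<close>, and \<open>H\<close> is a unit modulo \<open>f\<close>.
\<close>

lemma exists_transversal_element:
  fixes J :: "'a::field mpoly set"
  assumes X: "finite X" and J: "pideal X J" and T: "T \<subseteq> X"
    and JT: "J \<inter> polys T = {0}"
    and max: "\<And>x. x \<in> X - T \<Longrightarrow> J \<inter> polys (insert x T) \<noteq> {0}"
    and t: "t \<in> T"
  obtains f where "f \<in> polys T" "f \<notin> J"
    "{q + f * a | q a. q \<in> J \<and> a \<in> polys X} \<inter> polys (T - {t}) = {0}"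
proof -
  obtain H B where H: "H \<in> polys T" "H \<noteq> 0" and B: "finite B" "0 \<in> B" "monomials_independent T J B"
    and loc: "\<And>f. f \<in> polys X \<Longrightarrow> loc_in H J (monomials_span T B) f"
    by (rule generic_freeness[OF X J T JT max], assumption, rule that)
  define s where "s = var_poly t * H"
  define f where "f = 1 + s"
  have s: "s \<in> polys T" unfolding s_def by (intro polys_mult polys_var t H)
  have f: "f \<in> polys T" unfolding f_def by (intro polys_add polys_one s)
  have TX: "p \<in> polys X" if "p \<in> polys T" for p :: "'a mpoly" using that polys_mono[OF T] by blast
  have "s \<noteq> 0" using H(2) by (simp add: s_def single_one_nonzero)
  then obtain u where u: "u \<in> keys s" by (metis keys_eq_empty all_not_in_conv)
  then have ut: "lookup u t \<ge> 1" unfolding s_def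
    by (auto elim!: keys_multE simp: lookup_add_mon split: if_splits)
  then have "u \<noteq> 0" by auto
  then have uf: "u \<in> keys f" using u by (simp add: f_def in_keys_iff lookup_add lookup_one)
  then have "f \<noteq> 0" by auto
  then have fJ: "f \<notin> J" using JT f by blast
  have "g = 0" if g: "g \<in> polys (T - {t})" "g = q + f * a" "q \<in> J" "a \<in> polys X" for g q a
  proof (rule ccontr)
    assume "g \<noteq> 0"
    have gT: "g \<in> polys T" using g(1) polys_mono[of "T - {t}" T] by blast
    obtain k p where p: "\<forall>b\<in>B. p b \<in> polys T" "H ^ k * a - (\<Sum>b\<in>B. p b * single b 1) \<in> J"
      using loc[OF g(4)] unfolding loc_in_def monomials_span_def by blast
    \<comment> \<open>Coefficients over \<open>B\<close> of H^k g minus \<open>f\<close> times the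
      representative of H^k a. Their combination lies in \<open>J\<close>, so the coefficient at 1
      vanishes.\<close>
    define p' where "p' b = (if b = 0 then H ^ k * g else 0) - f * p b" for b
    have "(\<Sum>b\<in>B. (if b = 0 then H ^ k * g else 0) * single b 1) = H ^ k * g"
      using B(1,2) by (simp add: if_distrib[of "\<lambda>x. x * _"] cong: if_cong)
    then have "(\<Sum>b\<in>B. p' b * single b 1) = H ^ k * g - f * (\<Sum>b\<in>B. p b * single b 1)"
      by (simp add: p'_def left_diff_distrib sum_subtractf sum_distrib_left mult.assoc)
    also have "\<dots> = H ^ k * q + f * (H ^ k * a - (\<Sum>b\<in>B. p b * single b 1))"
      by (simp add: g(2) algebra_simps)
    also have "\<dots> \<in> J"
      using p(2) g(3) TX[OF f] TX[OF polys_power[OF H(1)]]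
      by (intro pideal_add[OF J] pideal_mult[OF J])
    finally have "(\<Sum>b\<in>B. p' b * single b 1) \<in> J" .
    moreover have "\<forall>b\<in>B. p' b \<in> polys T"
      using p(1) f gT H(1) by (auto simp: p'_def intro!: polys_intros)
    ultimately have "p' 0 = 0" using B(2,3) unfolding monomials_independent_def by blast
    then have eq: "H ^ k * g = f * p 0" by (simp add: p'_def)
    \<comment> \<open>Modulo \<open>f\<close> the element \<open>s\<close> = t H equals -1.
      Multiplying by t^k therefore turns H^k into the unit (-1)^k, and \<open>f\<close> divides
      \<open>g\<close>.\<close>
    have "\<exists>z. s ^ k = (- 1) ^ k + f * z"
    proof (induction k)
      case (Suc k)
      then obtain z where z: "s ^ k = (- 1) ^ k + f * z" by blast
      have "s ^ Suc k = (f - 1) * ((- 1) ^ k + f * z)" by (simp add: z f_def)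
      also have "\<dots> = (- 1) ^ Suc k + f * ((- 1) ^ k + (f - 1) * z)" by (simp add: algebra_simps)
      finally show ?case by blast
    qed (auto intro!: exI[of _ 0])
    then obtain z where z: "s ^ k = (- 1) ^ k + f * z" by blast
    have "f * (var_poly t ^ k * p 0) = s ^ k * g"
      using eq by (simp add: s_def power_mult_distrib mult_ac)
    then have "(- 1) ^ k * g = f * (var_poly t ^ k * p 0 - z * g)"
      by (simp add: z algebra_simps)
    then have "(- 1) ^ k * ((- 1) ^ k * g) = f * ((- 1) ^ k * (var_poly t ^ k * p 0 - z * g))"
      by (simp add: mult_ac)
    then have "g = f * ((- 1) ^ k * (var_poly t ^ k * p 0 - z * g))"
      by (simp flip: mult.assoc power_mult_distrib)
    then obtain y where y: "g = f * y" by blast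
    then have "y \<noteq> 0" using \<open>g \<noteq> 0\<close> by auto
    \<comment> \<open>A nonzero multiple of \<open>f\<close> has positive degree in
      \<open>t\<close>, whereas \<open>g\<close> does not involve \<open>t\<close>.\<close>
    from degree_in_variable_mult[OF uf this, of t] obtain v where v: "v \<in> keys g" "lookup v t \<ge> 1"
      using ut y by auto
    then have "t \<in> keys v" by (simp add: in_keys_iff)
    then show False using polys_keysD[OF g(1) v(1)] by blast
  qed
  then have "{q + f * a | q a. q \<in> J \<and> a \<in> polys X} \<inter> polys (T - {t}) \<subseteq> {0}" by blast
  moreover have "0 \<in> {q + f * a | q a. q \<in> J \<and> a \<in> polys X}"
    by (rule pideal_zero[OF pideal_adjoin(1)[OF J TX[OF f]]])
  ultimately have "{q + f * a | q a. q \<in> J \<and> a \<in> polys X} \<inter> polys (T - {t}) = {0}"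
    using polys_zero by (metis (no_types, lifting) IntI empty_iff subset_singletonD)
  then show ?thesis by (rule that[OF f fJ])
qed

text \<open>Induction on |T|. Enlarge \<open>T\<close> to a maximal \<open>S\<close> with J and K[S]
  meeting in 0, and take a prime \<open>Q\<close> above \<open>J\<close> with the same property.
  Some \<open>f\<close> outside \<open>Q\<close> has Q + (f) meeting K[S - t] in 0
  (\<open>exists_transversal_element\<close>); the induction hypothesis for this larger ideal and T
  - {t} gives a chain strictly above \<open>Q\<close>.\<close>

theorem prime_chain_over_ideal:
  fixes J :: "'a::field mpoly set"
  assumes X: "finite X" and J: "pideal X J" and T: "T \<subseteq> X" and JT: "J \<inter> polys T = {0}"
  shows "\<exists>Q. (\<forall>l\<le>card T. pprime X (Q l)) \<and> (\<forall>l<card T. Q l \<subset> Q (Suc l)) \<and> J \<subseteq> Q 0"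
  using J T JT
proof (induction "card T" arbitrary: J T)
  case 0
  have "J \<inter> (polys T - {0}) = {}" using 0 by blast
  moreover have "polys T - {0} \<subseteq> polys X" using polys_mono[OF 0(3)] by blast
  ultimately obtain Q where "pprime X Q" "J \<subseteq> Q"
    by (rule_tac prime_avoiding_exists[OF 0(2), of "polys T - {0}"]) (auto intro: polys_mult)
  then show ?case using 0(1) by (intro exI[of _ "\<lambda>_. Q"]) auto
next
  case (Suc d)
  let ?\<T> = "{S. S \<subseteq> X \<and> J \<inter> polys S = {0}}"
  have "finite ?\<T>" "T \<in> ?\<T>" using X Suc.prems by auto
  then obtain S where S: "S \<in> ?\<T>" "T \<subseteq> S" and Smax: "\<And>S'. S' \<in> ?\<T> \<Longrightarrow> S \<subseteq> S' \<Longrightarrow> S = S'"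
    using finite_has_maximal2[of ?\<T> T] by auto
  have SX: "S \<subseteq> X" "J \<inter> polys S = {0}" using S by auto
  have "polys S - {0} \<subseteq> polys X" using polys_mono[OF SX(1)] by blast
  moreover have "J \<inter> (polys S - {0}) = {}" using SX by blast
  ultimately obtain Q where Q: "pprime X Q" "J \<subseteq> Q" "Q \<inter> (polys S - {0}) = {}"
    by (rule_tac prime_avoiding_exists[OF Suc.prems(1), of "polys S - {0}"]) (auto intro: polys_mult)
  have id: "pideal X Q" by (rule pprime_pideal[OF Q(1)])
  have QS: "Q \<inter> polys S = {0}" using Q(3) pideal_zero[OF id] by auto
  \<comment> \<open>Maximality of \<open>S\<close> passes from \<open>J\<close> to the larger ideal
    \<open>Q\<close>.\<close>
  have max: "Q \<inter> polys (insert x S) \<noteq> {0}" if x: "x \<in> X - S" for x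
  proof
    assume "Q \<inter> polys (insert x S) = {0}"
    then have "J \<inter> polys (insert x S) = {0}"
      using Q(2) pideal_zero[OF Suc.prems(1)] by auto
    then show False using Smax[of "insert x S"] SX(1) x by auto
  qed
  have "T \<noteq> {}" using Suc.hyps(2) by auto
  then obtain t where t: "t \<in> T" by blast
  obtain f where f: "f \<in> polys S" "f \<notin> Q"
    "{q + f * a | q a. q \<in> Q \<and> a \<in> polys X} \<inter> polys (S - {t}) = {0}"
    by (rule exists_transversal_element[OF X id SX(1) QS max, of t]) (use t S(2) that in auto)
  define K where "K = {q + f * a | q a. q \<in> Q \<and> a \<in> polys X}"
  have fX: "f \<in> polys X" using f(1) polys_mono[OF SX(1)] by blast
  have K: "pideal X K" "Q \<subseteq> K" "f \<in> K" unfolding K_def by (rule pideal_adjoin[OF id fX])+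
  have "polys (T - {t}) \<subseteq> (polys (S - {t}) :: 'a mpoly set)" using S(2) by (intro polys_mono) auto
  then have "K \<inter> polys (T - {t}) = {0}" using f(3)[folded K_def] pideal_zero[OF K(1)] by auto
  then have "\<exists>P. (\<forall>l\<le>card (T - {t}). pprime X (P l)) \<and> (\<forall>l<card (T - {t}). P l \<subset> P (Suc l)) \<and> K \<subseteq> P 0"
    using Suc.hyps(2) t Suc.prems(2) by (intro Suc.hyps(1) K(1)) auto
  moreover have "card (T - {t}) = d" using Suc.hyps(2) t by simp
  ultimately obtain P where P: "\<forall>l\<le>d. pprime X (P l)" "\<forall>l<d. P l \<subset> P (Suc l)" "K \<subseteq> P 0"
    by auto
  define R where "R l = (case l of 0 \<Rightarrow> Q | Suc l \<Rightarrow> P l)" for l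
  have "Q \<subset> P 0" using K f(2) P(3) by blast
  then have "\<forall>l<card T. R l \<subset> R (Suc l)"
    using P(2) unfolding Suc.hyps(2)[symmetric] by (auto simp: R_def split: nat.split)
  moreover have "\<forall>l\<le>card T. pprime X (R l)"
    using P(1) Q(1) unfolding Suc.hyps(2)[symmetric] by (auto simp: R_def split: nat.split)
  moreover have "J \<subseteq> R 0" using Q(2) by (simp add: R_def)
  ultimately show ?case by blast
qed


section \<open>Variable ideals and the codimension of monomial ideals\<close>

section \<open>Dimension and codimension through independent sets\<close>

text \<open>For \<open>C\<close> inside \<open>X\<close> this is the ideal generated by the
  variables in \<open>C\<close>, described by supports.\<close>

definition var_ideal :: "(nat \<times> nat) set \<Rightarrow> (nat \<times> nat) set \<Rightarrow> 'a::field mpoly set" where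
  "var_ideal X C = {f \<in> polys X. \<forall>u\<in>keys f. keys u \<inter> C \<noteq> {}}"

text \<open>The quotient is the domain K[X - C]: the parts of two polynomials that are free of
  \<open>C\<close> have a product that is again free of \<open>C\<close>, and it is nonzero if both
  parts are.\<close>

lemma pprime_var_ideal: "pprime X (var_ideal X C :: 'a::field mpoly set)"
proof -
  have mult: "f * g \<in> var_ideal X C" if fg: "f \<in> polys X" "g \<in> var_ideal X C" for f g :: "'a mpoly"
  proof -
    have "keys w \<inter> C \<noteq> {}" if w: "w \<in> keys (f * g)" for w
    proof -
      obtain u v where "w = u + v" "v \<in> keys g" using w by (rule keys_multE)
      then show ?thesis using fg(2) by (auto simp: var_ideal_def keys_add_mon)
    qed
    then show ?thesis using fg by (auto simp: var_ideal_def polys_mult)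
  qed
  have add: "f + g \<in> var_ideal X C" if fg: "f \<in> var_ideal X C" "g \<in> var_ideal X C" for f g :: "'a mpoly"
    using fg Poly_Mapping.keys_add[of f g] by (auto simp: var_ideal_def polys_add)
  have id: "pideal X (var_ideal X C :: 'a mpoly set)"
  proof -
    have "var_ideal X C \<subseteq> (polys X :: 'a mpoly set)" "(0 :: 'a mpoly) \<in> var_ideal X C"
      by (auto simp: var_ideal_def)
    then show ?thesis unfolding pideal_def using mult add by simp
  qed
  define A where "A = {u :: mon. keys u \<inter> C = {}}"
  have restr: "restr_poly B f \<in> polys X" if "f \<in> polys X" for f :: "'a mpoly" and B
    using that by (auto simp: polys_def keys_restr_poly)
  have low: "restr_poly (- A) f \<in> var_ideal X C" if "f \<in> polys X" for f :: "'a mpoly"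
    using restr[OF that] by (auto simp: var_ideal_def keys_restr_poly A_def)
  have "f \<in> var_ideal X C \<or> g \<in> var_ideal X C"
    if fg: "f \<in> polys X" "g \<in> polys X" "f * g \<in> var_ideal X C" for f g :: "'a mpoly"
  proof (rule ccontr)
    assume "\<not> ?thesis"
    then obtain u v where "u \<in> keys f" "keys u \<inter> C = {}" "v \<in> keys g" "keys v \<inter> C = {}"
      using fg by (auto simp: var_ideal_def)
    then have "u \<in> keys (restr_poly A f)" "v \<in> keys (restr_poly A g)"
      by (auto simp: keys_restr_poly A_def)
    then have "restr_poly A f * restr_poly A g \<noteq> 0" by auto
    then obtain w where w: "w \<in> keys (restr_poly A f * restr_poly A g)"
      by (metis keys_eq_empty all_not_in_conv)
    then have wC: "keys w \<inter> C = {}"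
      by (auto elim!: keys_multE simp: keys_add_mon keys_restr_poly A_def)
    have "f * g = (restr_poly A f + restr_poly (- A) f) * g" "restr_poly A f * g = restr_poly A f * (restr_poly A g + restr_poly (- A) g)"
      using restr_poly_split[of f A] restr_poly_split[of g A] by simp_all
    then have eq: "restr_poly A f * restr_poly A g = f * g - (g * restr_poly (- A) f + restr_poly A f * restr_poly (- A) g)"
      by (simp add: algebra_simps)
    have "restr_poly A f * restr_poly A g \<in> var_ideal X C" unfolding eq
      by (intro pideal_diff[OF id] fg(3) add mult low fg(1,2) restr)
    then show False using w wC by (auto simp: var_ideal_def)
  qed
  then show ?thesis using id by (auto simp: pprime_def var_ideal_def)
qed

lemma var_chain:
  assumes "finite S" "S \<subseteq> X" "S \<inter> C = {}"
  shows "\<exists>P :: nat \<Rightarrow> 'a::field mpoly set. P 0 = var_ideal X C \<and> P (card S) = var_ideal X (C \<union> S) \<and>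
    (\<forall>l\<le>card S. pprime X (P l)) \<and> (\<forall>l<card S. P l \<subset> P (Suc l))"
  using assms
proof (induction S rule: finite_induct)
  case empty
  then show ?case by (intro exI[of _ "\<lambda>_. var_ideal X C"]) (auto simp: pprime_var_ideal)
next
  case (insert x S)
  then obtain P :: "nat \<Rightarrow> 'a mpoly set" where P: "P 0 = var_ideal X C" "P (card S) = var_ideal X (C \<union> S)"
    "\<forall>l\<le>card S. pprime X (P l)" "\<forall>l<card S. P l \<subset> P (Suc l)" by auto
  define R where "R l = (if l \<le> card S then P l else var_ideal X (C \<union> insert x S))" for l
  have "var_poly x \<in> (var_ideal X (C \<union> insert x S) :: 'a mpoly set)" "var_poly x \<notin> (var_ideal X (C \<union> S) :: 'a mpoly set)"
    using insert by (auto simp: var_ideal_def polys_single)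
  moreover have "var_ideal X (C \<union> S) \<subseteq> (var_ideal X (C \<union> insert x S) :: 'a mpoly set)"
    by (auto simp: var_ideal_def)
  ultimately have step: "P (card S) \<subset> var_ideal X (C \<union> insert x S)" unfolding P(2) by blast
  have card: "card (insert x S) = Suc (card S)" using insert by simp
  have "R l \<subset> R (Suc l)" if "l < Suc (card S)" for l
    using that P(4) step by (cases "l = card S") (auto simp: R_def)
  moreover have "pprime X (R l)" for l using P(3) pprime_var_ideal by (auto simp: R_def)
  ultimately show ?case using P(1) unfolding card by (intro exI[of _ R]) (auto simp: R_def)
qed

text \<open>When the supports of \<open>M\<close> lie in \<open>X\<close>, the complements of these
  sets are the vertex covers of the supports, that is, the sets of variables that generate primes
  above the monomials of \<open>M\<close>.\<close>

definition indep_set :: "(nat \<times> nat) set \<Rightarrow> mon set \<Rightarrow> (nat \<times> nat) set \<Rightarrow> bool" where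
  "indep_set X M S \<longleftrightarrow> S \<subseteq> X \<and> (\<forall>u\<in>M. \<not> keys u \<subseteq> S)"

definition max_indep :: "(nat \<times> nat) set \<Rightarrow> mon set \<Rightarrow> nat \<Rightarrow> bool" where
  "max_indep X M d \<longleftrightarrow> (\<exists>S. indep_set X M S \<and> card S = d) \<and> (\<forall>S. indep_set X M S \<longrightarrow> card S \<le> d)"

lemma max_indep_exists:
  assumes "finite X" "0 \<notin> M"
  obtains d where "max_indep X M d"
proof -
  have "{S. indep_set X M S} \<subseteq> Pow X" by (auto simp: indep_set_def)
  then have fin: "finite (card ` {S. indep_set X M S})" using assms(1) finite_subset by blast
  have "indep_set X M {}" using assms(2) by (auto simp: indep_set_def)
  then have "Max (card ` {S. indep_set X M S}) \<in> card ` {S. indep_set X M S}"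
    using fin by (intro Max_in) auto
  then have "max_indep X M (Max (card ` {S. indep_set X M S}))"
    unfolding max_indep_def using Max_ge[OF fin] by auto
  then show ?thesis by (rule that)
qed

lemma finite_xvars [simp]: "finite (xvars c n)"
  by (simp add: xvars_def)

lemma card_xvars [simp]: "card (xvars c n) = c * n"
  by (simp add: xvars_def card_cartesian_product)

lemma prime_chain_Rn:
  "prime_chain (Rn c n) d P \<longleftrightarrow> (\<forall>l\<le>d. pprime (xvars c n) (P l)) \<and> (\<forall>l<d. P l \<subset> P (Suc l))"
  by (simp add: prime_chain_def primeideal_Rn_iff)

lemma prime_chain_concat:
  assumes "prime_chain A k P" "prime_chain A m Q" "P k = Q 0"
  shows "prime_chain A (k + m) (\<lambda>l. if l \<le> k then P l else Q (l - k))"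
proof -
  have "(if l \<le> k then P l else Q (l - k)) \<subset> (if Suc l \<le> k then P (Suc l) else Q (Suc l - k))"
    if "l < k + m" for l
  proof (cases l k rule: linorder_cases)
    case equal
    then show ?thesis using assms that by (auto simp: prime_chain_def)
  next
    case greater
    then have "Suc l - k = Suc (l - k)" "l - k < m" using that by auto
    then show ?thesis using assms(2) greater by (simp add: prime_chain_def)
  qed (use assms in \<open>auto simp: prime_chain_def\<close>)
  then show ?thesis using assms by (auto simp: prime_chain_def)
qed

text \<open>The zero ideal with \<open>U\<close> empty in \<open>pflag_length_bound\<close>: the
  dimension of a polynomial ring is at most its number of variables.\<close>

lemma prime_chain_length_le:
  assumes "prime_chain (Rn c n :: 'a::field mpoly ring) k P"
  shows "k \<le> c * n"
proof -
  obtain ys where ys: "length ys = k" "pflag (xvars c n) (P 0) ys"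
    using pflag_of_chain[of k "xvars c n" P] assms by (auto simp: prime_chain_Rn)
  have id: "pideal (xvars c n) {0 :: 'a mpoly}" by (auto simp: pideal_def)
  have "length ys \<le> card (xvars c n)"
  proof (rule pflag_length_bound[where w = "\<lambda>_. 1" and U = "{}", OF _ _ id ys(2)])
    show "{0} \<subseteq> P 0" using pflag_pprime[OF ys(2)] pprime_pideal pideal_zero by blast
    show "card S \<le> card (xvars c n)" if "S \<subseteq> xvars c n" for S
      using that by (intro card_mono) auto
  qed auto
  then show ?thesis using ys(1) by simp
qed

text \<open>The complement of a largest independent set generates a prime above the ideal, of height
  at most c n - d. Conversely, the variables in any prime above the ideal form the complement of an
  independent set, so there are at least c n - d of them, and adding them one at a time gives a
  chain up to that prime.\<close>

lemma codim_monomial_ideal: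
  assumes M: "\<And>u. u \<in> M \<Longrightarrow> keys u \<subseteq> xvars c n" and d: "max_indep (xvars c n) M d"
  shows "codim (Rn c n) {f :: 'a::field mpoly. f \<in> polys (xvars c n) \<and> keys f \<subseteq> M} = ereal (real (c * n) - real d)"
proof -
  let ?X = "xvars c n"
  let ?J = "{f :: 'a mpoly. f \<in> polys ?X \<and> keys f \<subseteq> M}"
  obtain S where S: "indep_set ?X M S" "card S = d" using d by (auto simp: max_indep_def)
  have SX: "S \<subseteq> ?X" using S by (simp add: indep_set_def)
  have finS: "finite S" using finite_subset[OF SX] by simp
  show ?thesis unfolding codim_def
  proof (rule antisym)
    have "primeideal (var_ideal ?X (?X - S)) (Rn c n :: 'a mpoly ring)"
      by (simp add: primeideal_Rn_iff pprime_var_ideal)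
    moreover have "?J \<subseteq> var_ideal ?X (?X - S)"
      using S(1) M unfolding var_ideal_def indep_set_def by fast
    ultimately have "(INF Q\<in>{Q. primeideal Q (Rn c n) \<and> ?J \<subseteq> Q}. prime_height (Rn c n) Q)
      \<le> prime_height (Rn c n) (var_ideal ?X (?X - S) :: 'a mpoly set)"
      by (intro INF_lower) simp
    also have "\<dots> \<le> ereal (real (c * n) - real d)"
      unfolding prime_height_def
    proof (rule SUP_least)
      fix k assume "k \<in> {k. \<exists>P. prime_chain (Rn c n) k P \<and> P k = (var_ideal ?X (?X - S) :: 'a mpoly set)}"
      then obtain P :: "nat \<Rightarrow> 'a mpoly set"
        where P: "prime_chain (Rn c n) k P" "P k = var_ideal ?X (?X - S)" by blast
      obtain P' :: "nat \<Rightarrow> 'a mpoly set" where "P' 0 = var_ideal ?X (?X - S)" "prime_chain (Rn c n) (card S) P'"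
        using var_chain[OF finS SX, of "?X - S"] by (auto simp: prime_chain_Rn)
      \<comment> \<open>Adding the variables of \<open>S\<close> one by one prolongs the chain by
        |S| = d steps, while no chain is longer than c n.\<close>
      then have "prime_chain (Rn c n) (k + card S) (\<lambda>l. if l \<le> k then P l else P' (l - k))"
        using P by (intro prime_chain_concat) auto
      from prime_chain_length_le[OF this] have "k + d \<le> c * n" by (simp add: S(2))
      then have "real k \<le> real (c * n) - real d" by (metis le_diff_eq of_nat_add of_nat_le_iff)
      then show "ereal (real k) \<le> ereal (real (c * n) - real d)" by simp
    qed
    finally show "(INF Q\<in>{Q. primeideal Q (Rn c n) \<and> ?J \<subseteq> Q}. prime_height (Rn c n) Q)
      \<le> ereal (real (c * n) - real d)" .
  next
    show "ereal (real (c * n) - real d) \<le> (INF Q\<in>{Q. primeideal Q (Rn c n) \<and> ?J \<subseteq> Q}. prime_height (Rn c n) Q)"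
    proof (rule INF_greatest)
      fix Q assume "Q \<in> {Q. primeideal Q (Rn c n) \<and> ?J \<subseteq> Q}"
      then have Q: "pprime ?X Q" "?J \<subseteq> Q" by (auto simp: primeideal_Rn_iff)
      define C where "C = {x \<in> ?X. var_poly x \<in> Q}"
      \<comment> \<open>Splitting off one variable at a time, primality finds a variable of
        \<open>u\<close> in \<open>Q\<close>.\<close>
      have mon: "keys u \<inter> C \<noteq> {}" if "single u 1 \<in> Q" "keys u \<subseteq> ?X" for u
        using that
      proof (induction "\<Sum>x\<in>?X. lookup u x" arbitrary: u rule: less_induct)
        case less
        have "u \<noteq> 0"
        proof
          assume "u = 0"
          then show False using less.prems Q(1) by (simp add: pprime_def)
        qed
        then obtain x where x: "x \<in> keys u" by (metis keys_eq_empty all_not_in_conv)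
        obtain v where v: "u = single x 1 + v" by (rule mon_split_variable[OF x])
        have xX: "x \<in> ?X" and vX: "keys v \<subseteq> ?X" using less.prems x by (auto simp: v keys_add_mon)
        have "var_poly x * single v (1 :: 'a) \<in> Q" using less.prems by (simp add: v mult_single)
        then have "var_poly x \<in> Q \<or> single v 1 \<in> Q"
          using Q(1) polys_var[OF xX] polys_single[OF vX] unfolding pprime_def by blast
        then show ?case
        proof
          assume "var_poly x \<in> Q"
          then show ?thesis using x xX by (auto simp: C_def)
        next
          assume vQ: "single v 1 \<in> Q"
          have "(\<Sum>y\<in>?X. lookup v y) < (\<Sum>y\<in>?X. lookup u y)"
          proof (rule sum_strict_mono_ex1)
            show "\<exists>y\<in>?X. lookup v y < lookup u y"
              using xX by (intro bexI[of _ x]) (auto simp: v lookup_add)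
          qed (auto simp: v lookup_add)
          from less.hyps[OF this vQ vX] show ?thesis by (auto simp: v keys_add_mon)
        qed
      qed
      have CX: "C \<subseteq> ?X" by (auto simp: C_def)
      have finC: "finite C" using finite_subset[OF CX] by simp
      have "indep_set ?X M (?X - C)"
        unfolding indep_set_def
      proof (intro conjI ballI notI)
        fix u assume u: "u \<in> M" "keys u \<subseteq> ?X - C"
        then have "single u 1 \<in> ?J" using polys_single[OF M] by auto
        then show False using mon[OF _ M[OF u(1)]] Q(2) u by blast
      qed auto
      then have "card (?X - C) \<le> d" using d by (auto simp: max_indep_def)
      then have "c * n \<le> d + card C"
        using card_Diff_subset[OF finC CX] card_mono[OF _ CX] by simp
      then have "real (c * n) \<le> real (d + card C)" by (rule of_nat_mono)
      then have le: "real (c * n) - real d \<le> real (card C)" by simp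
      obtain P :: "nat \<Rightarrow> 'a mpoly set" where P: "P 0 = var_ideal ?X {}" "P (card C) = var_ideal ?X C"
        "\<forall>l\<le>card C. pprime ?X (P l)" "\<forall>l<card C. P l \<subset> P (Suc l)"
        using var_chain[OF finC CX, of "{}"] by auto
      have "f \<in> Q" if f: "f \<in> var_ideal ?X C" for f
      proof -
        have "single u (lookup f u) \<in> Q" if u: "u \<in> keys f" for u
        proof -
          obtain x where x: "x \<in> keys u" "x \<in> C" using f u unfolding var_ideal_def by blast
          obtain v where v: "u = single x 1 + v" by (rule mon_split_variable[OF x(1)])
          have "keys u \<subseteq> ?X" using f u polys_keysD by (auto simp: var_ideal_def)
          then have "keys v \<subseteq> ?X" by (auto simp: v keys_add_mon)
          then have "single v (lookup f u) * var_poly x \<in> Q"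
            using x(2) by (intro pideal_mult[OF pprime_pideal[OF Q(1)]] polys_single) (auto simp: C_def)
          then show ?thesis by (simp add: v mult_single add.commute)
        qed
        then have "(\<Sum>u\<in>keys f. single u (lookup f u)) \<in> Q"
          by (intro pideal_sum[OF pprime_pideal[OF Q(1)]])
        then show ?thesis by (simp flip: poly_sum_monomials)
      qed
      then have sub: "P (card C) \<subseteq> Q" using P(2) by blast
      \<comment> \<open>The top of the chain of variable ideals is replaced by \<open>Q\<close>,
        which contains it.\<close>
      define R where "R l = (if l < card C then P l else Q)" for l
      have "R l \<subset> R (Suc l)" if "l < card C" for l
      proof -
        have "P l \<subset> P (Suc l)" using P(4) that by blast
        moreover have "P (Suc l) \<subseteq> R (Suc l)"
          using sub that by (cases "Suc l = card C") (auto simp: R_def)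
        ultimately show ?thesis using that by (auto simp: R_def)
      qed
      moreover have "pprime ?X (R l)" if "l \<le> card C" for l
        using P(3) Q(1) that by (auto simp: R_def)
      ultimately have "prime_chain (Rn c n) (card C) R" "R (card C) = Q"
        by (auto simp: prime_chain_Rn R_def)
      then have "ereal (real (card C)) \<le> prime_height (Rn c n) Q"
        unfolding prime_height_def by (intro SUP_upper) blast
      then show "ereal (real (c * n) - real d) \<le> prime_height (Rn c n) Q"
        using le by (meson ereal_less_eq(3) order_trans)
    qed
  qed
qed

section \<open>Initial monomials and the dimension of the quotient\<close>

section \<open>Initial ideals\<close>

definition mono_ideal :: "(nat \<times> nat) set \<Rightarrow> mon set \<Rightarrow> 'a::field mpoly set" where
  "mono_ideal X G = {f \<in> polys X. \<forall>u\<in>keys f. \<exists>g\<in>G. \<exists>w. u = g + w}"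

lemma pideal_mono_ideal: "pideal X (mono_ideal X G :: 'a::field mpoly set)"
proof -
  have "f * g \<in> mono_ideal X G" if fg: "f \<in> polys X" "g \<in> mono_ideal X G" for f g :: "'a mpoly"
  proof -
    have "\<exists>g\<in>G. \<exists>w'. w = g + w'" if w: "w \<in> keys (f * g)" for w
    proof -
      obtain u v where uv: "w = u + v" "v \<in> keys g" using w by (rule keys_multE)
      then obtain h w' where "h \<in> G" "v = h + w'" using fg(2) by (auto simp: mono_ideal_def)
      then show ?thesis using uv by (intro bexI[of _ h] exI[of _ "u + w'"]) (auto simp: ac_simps)
    qed
    then show ?thesis using fg by (auto simp: mono_ideal_def polys_mult)
  qed
  moreover have "f + g \<in> mono_ideal X G" if "f \<in> mono_ideal X G" "g \<in> mono_ideal X G" for f g :: "'a mpoly"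
    using that Poly_Mapping.keys_add[of f g] by (auto simp: mono_ideal_def polys_add)
  moreover have "mono_ideal X G \<subseteq> (polys X :: 'a mpoly set)" "(0 :: 'a mpoly) \<in> mono_ideal X G"
    by (auto simp: mono_ideal_def)
  ultimately show ?thesis unfolding pideal_def by simp
qed

text \<open>\<open>F\<close> may contain more than monomials. This form serves
  \<open>generated_iff\<close>, where \<open>F\<close> consists of the images of all polynomials of
  a monomial ideal.\<close>

lemma Idl_eq_mono_ideal:
  fixes F :: "'a::field mpoly set"
  assumes "mono_poly ` G \<subseteq> F" "F \<subseteq> mono_ideal (xvars c n) G"
  shows "Idl\<^bsub>Rn c n\<^esub> F = mono_ideal (xvars c n) G"
proof
  interpret ring "Rn c n :: 'a mpoly ring" by (rule Rn_ring)
  let ?X = "xvars c n"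
  show "Idl\<^bsub>Rn c n\<^esub> F \<subseteq> mono_ideal ?X G"
    by (rule genideal_minimal) (use assms(2) pideal_mono_ideal in \<open>auto simp: ideal_Rn_iff\<close>)
  have sub: "F \<subseteq> carrier (Rn c n)"
    using assms(2) by (auto simp: carrier_Rn mono_ideal_def)
  have id: "pideal ?X (Idl\<^bsub>Rn c n\<^esub> F)"
    using genideal_ideal[OF sub] by (simp add: ideal_Rn_iff)
  show "mono_ideal ?X G \<subseteq> Idl\<^bsub>Rn c n\<^esub> F"
  proof
    fix f :: "'a mpoly" assume f: "f \<in> mono_ideal ?X G"
    have "single u (lookup f u) \<in> Idl\<^bsub>Rn c n\<^esub> F" if u: "u \<in> keys f" for u
    proof -
      obtain g w where gw: "g \<in> G" "u = g + w" using f u by (auto simp: mono_ideal_def)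
      have "keys u \<subseteq> ?X" using f u polys_keysD by (auto simp: mono_ideal_def)
      then have "keys w \<subseteq> ?X" by (auto simp: gw keys_add_mon)
      moreover have "mono_poly g \<in> Idl\<^bsub>Rn c n\<^esub> F" using genideal_self[OF sub] assms(1) gw(1) by blast
      ultimately have "single w (lookup f u) * mono_poly g \<in> Idl\<^bsub>Rn c n\<^esub> F"
        by (intro pideal_mult[OF id] polys_single)
      then show ?thesis by (simp add: gw mult_single add.commute)
    qed
    then have "(\<Sum>u\<in>keys f. single u (lookup f u)) \<in> Idl\<^bsub>Rn c n\<^esub> F" by (intro pideal_sum[OF id])
    then show "f \<in> Idl\<^bsub>Rn c n\<^esub> F" by (simp flip: poly_sum_monomials)
  qed
qed

lemma Idl_mono_poly:
  assumes "\<And>u. u \<in> G \<Longrightarrow> keys u \<subseteq> xvars c n"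
  shows "Idl\<^bsub>Rn c n\<^esub> (mono_poly ` G) = (mono_ideal (xvars c n) G :: 'a::field mpoly set)"
proof (rule Idl_eq_mono_ideal)
  have "\<exists>h\<in>G. \<exists>w. g = h + w" if "g \<in> G" for g
    using that by (intro bexI[of _ g] exI[of _ 0]) auto
  then show "mono_poly ` G \<subseteq> (mono_ideal (xvars c n) G :: 'a mpoly set)"
    using assms by (auto simp: mono_ideal_def intro!: polys_single)
qed simp

lemma Mons_of_xvars: "keys u \<subseteq> xvars c n \<Longrightarrow> u \<in> Mons c"
  by (force simp: Mons_def xvars_def)

context
  fixes c :: nat and r :: "mon rel"
  assumes r: "monomial_order c r"
begin

lemma ord_props: "refl_on (Mons c) r" "trans r" "antisym r" "total_on (Mons c) r"
  using r by (simp_all add: monomial_order_def order_on_defs)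

lemma ord_refl: "u \<in> Mons c \<Longrightarrow> (u, u) \<in> r"
  using refl_onD[OF ord_props(1)] .

lemma ord_trans: "(u, v) \<in> r \<Longrightarrow> (v, w) \<in> r \<Longrightarrow> (u, w) \<in> r"
  using transD[OF ord_props(2)] .

lemma ord_antisym: "(u, v) \<in> r \<Longrightarrow> (v, u) \<in> r \<Longrightarrow> u = v"
  using antisymD[OF ord_props(3)] .

lemma ord_total: "u \<in> Mons c \<Longrightarrow> v \<in> Mons c \<Longrightarrow> (u, v) \<in> r \<or> (v, u) \<in> r"
  using ord_refl[of u] ord_props(4) by (cases "u = v") (simp_all add: total_on_def)

lemma ord_add: "(u, v) \<in> r \<Longrightarrow> w \<in> Mons c \<Longrightarrow> (u + w, v + w) \<in> r"
  using r by (simp add: monomial_order_def)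

lemma ord_zero: "u \<in> Mons c \<Longrightarrow> (0, u) \<in> r"
  using r by (simp add: monomial_order_def)

lemma init_mon_eqI:
  assumes "u \<in> keys f" "\<And>v. v \<in> keys f \<Longrightarrow> (v, u) \<in> r"
  shows "init_mon r f = u"
  unfolding init_mon_def
proof (rule the_equality)
  fix v assume "v \<in> keys f \<and> (\<forall>w\<in>keys f. (w, v) \<in> r)"
  then show "v = u" using assms by (intro ord_antisym) auto
qed (use assms in auto)

lemma init_mon:
  assumes "f \<noteq> 0" "keys f \<subseteq> Mons c"
  shows "init_mon r f \<in> keys f" "v \<in> keys f \<Longrightarrow> (v, init_mon r f) \<in> r"
proof -
  have "\<exists>u\<in>A. \<forall>v\<in>A. (v, u) \<in> r" if "finite A" "A \<noteq> {}" "A \<subseteq> Mons c" for A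
    using that
  proof (induction A rule: finite_ne_induct)
    case (singleton x) then show ?case using ord_refl by auto
  next
    case (insert x A)
    then obtain u where u: "u \<in> A" "\<forall>v\<in>A. (v, u) \<in> r" by auto
    have "(x, u) \<in> r \<or> (u, x) \<in> r" using ord_total[of x u] insert.prems u(1) by auto
    then show ?case
    proof
      assume "(x, u) \<in> r" then show ?case using u by auto
    next
      assume "(u, x) \<in> r"
      then show ?case using u ord_trans ord_refl[of x] insert.prems by blast
    qed
  qed
  from this[of "keys f"] obtain u where u: "u \<in> keys f" "\<forall>v\<in>keys f. (v, u) \<in> r"
    using assms by auto
  then have "init_mon r f = u" by (intro init_mon_eqI) auto
  then show "init_mon r f \<in> keys f" "v \<in> keys f \<Longrightarrow> (v, init_mon r f) \<in> r" using u by auto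
qed

end

definition init_mons :: "mon rel \<Rightarrow> 'a::field mpoly set \<Rightarrow> mon set" where
  "init_mons r J = {init_mon r f | f. f \<in> J \<and> f \<noteq> 0}"

context
  fixes c n :: nat and r :: "mon rel" and J :: "'a::field mpoly set"
  assumes r: "monomial_order c r" and J: "pideal (xvars c n) J"
begin

lemma keys_Mons: "f \<in> J \<Longrightarrow> keys f \<subseteq> Mons c"
  by (intro subsetI Mons_of_xvars[of _ c n] polys_keysD[OF pideal_subset[OF J]])

lemma init_monsE:
  assumes "u \<in> init_mons r J"
  obtains f where "f \<in> J" "f \<noteq> 0" "u = init_mon r f" "u \<in> keys f" "\<And>v. v \<in> keys f \<Longrightarrow> (v, u) \<in> r"
proof -
  obtain f where f: "u = init_mon r f" "f \<in> J" "f \<noteq> 0" using assms by (auto simp: init_mons_def)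
  show ?thesis
    by (rule that[OF f(2,3,1)]) (unfold f(1), (rule init_mon[OF r f(3) keys_Mons[OF f(2)]], assumption?)+)
qed

lemma init_mons_xvars: "u \<in> init_mons r J \<Longrightarrow> keys u \<subseteq> xvars c n"
  by (erule init_monsE) (rule polys_keysD[OF pideal_subset[OF J]])

lemma init_mons_add:
  assumes "u \<in> init_mons r J" "keys w \<subseteq> xvars c n"
  shows "u + w \<in> init_mons r J"
proof -
  obtain f where f: "u = init_mon r f" "f \<in> J" "f \<noteq> 0" using assms(1) by (auto simp: init_mons_def)
  note i = init_mon[OF r f(3) keys_Mons[OF f(2)]]
  have wf: "single w 1 * f \<in> J" using assms(2) by (intro pideal_mult[OF J] polys_single f(2))
  have lk: "lookup (single w 1 * f) (w + v) = lookup f v" for v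
  proof -
    have "single w 1 * f = (\<Sum>v\<in>keys f. single (w + v) (lookup f v))"
      by (subst poly_sum_monomials[of f]) (simp add: sum_distrib_left mult_single)
    then have "lookup (single w 1 * f) (w + v) = (\<Sum>u\<in>keys f. if u = v then lookup f v else 0)"
      by (auto simp: lookup_sum lookup_single when_def intro!: sum.cong)
    also have "\<dots> = lookup f v" by (simp add: in_keys_iff)
    finally show ?thesis .
  qed
  have "init_mon r (single w 1 * f) = u + w"
  proof (rule init_mon_eqI[OF r])
    have "w + u \<in> keys (single w 1 * f)" using i(1) by (simp add: in_keys_iff lk f(1))
    then show "u + w \<in> keys (single w 1 * f)" by (simp add: add.commute)
    fix v assume "v \<in> keys (single w 1 * f)"
    then obtain a b where "v = a + b" "a \<in> keys (single w (1::'a))" "b \<in> keys f" by (rule keys_multE)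
    then have "v = b + w" "b \<in> keys f" by (auto simp: add.commute split: if_splits)
    then show "(v, u + w) \<in> r"
      using i(2) ord_add[OF r] Mons_of_xvars[OF assms(2)] f(1) by metis
  qed
  moreover have "single w 1 * f \<noteq> 0" using f(3) lk by (metis lookup_zero poly_mapping_eqI)
  ultimately show ?thesis
    using wf unfolding init_mons_def by (intro CollectI exI[of _ "single w 1 * f"]) simp
qed

text \<open>Initial monomials are closed under multiplication by monomials
  (\<open>init_mons_add\<close>), so generating an ideal adds no new monomials and in(J) is their
  linear span.\<close>

lemma init_ideal_eq: "init_ideal c r n J = {f \<in> polys (xvars c n). keys f \<subseteq> init_mons r J}"
proof -
  have "{mono_poly (init_mon r f) | f. f \<in> J \<and> f \<noteq> 0} = (mono_poly ` init_mons r J :: 'a mpoly set)"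
    by (auto simp: init_mons_def)
  then have "init_ideal c r n J = mono_ideal (xvars c n) (init_mons r J)"
    unfolding init_ideal_def using Idl_mono_poly[OF init_mons_xvars] by simp
  also have "\<dots> = {f \<in> polys (xvars c n). keys f \<subseteq> init_mons r J}"
  proof (intro equalityI subsetI)
    fix f :: "'a mpoly" assume f: "f \<in> mono_ideal (xvars c n) (init_mons r J)"
    have "u \<in> init_mons r J" if u: "u \<in> keys f" for u
    proof -
      obtain g w where gw: "g \<in> init_mons r J" "u = g + w" using f u by (auto simp: mono_ideal_def)
      have "keys u \<subseteq> xvars c n" using polys_keysD f u by (auto simp: mono_ideal_def)
      then show ?thesis using gw by (auto intro!: init_mons_add simp: keys_add_mon)
    qed
    then show "f \<in> {f \<in> polys (xvars c n). keys f \<subseteq> init_mons r J}" using f by (auto simp: mono_ideal_def)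
  next
    fix f :: "'a mpoly" assume f: "f \<in> {f \<in> polys (xvars c n). keys f \<subseteq> init_mons r J}"
    have "\<exists>g\<in>init_mons r J. \<exists>w. u = g + w" if "u \<in> keys f" for u
      using f that by (intro bexI[of _ u] exI[of _ 0]) auto
    then show "f \<in> mono_ideal (xvars c n) (init_mons r J)" using f by (auto simp: mono_ideal_def)
  qed
  finally show ?thesis .
qed

text \<open>As 1 is the least monomial, a polynomial with initial monomial 1 is a nonzero
  constant.\<close>

lemma zero_in_init_mons_iff: "0 \<in> init_mons r J \<longleftrightarrow> 1 \<in> J"
proof
  assume "0 \<in> init_mons r J"
  then obtain f where f: "init_mon r f = 0" "f \<in> J" "f \<noteq> 0" by (auto simp: init_mons_def)
  note i = init_mon[OF r f(3) keys_Mons[OF f(2)]]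
  have "keys f \<subseteq> {0}"
    using i(2) f(1) ord_zero[OF r] ord_antisym[OF r] keys_Mons[OF f(2)] by fastforce
  then have eq: "f = single 0 (lookup f 0)"
    by (intro poly_mapping_eqI) (auto simp: lookup_single when_def in_keys_iff)
  have nz: "lookup f 0 \<noteq> 0" using i(1) f(1) by (simp add: in_keys_iff)
  have "single 0 (1 / lookup f 0) * f \<in> J" by (intro pideal_mult[OF J] polys_const f(2))
  also have "single 0 (1 / lookup f 0) * f = 1" using nz by (subst eq) (simp add: mult_single)
  finally show "1 \<in> J" .
next
  assume "1 \<in> J"
  moreover have "init_mon r (1 :: 'a mpoly) = 0"
    using init_mon(1)[OF r, of "1 :: 'a mpoly"] by (simp add: Mons_def)
  ultimately show "0 \<in> init_mons r J" unfolding init_mons_def using one_neq_zero by force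
qed

text \<open>The exponent differences of strict comparisons are closed under addition, by
  compatibility of the order with products, and never vanish. So finitely many of them are positive
  under a common integer functional (\<open>positive_functional_exists\<close>).\<close>

lemma initial_weight:
  assumes U: "finite U" "U \<subseteq> init_mons r J"
  shows "\<exists>w. (\<forall>x\<in>xvars c n. w x \<ge> 1) \<and> (\<forall>u\<in>U. \<exists>g\<in>J. u \<in> keys g \<and>
    (\<forall>v\<in>keys g - {u}. wdeg (xvars c n) w v < wdeg (xvars c n) w u))"
proof -
  let ?X = "xvars c n"
  define df where "df u v = (\<lambda>x. int (lookup u x) - int (lookup v x))" for u v :: mon
  define P where "P = {df u v | u v. keys u \<subseteq> ?X \<and> keys v \<subseteq> ?X \<and> (v, u) \<in> r \<and> u \<noteq> v}"
  have "\<exists>g. g \<in> J \<and> u \<in> keys g \<and> (\<forall>v\<in>keys g. (v, u) \<in> r)" if "u \<in> U" for u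
    by (rule init_monsE[OF subsetD[OF U(2) that]]) blast
  then obtain g where g: "\<And>u. u \<in> U \<Longrightarrow> g u \<in> J \<and> u \<in> keys (g u) \<and> (\<forall>v\<in>keys (g u). (v, u) \<in> r)"
    by metis
  \<comment> \<open>The comparisons to be copied, together with those of each variable with 1, which
    make the weights positive.\<close>
  define D where "D = (\<Union>u\<in>U. df u ` (keys (g u) - {u})) \<union> (\<lambda>x. df (single x 1) 0) ` ?X"
  have finD: "finite D" using U(1) by (simp add: D_def)
  have kg: "keys v \<subseteq> ?X" if "u \<in> U" "v \<in> keys (g u)" for u v
    using g[OF that(1)] that(2) pideal_subset[OF J] polys_keysD by blast
  have unit: "df (single x 1) 0 \<in> P" if x: "x \<in> ?X" for x
  proof -
    have "keys (single x (1::nat)) \<subseteq> ?X" using x by simp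
    moreover from this have "(0, single x 1) \<in> r" by (intro ord_zero[OF r] Mons_of_xvars)
    moreover have "single x (1::nat) \<noteq> 0" by (rule single_one_nonzero)
    ultimately show ?thesis unfolding P_def by fastforce
  qed
  have DP: "D \<subseteq> P"
    using g kg unit unfolding D_def P_def by blast
  have "(\<lambda>x. d x + e x) \<in> P" if de: "d \<in> P" "e \<in> P" for d e
  proof -
    obtain u v u' v' where *: "d = df u v" "keys u \<subseteq> ?X" "keys v \<subseteq> ?X" "(v, u) \<in> r" "u \<noteq> v"
      "e = df u' v'" "keys u' \<subseteq> ?X" "keys v' \<subseteq> ?X" "(v', u') \<in> r" "u' \<noteq> v'"
      using de unfolding P_def by blast
    have 1: "(v + v', u + v') \<in> r" by (rule ord_add[OF r *(4) Mons_of_xvars[OF *(8)]])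
    have 2: "(u + v', u + u') \<in> r"
      using ord_add[OF r *(9) Mons_of_xvars[OF *(2)]] by (simp add: add.commute)
    have "u + u' \<noteq> v + v'"
    proof
      assume "u + u' = v + v'"
      then have "u + v' = u + u'" using 1 2 ord_antisym[OF r] by metis
      then show False using *(10) by simp
    qed
    then have "df (u + u') (v + v') \<in> P"
      unfolding P_def using * ord_trans[OF r 1 2]
      by (intro CollectI exI[of _ "u + u'"] exI[of _ "v + v'"]) (auto simp: keys_add_mon)
    also have "df (u + u') (v + v') = (\<lambda>x. d x + e x)" by (auto simp: df_def * lookup_add)
    finally show ?thesis .
  qed
  moreover have "\<exists>x\<in>?X. d x \<noteq> 0" if d: "d \<in> P" for d
  proof (rule ccontr)
    assume neg: "\<not> ?thesis"
    obtain u v where *: "d = df u v" "keys u \<subseteq> ?X" "keys v \<subseteq> ?X" "u \<noteq> v" using d unfolding P_def by blast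
    have "lookup u x = lookup v x" for x
    proof (cases "x \<in> ?X")
      case True then show ?thesis using neg by (auto simp: * df_def)
    next
      case False
      then have "x \<notin> keys u" "x \<notin> keys v" using * by auto
      then show ?thesis by (simp add: in_keys_iff)
    qed
    then show False using *(4) poly_mapping_eqI by blast
  qed
  ultimately obtain w where w: "\<forall>d\<in>D. (\<Sum>x\<in>?X. w x * d x) > 0"
    using positive_functional_exists[OF _ finD DP] by (metis finite_xvars)
  have pos: "w x > 0" if x: "x \<in> ?X" for x
  proof -
    have "(\<Sum>y\<in>?X. w y * df (single x 1) 0 y) = (\<Sum>y\<in>?X. if y = x then w x else 0)"
      by (intro sum.cong) (auto simp: df_def lookup_single when_def)
    then have "(\<Sum>y\<in>?X. w y * df (single x 1) 0 y) = w x" using x by simp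
    moreover have "df (single x 1) 0 \<in> D" using x by (simp add: D_def)
    ultimately show ?thesis using w by metis
  qed
  define w' where "w' x = nat (w x)" for x
  have int_w: "int (wdeg ?X w' u) = (\<Sum>x\<in>?X. w x * int (lookup u x))" for u
    unfolding wdeg_def of_nat_sum using pos by (intro sum.cong) (auto simp: w'_def less_imp_le)
  have "wdeg ?X w' v < wdeg ?X w' u" if uv: "u \<in> U" "v \<in> keys (g u) - {u}" for u v
  proof -
    have "df u v \<in> D" using uv by (auto simp: D_def)
    then have "0 < (\<Sum>x\<in>?X. w x * df u v x)" using w by blast
    also have "\<dots> = int (wdeg ?X w' u) - int (wdeg ?X w' v)"
      by (simp add: int_w df_def right_diff_distrib sum_subtractf)
    finally show ?thesis by simp
  qed
  moreover have "w' x \<ge> 1" if "x \<in> ?X" for x using pos[OF that] by (simp add: w'_def)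
  ultimately show ?thesis using g by (intro exI[of _ w']) blast
qed

text \<open>The upper bound is \<open>pflag_length_bound\<close> with a weight from
  \<open>initial_weight\<close>; the lower bound is \<open>prime_chain_over_ideal\<close> for a
  largest independent set.\<close>

theorem krull_dim_quot:
  assumes d: "max_indep (xvars c n) (init_mons r J) d"
  shows "krull_dim (Rn c n Quot J) = ereal (real d)"
proof -
  let ?X = "xvars c n"
  interpret ring "Rn c n :: 'a mpoly ring" by (rule Rn_ring)
  have chain: "(\<exists>P. prime_chain (Rn c n Quot J) k P) \<longleftrightarrow> (\<exists>Q. prime_chain (Rn c n) k Q \<and> J \<subseteq> Q 0)" for k
    by (rule prime_chain_quot_iff) (use J in \<open>simp_all add: ideal_Rn_iff Rn_cring\<close>)
  have upper: "k \<le> d" if k: "prime_chain (Rn c n) k Q" "J \<subseteq> Q 0" for k Q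
  proof -
    obtain ys where ys: "length ys = k" "pflag ?X (Q 0) ys"
      using pflag_of_chain[of k ?X Q] k(1) by (auto simp: prime_chain_Rn)
    \<comment> \<open>One initial monomial inside each dependent set of variables detects all
      dependence, so finitely many comparisons suffice for the weight.\<close>
    define \<D> where "\<D> = {S. S \<subseteq> ?X \<and> \<not> indep_set ?X (init_mons r J) S}"
    have "\<exists>u. u \<in> init_mons r J \<and> keys u \<subseteq> S" if "S \<in> \<D>" for S
      using that by (auto simp: \<D>_def indep_set_def)
    then obtain u where u: "\<And>S. S \<in> \<D> \<Longrightarrow> u S \<in> init_mons r J \<and> keys (u S) \<subseteq> S" by metis
    have "finite \<D>" by (rule finite_subset[of _ "Pow ?X"]) (auto simp: \<D>_def)
    then have U: "finite (u ` \<D>)" "u ` \<D> \<subseteq> init_mons r J" using u by auto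
    obtain w where w: "\<forall>x\<in>?X. w x \<ge> 1" "\<forall>u\<in>u ` \<D>. \<exists>g\<in>J. u \<in> keys g \<and>
      (\<forall>v\<in>keys g - {u}. wdeg ?X w v < wdeg ?X w u)" using initial_weight[OF U] by blast
    have "length ys \<le> d"
    proof (rule pflag_length_bound[where w = w, OF _ _ J ys(2) k(2) U(1)])
      show "card S \<le> d" if S: "S \<subseteq> ?X" "\<And>v. v \<in> u ` \<D> \<Longrightarrow> \<not> keys v \<subseteq> S" for S
      proof -
        have "S \<notin> \<D>" using S(2) u by blast
        then show ?thesis using d S(1) by (auto simp: \<D>_def max_indep_def)
      qed
    qed (use w in auto)
    then show ?thesis using ys(1) by simp
  qed
  obtain S where S: "indep_set ?X (init_mons r J) S" "card S = d" using d by (auto simp: max_indep_def)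
  \<comment> \<open>The initial monomial of a nonzero \<open>f\<close> in K[S] would be supported in
    \<open>S\<close>.\<close>
  have "f = 0" if f: "f \<in> J" "f \<in> polys S" for f
  proof (rule ccontr)
    assume "f \<noteq> 0"
    then have "init_mon r f \<in> init_mons r J" "keys (init_mon r f) \<subseteq> S"
      using f init_mon(1)[OF r _ keys_Mons[OF f(1)]] polys_keysD by (auto simp: init_mons_def)
    then show False using S(1) by (auto simp: indep_set_def)
  qed
  then have "J \<inter> polys S = {0}" using pideal_zero[OF J] by auto
  then obtain Q where Q: "prime_chain (Rn c n) d Q" "J \<subseteq> Q 0"
    using prime_chain_over_ideal[OF finite_xvars J, of S] S by (auto simp: indep_set_def prime_chain_Rn)
  show ?thesis unfolding krull_dim_def chain
  proof (rule antisym)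
    show "(SUP k\<in>{k. \<exists>Q. prime_chain (Rn c n) k Q \<and> J \<subseteq> Q 0}. ereal (real k)) \<le> ereal (real d)"
      using upper by (intro SUP_least) auto
    show "ereal (real d) \<le> (SUP k\<in>{k. \<exists>Q. prime_chain (Rn c n) k Q \<and> J \<subseteq> Q 0}. ereal (real k))"
      using Q by (intro SUP_upper) blast
  qed
qed

lemma codim_init_ideal:
  assumes "max_indep (xvars c n) (init_mons r J) d"
  shows "codim (Rn c n) (init_ideal c r n J) = ereal (real (c * n) - real d)"
  using codim_monomial_ideal[OF init_mons_xvars assms] by (simp add: init_ideal_eq)

end

lemma no_prime_over_one:
  assumes "1 \<in> J"
  shows "\<not> (pprime X Q \<and> J \<subseteq> Q)"
  using assms by (auto simp: pprime_def)

lemma codim_unit: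
  assumes "1 \<in> J"
  shows "codim (Rn c n) J = \<infinity>"
proof -
  have eq: "{Q. primeideal Q (Rn c n) \<and> J \<subseteq> Q} = {}"
    using no_prime_over_one[OF assms] by (auto simp: primeideal_Rn_iff)
  show ?thesis unfolding codim_def eq by (simp add: top_ereal_def)
qed

lemma krull_dim_quot_unit:
  assumes "pideal (xvars c n) J" "1 \<in> J"
  shows "krull_dim (Rn c n Quot J) = - \<infinity>"
proof -
  interpret ring "Rn c n :: 'a mpoly ring" by (rule Rn_ring)
  have "{k. \<exists>P. prime_chain (Rn c n Quot J) k P} = {k. \<exists>Q. prime_chain (Rn c n) k Q \<and> J \<subseteq> Q 0}"
    by (intro Collect_cong prime_chain_quot_iff) (use assms in \<open>simp_all add: ideal_Rn_iff Rn_cring\<close>)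
  also have "\<dots> = {}"
    using no_prime_over_one[OF assms(2)] by (auto simp: prime_chain_Rn)
  finally have eq: "{k. \<exists>P. prime_chain (Rn c n Quot J) k P} = {}" .
  show ?thesis unfolding krull_dim_def eq by (simp add: bot_ereal_def)
qed


section \<open>Increasing maps and their action on monomials and polynomials\<close>

section \<open>The action of increasing maps\<close>

lemma Inc_ge1: "\<pi> \<in> Inc i \<Longrightarrow> j \<ge> 1 \<Longrightarrow> \<pi> j \<ge> 1"
  by (auto simp: Inc_def)

lemma Inc_less: "\<pi> \<in> Inc i \<Longrightarrow> 1 \<le> j \<Longrightarrow> j < l \<Longrightarrow> \<pi> j < \<pi> l"
  by (auto simp: Inc_def strict_mono_on_def)

lemma Inc_fix: "\<pi> \<in> Inc i \<Longrightarrow> 1 \<le> j \<Longrightarrow> j \<le> i \<Longrightarrow> \<pi> j = j"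
  by (auto simp: Inc_def)

lemma Inc_inj: "\<pi> \<in> Inc i \<Longrightarrow> 1 \<le> j \<Longrightarrow> 1 \<le> l \<Longrightarrow> \<pi> j = \<pi> l \<Longrightarrow> j = l"
  by (metis Inc_less less_irrefl linorder_neqE_nat)

lemma Inc_le: "\<pi> \<in> Inc i \<Longrightarrow> 1 \<le> j \<Longrightarrow> j \<le> l \<Longrightarrow> \<pi> j \<le> \<pi> l"
  using Inc_less[of \<pi> i j l] by (cases "j = l") auto

lemma Inc_gt_iff: "\<pi> \<in> Inc i \<Longrightarrow> 1 \<le> j \<Longrightarrow> \<pi> j > i \<longleftrightarrow> j > i"
proof -
  assume \<pi>: "\<pi> \<in> Inc i" and j: "1 \<le> j"
  have "\<pi> j > i" if "j > i"
  proof (cases "i = 0")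
    case True then show ?thesis using Inc_ge1[OF \<pi> j] by simp
  next
    case False
    then show ?thesis using Inc_less[OF \<pi>, of i j] Inc_fix[OF \<pi>, of i] that by simp
  qed
  then show ?thesis using Inc_fix[OF \<pi> j] by (cases "j \<le> i") auto
qed

lemma id_Inc_mn: "m \<le> n \<Longrightarrow> (\<lambda>j. j) \<in> Inc_mn i m n"
  by (auto simp: Inc_mn_def Inc_def strict_mono_on_def)

lemma Inc_mnI:
  assumes "\<And>j. 1 \<le> j \<Longrightarrow> \<pi> j \<ge> 1" "\<And>j l. 1 \<le> j \<Longrightarrow> j < l \<Longrightarrow> \<pi> j < \<pi> l"
    "\<And>j. 1 \<le> j \<Longrightarrow> j \<le> i \<Longrightarrow> \<pi> j = j" "\<pi> m \<le> n"
  shows "\<pi> \<in> Inc_mn i m n"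
  using assms by (auto simp: Inc_mn_def Inc_def strict_mono_on_def)

lemma Inc_mn_extend:
  assumes "\<And>j. 1 \<le> j \<Longrightarrow> j \<le> m \<Longrightarrow> 1 \<le> g j \<and> g j \<le> n"
    "\<And>j l. 1 \<le> j \<Longrightarrow> j < l \<Longrightarrow> l \<le> m \<Longrightarrow> g j < g l"
    "\<And>j. 1 \<le> j \<Longrightarrow> j \<le> m \<Longrightarrow> j \<le> i \<Longrightarrow> g j = j" "1 \<le> m" "i \<le> n"
  obtains \<pi> where "\<pi> \<in> Inc_mn i m n" "\<And>j. 1 \<le> j \<Longrightarrow> j \<le> m \<Longrightarrow> \<pi> j = g j"
proof
  \<comment> \<open>Beyond \<open>m\<close> the map stays the identity up to \<open>i\<close>, as
    membership in \<open>Inc i\<close> demands, and then continues with n + j, past all values used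
    so far.\<close>
  define \<pi> where "\<pi> j = (if j \<le> m then g j else if j \<le> i then j else n + j)" for j
  show "\<pi> j = g j" if "1 \<le> j" "j \<le> m" for j using that by (simp add: \<pi>_def)
  show "\<pi> \<in> Inc_mn i m n"
  proof (rule Inc_mnI)
    show "\<pi> j < \<pi> l" if jl: "1 \<le> j" "j < l" for j l
    proof (cases "l \<le> m")
      case True then show ?thesis using jl assms(2)[of j l] by (simp add: \<pi>_def)
    next
      case False
      then show ?thesis using jl assms(1,3)[of j] by (auto simp: \<pi>_def)
    qed
  qed (use assms in \<open>auto simp: \<pi>_def\<close>)
qed

text \<open>An intermediate level \<open>r\<close> can always be inserted. This lets a map between
  distant levels be compared with generation from a level in between.\<close>

lemma Inc_factor:
  assumes \<pi>: "\<pi> \<in> Inc_mn i m n" and "1 \<le> m" "m \<le> r" "r \<le> n"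
  obtains \<sigma> \<rho> where "\<sigma> \<in> Inc_mn i m r" "\<rho> \<in> Inc_mn i r n"
    "\<And>j. 1 \<le> j \<Longrightarrow> j \<le> m \<Longrightarrow> \<pi> j = \<rho> (\<sigma> j)"
proof
  have I: "\<pi> \<in> Inc i" "\<pi> m \<le> n" using \<pi> by (auto simp: Inc_mn_def)
  \<comment> \<open>\<open>\<sigma>\<close> follows \<open>\<pi>\<close> but shifts each column by
    at most \<open>e\<close>, which keeps the first \<open>m\<close> columns within
    \<open>r\<close>; \<open>\<rho>\<close> makes up for the missing shift.\<close>
  define e where "e = r - m"
  define \<sigma> where "\<sigma> j = min (\<pi> j) (e + j)" for j
  define \<rho> where "\<rho> l = (if l \<le> e then l else max l (\<pi> (l - e)))" for l
  show "\<sigma> \<in> Inc_mn i m r"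
  proof (rule Inc_mnI)
    show "\<sigma> j < \<sigma> l" if "1 \<le> j" "j < l" for j l
      using Inc_less[OF I(1) that] that by (auto simp: \<sigma>_def)
    show "\<sigma> m \<le> r" using assms by (simp add: \<sigma>_def e_def)
  qed (use Inc_ge1[OF I(1)] Inc_fix[OF I(1)] in \<open>auto simp: \<sigma>_def\<close>)
  show "\<rho> \<in> Inc_mn i r n"
  proof (rule Inc_mnI)
    show "\<rho> j < \<rho> l" if jl: "1 \<le> j" "j < l" for j l
    proof (cases "j \<le> e")
      case True
      then show ?thesis using jl by (auto simp: \<rho>_def)
    next
      case False
      then have "\<pi> (j - e) < \<pi> (l - e)" using jl by (intro Inc_less[OF I(1)]) auto
      then show ?thesis using False jl by (auto simp: \<rho>_def)
    qed
    show "\<rho> j = j" if j: "1 \<le> j" "j \<le> i" for j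
      using Inc_fix[OF I(1), of "j - e"] j by (auto simp: \<rho>_def)
    show "\<rho> r \<le> n" using assms I by (auto simp: \<rho>_def e_def)
  qed (auto simp: \<rho>_def)
  show "\<pi> j = \<rho> (\<sigma> j)" if j: "1 \<le> j" "j \<le> m" for j
  proof (cases "\<pi> j \<le> e + j")
    case True
    then have "\<pi> (\<pi> j - e) \<le> \<pi> j" if "\<pi> j > e" using that by (intro Inc_le[OF I(1)]) auto
    then show ?thesis using True by (auto simp: \<rho>_def \<sigma>_def)
  next
    case False
    then show ?thesis using j by (auto simp: \<rho>_def \<sigma>_def)
  qed
qed

lemma lookup_act_mon:
  assumes \<pi>: "\<pi> \<in> Inc i" and u: "u \<in> Mons c"
  shows "j \<ge> 1 \<Longrightarrow> lookup (act_mon \<pi> u) (k, \<pi> j) = lookup u (k, j)"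
    and "keys (act_mon \<pi> u) = (\<lambda>(k, j). (k, \<pi> j)) ` keys u"
proof -
  have ge: "j \<ge> 1" if "(k, j) \<in> keys u" for k j using u that by (auto simp: Mons_def)
  have eq: "lookup (act_mon \<pi> u) (k, l) = (\<Sum>(k', j)\<in>keys u. if k' = k \<and> \<pi> j = l then lookup u (k', j) else 0)" for k l
    unfolding act_mon_def lookup_sum
    by (intro sum.cong) (auto simp: lookup_single when_def split: prod.splits)
  show *: "lookup (act_mon \<pi> u) (k, \<pi> j) = lookup u (k, j)" if j: "j \<ge> 1" for k j
  proof -
    have "lookup (act_mon \<pi> u) (k, \<pi> j) = (\<Sum>x\<in>keys u. if x = (k, j) then lookup u (k, j) else 0)"
      unfolding eq
    proof (rule sum.cong[OF refl])
      fix x assume "x \<in> keys u"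
      then show "(case x of (k', j') \<Rightarrow> if k' = k \<and> \<pi> j' = \<pi> j then lookup u (k', j') else 0) =
        (if x = (k, j) then lookup u (k, j) else 0)"
        using ge Inc_inj[OF \<pi> _ j] by (cases x) auto
    qed
    also have "\<dots> = lookup u (k, j)" by (simp add: in_keys_iff)
    finally show ?thesis .
  qed
  show "keys (act_mon \<pi> u) = (\<lambda>(k, j). (k, \<pi> j)) ` keys u"
  proof (intro equalityI subsetI)
    fix x assume x: "x \<in> keys (act_mon \<pi> u)"
    obtain k l where kl: "x = (k, l)" by (cases x)
    have "\<exists>y\<in>keys u. (case y of (k', j) \<Rightarrow> if k' = k \<and> \<pi> j = l then lookup u (k', j) else 0) \<noteq> 0"
    proof (rule ccontr)
      assume "\<not> ?thesis"
      then have "lookup (act_mon \<pi> u) (k, l) = 0" unfolding eq by (intro sum.neutral) blast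
      then show False using x kl by (simp add: in_keys_iff)
    qed
    then show "x \<in> (\<lambda>(k, j). (k, \<pi> j)) ` keys u" using kl by (force split: if_splits)
  next
    fix x assume "x \<in> (\<lambda>(k, j). (k, \<pi> j)) ` keys u"
    then obtain k j where "(k, j) \<in> keys u" "x = (k, \<pi> j)" by auto
    then show "x \<in> keys (act_mon \<pi> u)" using *[OF ge] by (auto simp: in_keys_iff)
  qed
qed

lemma act_mon_Mons:
  assumes \<pi>: "\<pi> \<in> Inc i" and u: "u \<in> Mons c"
  shows "act_mon \<pi> u \<in> Mons c"
  using u Inc_ge1[OF \<pi>] unfolding Mons_def by (auto simp: lookup_act_mon(2)[OF \<pi> u])

lemma act_mon_eqI:
  assumes \<pi>: "\<pi> \<in> Inc i" and u: "u \<in> Mons c" and v: "keys v \<subseteq> (\<lambda>(k, j). (k, \<pi> j)) ` (UNIV \<times> {1..})"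
    and eq: "\<And>k j. j \<ge> 1 \<Longrightarrow> lookup v (k, \<pi> j) = lookup u (k, j)"
  shows "act_mon \<pi> u = v"
proof (rule poly_mapping_eqI)
  fix x :: "nat \<times> nat"
  obtain k l where x: "x = (k, l)" by (cases x)
  show "lookup (act_mon \<pi> u) x = lookup v x"
  proof (cases "\<exists>j\<ge>1. l = \<pi> j")
    case True
    then show ?thesis using lookup_act_mon(1)[OF \<pi> u] eq x by auto
  next
    case False
    then have "x \<notin> keys v" using v x by auto
    moreover have "x \<notin> keys (act_mon \<pi> u)"
      using False x u by (force simp: lookup_act_mon(2)[OF \<pi> u] Mons_def)
    ultimately show ?thesis by (simp add: in_keys_iff)
  qed
qed

lemma act_mon_inj:
  assumes \<pi>: "\<pi> \<in> Inc i" and u: "u \<in> Mons c" "v \<in> Mons c" "act_mon \<pi> u = act_mon \<pi> v"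
  shows "u = v"
proof (rule poly_mapping_eqI)
  fix x :: "nat \<times> nat"
  obtain k j where x: "x = (k, j)" by (cases x)
  show "lookup u x = lookup v x"
  proof (cases "j \<ge> 1")
    case True
    then show ?thesis using lookup_act_mon(1)[OF \<pi> u(1) True] lookup_act_mon(1)[OF \<pi> u(2) True] u(3) x by metis
  next
    case False
    then have "x \<notin> keys u" "x \<notin> keys v" using u x by (auto simp: Mons_def)
    then show ?thesis by (simp add: in_keys_iff)
  qed
qed

lemma act_mon_comp:
  assumes \<sigma>: "\<sigma> \<in> Inc i" and \<rho>: "\<rho> \<in> Inc i" and \<pi>: "\<pi> \<in> Inc i" and u: "keys u \<subseteq> xvars c m"
    and eq: "\<And>j. 1 \<le> j \<Longrightarrow> j \<le> m \<Longrightarrow> \<pi> j = \<rho> (\<sigma> j)"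
  shows "act_mon \<rho> (act_mon \<sigma> u) = act_mon \<pi> u"
proof -
  have uM: "u \<in> Mons c" by (rule Mons_of_xvars[OF u])
  have k1: "keys (act_mon \<sigma> u) = (\<lambda>(k, j). (k, \<sigma> j)) ` keys u" by (rule lookup_act_mon(2)[OF \<sigma> uM])
  have "keys (act_mon \<rho> (act_mon \<sigma> u)) = (\<lambda>(k, j). (k, \<rho> j)) ` keys (act_mon \<sigma> u)"
    by (rule lookup_act_mon(2)[OF \<rho> act_mon_Mons[OF \<sigma> uM]])
  also have "\<dots> = (\<lambda>(k, j). (k, \<pi> j)) ` keys u"
    unfolding k1 image_image using u eq by (intro image_cong) (auto simp: xvars_def)
  finally have k2: "keys (act_mon \<rho> (act_mon \<sigma> u)) = (\<lambda>(k, j). (k, \<pi> j)) ` keys u" .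
  have k3: "keys (act_mon \<pi> u) = (\<lambda>(k, j). (k, \<pi> j)) ` keys u" by (rule lookup_act_mon(2)[OF \<pi> uM])
  show ?thesis
  proof (rule poly_mapping_eqI)
    fix x
    show "lookup (act_mon \<rho> (act_mon \<sigma> u)) x = lookup (act_mon \<pi> u) x"
    proof (cases "x \<in> (\<lambda>(k, j). (k, \<pi> j)) ` keys u")
      case True
      then obtain k j where kj: "(k, j) \<in> keys u" "x = (k, \<pi> j)" by auto
      then have j: "1 \<le> j" "j \<le> m" using u by (auto simp: xvars_def)
      show ?thesis
        using lookup_act_mon(1)[OF \<pi> uM j(1)] lookup_act_mon(1)[OF \<sigma> uM j(1)]
          lookup_act_mon(1)[OF \<rho> act_mon_Mons[OF \<sigma> uM] Inc_ge1[OF \<sigma> j(1)]] eq[OF j] kj(2) by metis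
    next
      case False
      then have "x \<notin> keys (act_mon \<rho> (act_mon \<sigma> u))" "x \<notin> keys (act_mon \<pi> u)"
        using False by (simp_all only: k2 k3 not_False_eq_True)
      then show ?thesis by (simp add: in_keys_iff)
    qed
  qed
qed

text \<open>Increasing maps act injectively on monomials, so no terms merge or cancel.\<close>

lemma keys_act:
  assumes \<pi>: "\<pi> \<in> Inc i" and f: "keys f \<subseteq> Mons c"
  shows "keys (act \<pi> f) = act_mon \<pi> ` keys f"
proof -
  have inj: "inj_on (act_mon \<pi>) (keys f)"
    using act_mon_inj[OF \<pi>] f by (meson inj_onI subsetD)
  have eq: "act \<pi> f = (\<Sum>v\<in>act_mon \<pi> ` keys f. single v (lookup f (inv_into (keys f) (act_mon \<pi>) v)))"
    unfolding act_def by (subst sum.reindex[OF inj]) (auto simp: inj intro!: sum.cong)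
  have "lookup (act \<pi> f) v = (if v \<in> act_mon \<pi> ` keys f then lookup f (inv_into (keys f) (act_mon \<pi>) v) else 0)" for v
  proof -
    have "lookup (act \<pi> f) v = (\<Sum>w\<in>act_mon \<pi> ` keys f. if w = v then lookup f (inv_into (keys f) (act_mon \<pi>) v) else 0)"
      unfolding eq lookup_sum by (intro sum.cong) (auto simp: lookup_single when_def)
    then show ?thesis by simp
  qed
  moreover have "lookup f (inv_into (keys f) (act_mon \<pi>) v) \<noteq> 0" if "v \<in> act_mon \<pi> ` keys f" for v
    using inv_into_into[OF that] by (simp add: in_keys_iff)
  ultimately show ?thesis by (auto simp: in_keys_iff split: if_splits)
qed

lemma act_single: "act \<pi> (mono_poly u) = (mono_poly (act_mon \<pi> u) :: 'a::field mpoly)"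
  by (simp add: act_def)

lemma act_zero_mon [simp]: "act_mon \<pi> 0 = 0"
  by (simp add: act_mon_def)

section \<open>The lemmas of Dickson and Higman\<close>

section \<open>Well-quasi-orders\<close>

definition almost_full :: "('b \<Rightarrow> 'b \<Rightarrow> bool) \<Rightarrow> bool" where
  "almost_full P \<longleftrightarrow> (\<forall>f :: nat \<Rightarrow> 'b. \<exists>j k. j < k \<and> P (f j) (f k))"

lemma almost_fullD: "almost_full P \<Longrightarrow> \<exists>j k. j < k \<and> P (f j) (f k)" for f :: "nat \<Rightarrow> 'b"
  by (simp add: almost_full_def)

text \<open>Ramsey's theorem for pairs coloured by whether \<open>P\<close> holds. A homogeneous
  subsequence of the bad colour would contradict almost-fullness.\<close>

lemma almost_full_subseq:
  assumes "almost_full P"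
  obtains \<phi> :: "nat \<Rightarrow> nat" where "strict_mono \<phi>" "\<And>j k. j < k \<Longrightarrow> P (f (\<phi> j)) (f (\<phi> k))"
proof -
  define col where "col e = (if P (f (Min e)) (f (Max e)) then 0 else 1 :: nat)" for e :: "nat set"
  have "\<exists>Y t. Y \<subseteq> UNIV \<and> infinite Y \<and> t < 2 \<and> (\<forall>x\<in>Y. \<forall>y\<in>Y. x \<noteq> y \<longrightarrow> col {x, y} = t)"
    by (rule Ramsey2) (auto simp: col_def)
  then obtain Y t where Y: "infinite Y" and "\<forall>x\<in>Y. \<forall>y\<in>Y. x \<noteq> y \<longrightarrow> col {x, y} = t"
    by (elim exE conjE) (rule that)
  then have hom: "col {x, y} = t" if "x \<in> Y" "y \<in> Y" "x \<noteq> y" for x y using that by simp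
  define \<phi> where "\<phi> = enumerate Y"
  have \<phi>: "strict_mono \<phi>" "\<phi> k \<in> Y" for k
    unfolding \<phi>_def using Y by (auto simp: strict_mono_enumerate enumerate_in_set)
  have c: "col {\<phi> j, \<phi> k} = t \<and> (col {\<phi> j, \<phi> k} = 0 \<longleftrightarrow> P (f (\<phi> j)) (f (\<phi> k)))" if "j < k" for j k
    using hom[OF \<phi>(2) \<phi>(2), of j k] strict_monoD[OF \<phi>(1) that] by (auto simp: col_def split: if_splits)
  obtain j k where "j < k" "P (f (\<phi> j)) (f (\<phi> k))"
    using assms[unfolded almost_full_def, rule_format, of "\<lambda>k. f (\<phi> k)"] by blast
  then have "t = 0" using c by metis
  then show ?thesis using that[OF \<phi>(1)] c by blast
qed

lemma almost_full_conj:
  assumes "almost_full (\<lambda>x y. P (g x) (g y))" "almost_full (\<lambda>x y. Q (h x) (h y))"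
  shows "almost_full (\<lambda>x y. P (g x) (g y) \<and> Q (h x) (h y))"
  unfolding almost_full_def
proof
  fix f :: "nat \<Rightarrow> 'a"
  obtain \<phi> :: "nat \<Rightarrow> nat" where \<phi>: "strict_mono \<phi>" "\<And>j k. j < k \<Longrightarrow> P (g (f (\<phi> j))) (g (f (\<phi> k)))"
    using almost_full_subseq[OF assms(1)] by blast
  obtain j k where "j < k" "Q (h (f (\<phi> j))) (h (f (\<phi> k)))"
    using assms(2)[unfolded almost_full_def, rule_format, of "\<lambda>j. f (\<phi> j)"] by blast
  then show "\<exists>j k. j < k \<and> P (g (f j)) (g (f k)) \<and> Q (h (f j)) (h (f k))"
    using \<phi> by (intro exI[of _ "\<phi> j"] exI[of _ "\<phi> k"]) (auto simp: strict_monoD)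
qed

lemma almost_full_vimage: "almost_full P \<Longrightarrow> almost_full (\<lambda>x y. P (g x) (g y))"
  unfolding almost_full_def[of "\<lambda>x y. P (g x) (g y)"] by (intro allI almost_fullD)

lemma almost_full_nat: "almost_full (\<lambda>x y :: nat. x \<le> y)"
  unfolding almost_full_def
proof
  fix f :: "nat \<Rightarrow> nat"
  obtain j where "\<And>k. f j \<le> f k"
    using ex_has_least_nat[of "\<lambda>_. True" 0 f] by auto
  then show "\<exists>j k. j < k \<and> f j \<le> f k" by (intro exI[of _ j] exI[of _ "Suc j"]) auto
qed

lemma dickson:
  assumes "finite K"
  shows "almost_full (\<lambda>x y :: 'k \<Rightarrow> nat. \<forall>k\<in>K. x k \<le> y k)"
  using assms
proof (induction K rule: finite_induct)
  case empty
  show ?case by (auto simp: almost_full_def)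
next
  case (insert k K)
  have "almost_full (\<lambda>x y :: 'k \<Rightarrow> nat. x k \<le> y k)"
    by (rule almost_full_vimage[OF almost_full_nat, of "\<lambda>x. x k"])
  from almost_full_conj[of "(\<le>)" "\<lambda>x. x k" _ "\<lambda>x. x", OF this insert.IH] show ?case by simp
qed

text \<open>Nash-Williams' construction. \<open>closed\<close> says that membership in
  \<open>B\<close> is decided by pairs of positions, so the limit of the successive choices stays in
  \<open>B\<close>.\<close>

lemma minimal_bad_sequence:
  fixes B :: "(nat \<Rightarrow> 'b) \<Rightarrow> bool" and size :: "'b \<Rightarrow> nat"
  assumes ex: "B h" and closed: "\<And>f g. (\<And>j k. j < k \<Longrightarrow> \<exists>g. B g \<and> g j = f j \<and> g k = f k) \<Longrightarrow> B f"
  obtains f where "B f" "\<And>n g. B g \<Longrightarrow> (\<And>k. k < n \<Longrightarrow> g k = f k) \<Longrightarrow> size (f n) \<le> size (g n)"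
proof -
  \<comment> \<open>Among the sequences in \<open>B\<close> that agree with \<open>g\<close> below
    \<open>n\<close>, one with the smallest entry at \<open>n\<close>.\<close>
  define pick where "pick n g = arg_min (\<lambda>h. size (h n)) (\<lambda>h. B h \<and> (\<forall>k<n. h k = g k))" for n g
  define G where "G = rec_nat (pick 0 h) (\<lambda>n g. pick (Suc n) g)"
  have G: "G 0 = pick 0 h" "G (Suc n) = pick (Suc n) (G n)" for n by (simp_all add: G_def)
  have pick: "B (pick n g) \<and> (\<forall>k<n. pick n g k = g k)" if "B g" for n g
    unfolding pick_def by (rule arg_min_natI[of "\<lambda>h. B h \<and> (\<forall>k<n. h k = g k)" g]) (use that in auto)
  have min: "size (pick n g n) \<le> size (g' n)" if "B g'" "\<forall>k<n. g' k = g k" for n g g'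
    using arg_min_nat_le[of "\<lambda>h. B h \<and> (\<forall>k<n. h k = g k)" g' "\<lambda>h. size (h n)"] that
    by (simp add: pick_def)
  have BG: "B (G n)" for n by (induction n) (use pick ex in \<open>auto simp: G\<close>)
  define f where "f n = G n n" for n
  have agree: "G n k = f k" if "k \<le> n" for n k
    using that
  proof (induction n)
    case (Suc n)
    then show ?case using pick[OF BG, of "Suc n" n] by (cases "k = Suc n") (auto simp: f_def G)
  qed (simp add: f_def)
  show ?thesis
  proof
    show "B f"
    proof (rule closed)
      fix j k :: nat assume "j < k"
      then show "\<exists>g. B g \<and> g j = f j \<and> g k = f k"
        using BG agree by (intro exI[of _ "G k"]) auto
    qed
    fix n g assume g: "B g" "\<And>k. k < n \<Longrightarrow> g k = f k"
    show "size (f n) \<le> size (g n)"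
    proof (cases n)
      case 0 then show ?thesis using min[of g 0 h] g(1) by (simp add: f_def G)
    next
      case (Suc m)
      have "\<forall>k<n. g k = G m k" using g(2) agree Suc by auto
      then show ?thesis using min[of g n "G m"] g(1) Suc by (simp add: f_def G)
    qed
  qed
qed

text \<open>Take a bad sequence of words that is minimal in length and a subsequence with increasing
  first letters. Removing these letters yields a bad sequence that contradicts minimality.\<close>

lemma higman:
  assumes "almost_full P"
  shows "almost_full (list_emb P)"
proof (rule ccontr)
  define B where "B f \<longleftrightarrow> (\<forall>j k :: nat. j < k \<longrightarrow> \<not> list_emb P (f j) (f k))" for f
  assume "\<not> almost_full (list_emb P)"
  then obtain h where "B h" by (auto simp: almost_full_def B_def)
  moreover have "B f" if "\<And>j k. j < k \<Longrightarrow> \<exists>g. B g \<and> g j = f j \<and> g k = f k" for f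
    unfolding B_def using that by (metis B_def)
  ultimately obtain f where f: "B f"
    "\<And>n g. B g \<Longrightarrow> (\<And>k. k < n \<Longrightarrow> g k = f k) \<Longrightarrow> length (f n) \<le> length (g n)"
    using minimal_bad_sequence[of B h length] by blast
  have ne: "f n \<noteq> []" for n
    using f(1)[unfolded B_def, rule_format, of n "Suc n"] by auto
  then have dec: "f n = hd (f n) # tl (f n)" for n by simp
  obtain \<phi> :: "nat \<Rightarrow> nat" where \<phi>: "strict_mono \<phi>" "\<And>j k. j < k \<Longrightarrow> P (hd (f (\<phi> j))) (hd (f (\<phi> k)))"
    using almost_full_subseq[OF assms, of "\<lambda>n. hd (f n)"] by blast
  \<comment> \<open>The minimal sequence is kept below position \<open>\<phi> 0\<close>; from there
    on come the shortened words of the subsequence.\<close>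
  define g where "g n = (if n < \<phi> 0 then f n else tl (f (\<phi> (n - \<phi> 0))))" for n
  have \<phi>0: "\<phi> 0 \<le> \<phi> k" for k using \<phi>(1) by (simp add: strict_mono_less_eq)
  have "B g"
    unfolding B_def
  proof (intro allI impI notI)
    fix j k :: nat assume jk: "j < k" and emb: "list_emb P (g j) (g k)"
    consider "k < \<phi> 0" | "j < \<phi> 0" "\<phi> 0 \<le> k" | "\<phi> 0 \<le> j" using jk by linarith
    then show False
    proof cases
      case 1
      then show ?thesis using emb jk f(1) by (simp add: g_def B_def)
    next
      case 2
      then have "list_emb P (f j) (tl (f (\<phi> (k - \<phi> 0))))" using emb by (simp add: g_def)
      then have "list_emb P (f j) (f (\<phi> (k - \<phi> 0)))" using dec by (metis list_emb_Cons)
      moreover have "j < \<phi> (k - \<phi> 0)" using 2 \<phi>0[of "k - \<phi> 0"] by simp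
      ultimately show ?thesis using f(1) by (simp add: B_def)
    next
      case 3
      let ?j = "j - \<phi> 0" and ?k = "k - \<phi> 0"
      have lt: "?j < ?k" using 3 jk by simp
      have "list_emb P (tl (f (\<phi> ?j))) (tl (f (\<phi> ?k)))" using emb 3 jk by (simp add: g_def)
      then have "list_emb P (f (\<phi> ?j)) (f (\<phi> ?k))"
        using \<phi>(2)[OF lt] dec by (metis list_emb_Cons2)
      then show ?thesis using f(1) strict_monoD[OF \<phi>(1) lt] by (simp add: B_def)
    qed
  qed
  then have "length (f (\<phi> 0)) \<le> length (g (\<phi> 0))" by (rule f(2)) (simp add: g_def)
  also have "\<dots> < length (f (\<phi> 0))" using ne[of "\<phi> 0"] by (simp add: g_def)
  finally show False by simp
qed

lemma list_emb_index_map: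
  assumes "list_emb P xs ys"
  shows "\<exists>\<sigma>. (\<forall>k<length xs. \<sigma> k < length ys \<and> P (xs ! k) (ys ! \<sigma> k)) \<and>
    (\<forall>k l. k < l \<longrightarrow> l < length xs \<longrightarrow> \<sigma> k < (\<sigma> l :: nat))"
  using assms
proof (induction rule: list_emb.induct)
  case (list_emb_Nil ys)
  then show ?case by simp
next
  case (list_emb_Cons xs ys y)
  then obtain \<sigma> where \<sigma>: "\<forall>k<length xs. \<sigma> k < length ys \<and> P (xs ! k) (ys ! \<sigma> k)"
    "\<forall>k l. k < l \<longrightarrow> l < length xs \<longrightarrow> \<sigma> k < (\<sigma> l :: nat)" by blast
  then show ?case by (intro exI[of _ "\<lambda>k. Suc (\<sigma> k)"]) auto
next
  case (list_emb_Cons2 x y xs ys)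
  then obtain \<sigma> where \<sigma>: "\<forall>k<length xs. \<sigma> k < length ys \<and> P (xs ! k) (ys ! \<sigma> k)"
    "\<forall>k l. k < l \<longrightarrow> l < length xs \<longrightarrow> \<sigma> k < (\<sigma> l :: nat)" by blast
  define \<tau> where "\<tau> k = (case k of 0 \<Rightarrow> 0 | Suc k \<Rightarrow> Suc (\<sigma> k))" for k
  have "\<tau> k < length (y # ys) \<and> P ((x # xs) ! k) ((y # ys) ! \<tau> k)" if "k < length (x # xs)" for k
    using that \<sigma>(1) list_emb_Cons2(1) by (cases k) (auto simp: \<tau>_def)
  moreover have "\<tau> k < \<tau> l" if "k < l" "l < length (x # xs)" for k l
    using that \<sigma>(2) by (cases k; cases l) (auto simp: \<tau>_def)
  ultimately show ?case by blast
qed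

section \<open>Noetherianity up to the action of increasing maps\<close>

section \<open>Chains of monomial ideals\<close>

text \<open>\<open>M n\<close> stands for the monomials of the n-th ideal in an invariant chain of
  monomial ideals. Coefficients have disappeared; what remains is combinatorics of
  exponents.\<close>

locale monomial_chain =
  fixes c i :: nat and M :: "nat \<Rightarrow> mon set"
  assumes xvars: "\<And>n u. 1 \<le> n \<Longrightarrow> u \<in> M n \<Longrightarrow> keys u \<subseteq> xvars c n"
    and add: "\<And>n u w. 1 \<le> n \<Longrightarrow> u \<in> M n \<Longrightarrow> keys w \<subseteq> xvars c n \<Longrightarrow> u + w \<in> M n"
    and act: "\<And>m n u \<pi>. 1 \<le> m \<Longrightarrow> m \<le> n \<Longrightarrow> u \<in> M m \<Longrightarrow> \<pi> \<in> Inc_mn i m n \<Longrightarrow> act_mon \<pi> u \<in> M n"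
begin

definition generated_from :: "nat \<Rightarrow> bool" where
  "generated_from r \<longleftrightarrow> (\<forall>n\<ge>r. \<forall>v\<in>M n. \<exists>u\<in>M r. \<exists>\<pi>\<in>Inc_mn i r n. \<exists>w. v = act_mon \<pi> u + w)"

text \<open>The first \<open>i\<close> columns of a monomial are a vector of fixed length (Dickson);
  the later columns form a word over vectors of length \<open>c\<close> (Higman). An embedding of
  words tells where the columns beyond \<open>i\<close> go, and so defines an increasing map that
  fixes the first \<open>i\<close>.\<close>

lemma embedding_exists:
  fixes n :: "nat \<Rightarrow> nat" and v :: "nat \<Rightarrow> mon"
  assumes n: "\<And>k. 1 \<le> n k \<and> i \<le> n k" "\<And>j k. j < k \<Longrightarrow> n j \<le> n k" and v: "\<And>k. v k \<in> M (n k)"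
  shows "\<exists>j k. j < k \<and> (\<exists>\<pi>\<in>Inc_mn i (n j) (n k). \<exists>w. v k = act_mon \<pi> (v j) + w)"
proof -
  define wd where "wd k = map (\<lambda>j t. lookup (v k) (t, j)) [Suc i..<Suc (n k)]" for k
  have "almost_full (\<lambda>j k. (\<forall>x\<in>{1..c} \<times> {1..i}. lookup (v j) x \<le> lookup (v k) x) \<and>
      list_emb (\<lambda>a b. \<forall>t\<in>{1..c}. a t \<le> b t) (wd j) (wd k))"
  proof (rule almost_full_conj[of "\<lambda>f g. \<forall>x\<in>{1..c} \<times> {1..i}. f x \<le> g x" "\<lambda>k. lookup (v k)"])
    show "almost_full (\<lambda>j k. \<forall>x\<in>{1..c} \<times> {1..i}. lookup (v j) x \<le> lookup (v k) x)"
      by (rule almost_full_vimage[OF dickson]) simp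
    show "almost_full (\<lambda>j k. list_emb (\<lambda>a b. \<forall>t\<in>{1..c}. a t \<le> b t) (wd j) (wd k))"
      by (rule almost_full_vimage[OF higman[OF dickson]]) simp
  qed
  from almost_fullD[OF this, of "\<lambda>k. k"] obtain j k where
    jk: "j < k" "\<forall>x\<in>{1..c} \<times> {1..i}. lookup (v j) x \<le> lookup (v k) x"
    "list_emb (\<lambda>a b. \<forall>t\<in>{1..c}. a t \<le> b t) (wd j) (wd k)"
    by (elim exE conjE) (rule that)
  obtain \<sigma> where \<sigma>: "\<And>l. l < n j - i \<Longrightarrow> \<sigma> l < n k - i \<and> (\<forall>t\<in>{1..c}. (wd j ! l) t \<le> (wd k ! \<sigma> l) t)"
    "\<And>l l'. l < l' \<Longrightarrow> l' < n j - i \<Longrightarrow> \<sigma> l < \<sigma> l'"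
    using list_emb_index_map[OF jk(3)] by (auto simp: wd_def simp del: upt_Suc)
  define g where "g p = (if p \<le> i then p else Suc i + \<sigma> (p - Suc i))" for p
  have gn: "1 \<le> g p \<and> g p \<le> n k" if p: "1 \<le> p" "p \<le> n j" for p
  proof (cases "p \<le> i")
    case True then show ?thesis using p n(1)[of k] by (simp add: g_def)
  next
    case False
    then have "\<sigma> (p - Suc i) < n k - i" using \<sigma>(1)[of "p - Suc i"] p by auto
    then show ?thesis using False by (simp add: g_def)
  qed
  have glt: "g p < g q" if pq: "p < q" "q \<le> n j" for p q
    using \<sigma>(2)[of "p - Suc i" "q - Suc i"] pq by (auto simp: g_def)
  obtain \<pi> where \<pi>: "\<pi> \<in> Inc_mn i (n j) (n k)" "\<And>p. 1 \<le> p \<Longrightarrow> p \<le> n j \<Longrightarrow> \<pi> p = g p"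
    by (rule Inc_mn_extend[of "n j" g "n k" i]) (use gn glt n(1) in \<open>auto simp: g_def\<close>)
  have I: "\<pi> \<in> Inc i" using \<pi>(1) by (simp add: Inc_mn_def)
  have vx: "keys (v j) \<subseteq> xvars c (n j)" using xvars n(1) v by blast
  have "lookup (act_mon \<pi> (v j)) x \<le> lookup (v k) x" for x
  proof (cases "x \<in> keys (act_mon \<pi> (v j))")
    case True
    then obtain t p where tp: "(t, p) \<in> keys (v j)" "x = (t, \<pi> p)"
      unfolding lookup_act_mon(2)[OF I Mons_of_xvars[OF vx]] by auto
    then have p: "1 \<le> p" "p \<le> n j" "t \<in> {1..c}" using vx by (auto simp: xvars_def)
    have eq: "lookup (act_mon \<pi> (v j)) x = lookup (v j) (t, p)"
      using lookup_act_mon(1)[OF I Mons_of_xvars[OF vx] p(1)] tp(2) by simp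
    show ?thesis
    proof (cases "p \<le> i")
      case True
      then show ?thesis using eq jk(2) p tp(2) \<pi>(2)[OF p(1,2)] by (auto simp: g_def)
    next
      case False
      let ?l = "p - Suc i"
      have l: "?l < n j - i" using False p(2) by auto
      have "wd j ! ?l = (\<lambda>t. lookup (v j) (t, p))" using l False by (simp add: wd_def nth_upt del: upt_Suc)
      moreover have "wd k ! \<sigma> ?l = (\<lambda>t. lookup (v k) (t, \<pi> p))"
      proof -
        have "\<sigma> ?l < n k - i" using \<sigma>(1)[OF l] by blast
        then have "Suc i + \<sigma> ?l < Suc (n k)" "\<sigma> ?l < length [Suc i..<Suc (n k)]" by (simp_all del: upt_Suc)
        then show ?thesis using False \<pi>(2)[OF p(1,2)] by (simp add: wd_def g_def nth_upt del: upt_Suc)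
      qed
      ultimately show ?thesis using \<sigma>(1)[OF l] p(3) eq tp(2) by auto
    qed
  qed (simp add: in_keys_iff)
  then obtain w where "v k = act_mon \<pi> (v j) + w" using mon_le_obtain by metis
  then show ?thesis using jk(1) \<pi>(1) by blast
qed

text \<open>If no level generates, choose levels a_0 <= a_1 <= ... and monomials V(a_k) at level
  a_(k+1) that do not come from level a_k. Some V(a_j) with j < k divides V(a_k) after an increasing
  map; factoring this map through level a_k contradicts the choice of V(a_k).\<close>

lemma generated_from_exists: "\<exists>r\<ge>1. generated_from r"
proof (rule ccontr)
  assume neg: "\<not> ?thesis"
  define ok where "ok r n v \<longleftrightarrow> r \<le> n \<and> v \<in> M n \<and> \<not> (\<exists>u\<in>M r. \<exists>\<pi>\<in>Inc_mn i r n. \<exists>w. v = act_mon \<pi> u + w)"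
    for r n :: nat and v :: mon
  have "\<forall>r\<ge>1. \<exists>n v. ok r n v"
    using neg unfolding generated_from_def ok_def by (metis (no_types, lifting))
  then obtain N V where NV: "\<And>r. 1 \<le> r \<Longrightarrow> ok r (N r) (V r)" by metis
  \<comment> \<open>Starting at max(i, 1) makes every level large enough to extend maps that fix the
    first \<open>i\<close> columns.\<close>
  define a where "a k = (N ^^ k) (max i 1)" for k
  have a1: "1 \<le> a k \<and> i \<le> a k" for k
  proof (induction k)
    case (Suc k)
    then show ?case using NV[of "a k"] by (auto simp: a_def ok_def)
  qed (simp add: a_def)
  have okk: "ok (a k) (a (Suc k)) (V (a k))" for k using NV[of "a k"] a1[of k] by (simp add: a_def)
  then have mono: "a j \<le> a k" if "j \<le> k" for j k
    using lift_Suc_mono_le[of a, OF _ that] by (simp add: ok_def)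
  obtain j k \<pi> w where jk: "j < k" "\<pi> \<in> Inc_mn i (a (Suc j)) (a (Suc k))" "V (a k) = act_mon \<pi> (V (a j)) + w"
    using embedding_exists[of "\<lambda>k. a (Suc k)" "\<lambda>k. V (a k)"] a1 mono okk by (force simp: ok_def)
  have Vj: "V (a j) \<in> M (a (Suc j))" using okk by (simp add: ok_def)
  \<comment> \<open>Level a_k lies between a_(j+1) and a_(k+1) because j < k.\<close>
  obtain \<sigma> \<rho> where \<sigma>: "\<sigma> \<in> Inc_mn i (a (Suc j)) (a k)" and \<rho>: "\<rho> \<in> Inc_mn i (a k) (a (Suc k))"
    and eq: "\<And>l. 1 \<le> l \<Longrightarrow> l \<le> a (Suc j) \<Longrightarrow> \<pi> l = \<rho> (\<sigma> l)"
    by (rule Inc_factor[OF jk(2), of "a k"]) (use a1 mono jk(1) in auto)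
  have "act_mon \<rho> (act_mon \<sigma> (V (a j))) = act_mon \<pi> (V (a j))"
    by (rule act_mon_comp[where m = "a (Suc j)" and i = i])
      (use \<sigma> \<rho> jk(2) xvars[OF _ Vj] a1 eq in \<open>auto simp: Inc_mn_def\<close>)
  moreover have "act_mon \<sigma> (V (a j)) \<in> M (a k)"
    by (rule act[OF _ _ Vj \<sigma>]) (use a1 mono jk(1) in auto)
  ultimately show False using okk[of k] \<rho> jk(3) unfolding ok_def by metis
qed

end


section \<open>Column counts and growth of largest independent sets\<close>

section \<open>Growth of maximal independent sets along a chain\<close>

lemma finite_nat_enumeration:
  fixes P :: "nat set"
  assumes "finite P"
  obtains p where "\<And>j. j < card P \<Longrightarrow> p j \<in> P" "\<And>j l. j < l \<Longrightarrow> l < card P \<Longrightarrow> p j < p l"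
proof
  let ?xs = "sorted_list_of_set P"
  have len: "length ?xs = card P" by simp
  show "?xs ! j \<in> P" if "j < card P" for j
    using nth_mem[of j ?xs] that assms by (simp add: len)
  show "?xs ! j < ?xs ! l" if "j < l" "l < card P" for j l
    using sorted_wrt_nth_less[OF strict_sorted_list_of_set[of P], of j l] that by (simp add: len)
qed

lemma pigeonhole_fibre:
  assumes "finite T" "f ` E \<subseteq> T" "finite E" "card T * r < card E"
  shows "\<exists>y\<in>T. r < card {x \<in> E. f x = y}"
proof (rule ccontr)
  assume neg: "\<not> ?thesis"
  have "E \<subseteq> (\<Union>y\<in>T. {x \<in> E. f x = y})" using assms(2) by auto
  then have "card E \<le> card (\<Union>y\<in>T. {x \<in> E. f x = y})"
    using assms(1,3) by (intro card_mono) auto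
  also have "\<dots> \<le> (\<Sum>y\<in>T. card {x \<in> E. f x = y})" by (rule card_UN_le[OF assms(1)])
  also have "\<dots> \<le> (\<Sum>y\<in>T. r)" using neg by (intro sum_mono) (auto simp: not_less)
  finally show False using assms(4) by simp
qed

lemma eventually_constant_int:
  fixes f :: "nat \<Rightarrow> int"
  assumes "\<And>n. n \<ge> n0 \<Longrightarrow> f n \<le> f (Suc n)" "\<And>n. n \<ge> n0 \<Longrightarrow> f n \<le> b"
  shows "\<exists>B. \<forall>\<^sub>F n in sequentially. f n = B"
proof -
  obtain m where m: "m \<ge> n0" "\<And>k. k \<ge> n0 \<Longrightarrow> nat (b - f m) \<le> nat (b - f k)"
    using ex_has_least_nat[of "\<lambda>m. m \<ge> n0" n0 "\<lambda>m. nat (b - f m)"] by auto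
  have "f n = f m" if "n \<ge> m" for n
    using that
  proof (induction n rule: dec_induct)
    case (step n)
    then show ?case using assms(1)[of n] assms(2)[of "Suc n"] assms(2)[of m] m(1) m(2)[of "Suc n"] by auto
  qed simp
  then show ?thesis using eventually_sequentially by blast
qed

definition column :: "(nat \<times> nat) set \<Rightarrow> nat \<Rightarrow> nat set" where
  "column S j = {k. (k, j) \<in> S}"

lemma column_subset: "S \<subseteq> xvars c n \<Longrightarrow> column S j \<subseteq> {1..c}"
  by (auto simp: column_def xvars_def)

lemma card_column_le:
  assumes "S \<subseteq> xvars c n"
  shows "card (column S j) \<le> c"
  using card_mono[OF finite_atLeastAtMost column_subset[OF assms, of j]] by simp

lemma card_columns:
  assumes "S \<subseteq> xvars c n"
  shows "card S = (\<Sum>j\<in>{1..n}. card (column S j))"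
proof -
  have "S = (\<lambda>(j, k). (k, j)) ` (SIGMA j:{1..n}. column S j)"
    using assms by (force simp: column_def xvars_def image_iff)
  moreover have "inj_on (\<lambda>(j, k). (k, j)) (SIGMA j:{1..n}. column S j)" by (auto intro: inj_onI)
  ultimately have "card S = card (SIGMA j:{1..n}. column S j)" by (metis card_image)
  also have "\<dots> = (\<Sum>j\<in>{1..n}. card (column S j))"
    by (rule card_SigmaI) (use finite_subset[OF column_subset[OF assms]] in auto)
  finally show ?thesis .
qed

lemma indep_set_mono: "indep_set X M S \<Longrightarrow> S' \<subseteq> S \<Longrightarrow> indep_set X M S'"
  unfolding indep_set_def by blast

text \<open>The parameter \<open>g\<close> is the paper's \<open>\<gamma>\<^sub>i\<close>, with all monomials of \<open>M r\<close> in place of the minimal ones.\<close>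

locale generated_chain = monomial_chain +
  fixes r g :: nat
  assumes gen: "generated_from r" and r1: "1 \<le> r" and nz: "0 \<notin> M r"
    and cover: "\<exists>C\<subseteq>{1..c}. card C = g \<and>
      (\<forall>u\<in>M r. (\<forall>(k, j)\<in>keys u. i < j) \<longrightarrow> (\<exists>k\<in>C. \<exists>j. (k, j) \<in> keys u))"
    and cover_min: "\<And>C. C \<subseteq> {1..c} \<Longrightarrow>
      (\<forall>u\<in>M r. (\<forall>(k, j)\<in>keys u. i < j) \<longrightarrow> (\<exists>k\<in>C. \<exists>j. (k, j) \<in> keys u)) \<Longrightarrow> g \<le> card C"
begin

lemma g_le: "g \<le> c"
  using cover card_mono[of "{1..c}"] by auto

lemma genE:
  assumes "r \<le> n" "v \<in> M n"
  obtains u \<pi> where "u \<in> M r" "\<pi> \<in> Inc_mn i r n" "\<pi> \<in> Inc i" "keys u \<subseteq> xvars c r"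
    "keys (act_mon \<pi> u) = (\<lambda>(k, j). (k, \<pi> j)) ` keys u" "keys (act_mon \<pi> u) \<subseteq> keys v"
proof -
  obtain u \<pi> w where *: "u \<in> M r" "\<pi> \<in> Inc_mn i r n" "v = act_mon \<pi> u + w"
    using gen assms unfolding generated_from_def by blast
  have I: "\<pi> \<in> Inc i" using *(2) by (simp add: Inc_mn_def)
  have u: "keys u \<subseteq> xvars c r" by (rule xvars[OF r1 *(1)])
  show ?thesis
    by (rule that[OF *(1,2) I u lookup_act_mon(2)[OF I Mons_of_xvars[OF u]]]) (simp add: *(3) keys_add_mon)
qed

lemma zero_notin: "r \<le> n \<Longrightarrow> 0 \<notin> M n"
proof
  assume "r \<le> n" "0 \<in> M n"
  then obtain u \<pi> where "u \<in> M r" "keys (act_mon \<pi> u) = (\<lambda>(k, j). (k, \<pi> j)) ` keys u"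
    "keys (act_mon \<pi> u) \<subseteq> keys (0 :: mon)" by (rule genE)
  then show False using nz by simp
qed

text \<open>For initial monomials and n >= r this is dim R_n/I_n, by
  \<open>krull_dim_quot\<close>.\<close>

definition \<alpha> :: "nat \<Rightarrow> nat" where
  "\<alpha> n = (SOME d. max_indep (xvars c n) (M n) d)"

lemma max_indep_\<alpha>: "r \<le> n \<Longrightarrow> max_indep (xvars c n) (M n) (\<alpha> n)"
  unfolding \<alpha>_def by (rule someI_ex) (use max_indep_exists[OF finite_xvars zero_notin] in blast)

text \<open>Generation from level \<open>r\<close> makes independence local: it is tested on the
  \<open>r\<close> columns selected by each increasing map. This is what allows columns to be
  repeated and inserted.\<close>

lemma indep_iff:
  assumes n: "r \<le> n"
  shows "indep_set (xvars c n) (M n) S \<longleftrightarrow> S \<subseteq> xvars c n \<and>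
    (\<forall>\<pi>\<in>Inc_mn i r n. indep_set (xvars c r) (M r) {(k, j) \<in> xvars c r. (k, \<pi> j) \<in> S})"
proof (intro iffI conjI ballI)
  assume S: "indep_set (xvars c n) (M n) S"
  then show "S \<subseteq> xvars c n" by (simp add: indep_set_def)
  fix \<pi> assume \<pi>: "\<pi> \<in> Inc_mn i r n"
  then have I: "\<pi> \<in> Inc i" by (simp add: Inc_mn_def)
  show "indep_set (xvars c r) (M r) {(k, j) \<in> xvars c r. (k, \<pi> j) \<in> S}"
    unfolding indep_set_def
  proof (intro conjI ballI notI)
    fix u assume u: "u \<in> M r" "keys u \<subseteq> {(k, j) \<in> xvars c r. (k, \<pi> j) \<in> S}"
    have "keys (act_mon \<pi> u) = (\<lambda>(k, j). (k, \<pi> j)) ` keys u"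
      by (rule lookup_act_mon(2)[OF I Mons_of_xvars[OF xvars[OF r1 u(1)]]])
    then have "keys (act_mon \<pi> u) \<subseteq> S" using u(2) by auto
    moreover have "act_mon \<pi> u \<in> M n" by (rule act[OF r1 n u(1) \<pi>])
    ultimately show False using S by (auto simp: indep_set_def)
  qed auto
next
  assume S: "S \<subseteq> xvars c n \<and>
    (\<forall>\<pi>\<in>Inc_mn i r n. indep_set (xvars c r) (M r) {(k, j) \<in> xvars c r. (k, \<pi> j) \<in> S})"
  show "indep_set (xvars c n) (M n) S"
    unfolding indep_set_def
  proof (intro conjI ballI notI)
    fix v assume v: "v \<in> M n" "keys v \<subseteq> S"
    obtain u \<pi> where u: "u \<in> M r" "\<pi> \<in> Inc_mn i r n" "keys u \<subseteq> xvars c r"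
      "keys (act_mon \<pi> u) = (\<lambda>(k, j). (k, \<pi> j)) ` keys u" "keys (act_mon \<pi> u) \<subseteq> keys v"
      by (rule genE[OF n v(1)])
    have "(\<lambda>(k, j). (k, \<pi> j)) ` keys u \<subseteq> S" using u(4,5) v(2) by auto
    then have "keys u \<subseteq> {(k, j) \<in> xvars c r. (k, \<pi> j) \<in> S}" using u(3) by auto
    then show False using S u(1,2) unfolding indep_set_def by blast
  qed (use S in auto)
qed

text \<open>The rows outside a minimum cover, in the columns beyond \<open>i\<close>, are
  independent. A monomial supported there would come from some \<open>u\<close> whose columns also
  lie beyond \<open>i\<close> (\<open>Inc_gt_iff\<close>), and \<open>u\<close> would escape the
  cover.\<close>

lemma lower_bound:
  assumes "r \<le> n"
  shows "(c - g) * (n - i) \<le> \<alpha> n"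
proof -
  obtain C where C: "C \<subseteq> {1..c}" "card C = g"
    "\<forall>u\<in>M r. (\<forall>(k, j)\<in>keys u. i < j) \<longrightarrow> (\<exists>k\<in>C. \<exists>j. (k, j) \<in> keys u)" using cover by blast
  let ?S = "({1..c} - C) \<times> {Suc i..n}"
  have "indep_set (xvars c n) (M n) ?S"
    unfolding indep_set_def
  proof (intro conjI ballI notI)
    show "?S \<subseteq> xvars c n" by (auto simp: xvars_def)
    fix v assume v: "v \<in> M n" "keys v \<subseteq> ?S"
    obtain u \<pi> where u: "u \<in> M r" "\<pi> \<in> Inc i" "keys u \<subseteq> xvars c r"
      "keys (act_mon \<pi> u) = (\<lambda>(k, j). (k, \<pi> j)) ` keys u" "keys (act_mon \<pi> u) \<subseteq> keys v"
      by (rule genE[OF assms v(1)])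
    have sub: "(k, \<pi> j) \<in> ?S" if "(k, j) \<in> keys u" for k j using u(4,5) v(2) that by force
    have "i < j" if "(k, j) \<in> keys u" for k j
    proof -
      have "1 \<le> j" using u(3) that by (auto simp: xvars_def)
      then show ?thesis using sub[OF that] Inc_gt_iff[OF u(2), of j] by auto
    qed
    then obtain k j where "k \<in> C" "(k, j) \<in> keys u" using C(3) u(1) by blast
    then show False using sub by blast
  qed
  then have "card ?S \<le> \<alpha> n" using max_indep_\<alpha>[OF assms] unfolding max_indep_def by blast
  moreover have "card ?S = (c - g) * (n - i)"
    using C(1,2) finite_subset[OF C(1)] by (simp add: card_cartesian_product card_Diff_subset)
  ultimately show ?thesis by metis
qed

text \<open>The rows outside \<open>L\<close> number fewer than \<open>g\<close>, so they miss some
  \<open>u\<close> with all columns beyond \<open>i\<close>, whose rows then lie in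
  \<open>L\<close>. With \<open>r\<close> copies of \<open>L\<close> available, an image of
  \<open>u\<close> would be supported in \<open>S\<close>.\<close>

lemma few_repetitions:
  assumes n: "r \<le> n" "i \<le> n" and S: "indep_set (xvars c n) (M n) S"
    and L: "L \<subseteq> {1..c}" "c - g < card L"
  shows "card {j \<in> {Suc i..n}. column S j = L} < r"
proof (rule ccontr)
  define P where "P = {j \<in> {Suc i..n}. column S j = L}"
  assume "\<not> ?thesis"
  then have rP: "r \<le> card P" by (simp add: P_def)
  have finP: "finite P" by (simp add: P_def)
  obtain p where p: "\<And>j. j < card P \<Longrightarrow> p j \<in> P" "\<And>j l. j < l \<Longrightarrow> l < card P \<Longrightarrow> p j < p l"
    by (rule finite_nat_enumeration[OF finP]) (rule that)
  have "card ({1..c} - L) = c - card L" "card L \<le> c"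
    using L(1) finite_subset[OF L(1)] card_mono[OF _ L(1)] by (simp_all add: card_Diff_subset)
  then have "\<not> g \<le> card ({1..c} - L)" using L(2) g_le by linarith
  then obtain u where u: "u \<in> M r" "\<forall>(k, j)\<in>keys u. i < j" "\<And>k j. k \<in> {1..c} - L \<Longrightarrow> (k, j) \<notin> keys u"
    using cover_min[of "{1..c} - L"] by blast
  have ux: "keys u \<subseteq> xvars c r" by (rule xvars[OF r1 u(1)])
  \<comment> \<open>Column j of \<open>u\<close> goes to the j-th copy of \<open>L\<close>; up to
    \<open>i\<close>, where \<open>u\<close> has no columns, the map is the identity.\<close>
  define h where "h j = (if j \<le> i then j else p (j - 1))" for j
  have pP: "p (j - 1) \<in> P" if "1 \<le> j" "j \<le> r" for j using p(1)[of "j - 1"] that rP by simp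
  have PI: "i < j \<and> j \<le> n" if "j \<in> P" for j using that by (auto simp: P_def)
  obtain \<pi> where \<pi>: "\<pi> \<in> Inc_mn i r n" "\<And>j. 1 \<le> j \<Longrightarrow> j \<le> r \<Longrightarrow> \<pi> j = h j"
  proof (rule Inc_mn_extend[of r h n i])
    show "1 \<le> h j \<and> h j \<le> n" if "1 \<le> j" "j \<le> r" for j
      using PI[OF pP[OF that]] that n(2) by (auto simp: h_def)
    show "h j < h l" if "1 \<le> j" "j < l" "l \<le> r" for j l
      using PI[OF pP[of l]] p(2)[of "j - 1" "l - 1"] that rP by (auto simp: h_def)
  qed (use n r1 in \<open>auto simp: h_def\<close>)
  have I: "\<pi> \<in> Inc i" using \<pi>(1) by (simp add: Inc_mn_def)
  have "(k, \<pi> j) \<in> S" if kj: "(k, j) \<in> keys u" for k j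
  proof -
    have j: "1 \<le> j" "j \<le> r" "k \<in> {1..c}" using ux kj by (auto simp: xvars_def)
    moreover have "i < j" using u(2) kj by auto
    ultimately have "\<pi> j \<in> P" using \<pi>(2)[OF j(1,2)] pP by (simp add: h_def)
    then have "column S (\<pi> j) = L" by (simp add: P_def)
    moreover have "k \<in> L" using u(3) kj j(3) by blast
    ultimately show ?thesis by (auto simp: column_def)
  qed
  then have "keys (act_mon \<pi> u) \<subseteq> S"
    unfolding lookup_act_mon(2)[OF I Mons_of_xvars[OF ux]] by auto
  moreover have "act_mon \<pi> u \<in> M n" by (rule act[OF r1 n(1) u(1) \<pi>(1)])
  ultimately show False using S by (auto simp: indep_set_def)
qed

text \<open>There are at most 2^c possible contents, each repeated fewer than \<open>r\<close>
  times.\<close>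

lemma few_heavy_columns:
  assumes n: "r \<le> n" "i \<le> n" and S: "indep_set (xvars c n) (M n) S"
  shows "card {j \<in> {Suc i..n}. c - g < card (column S j)} \<le> 2 ^ c * r"
proof -
  have Sx: "S \<subseteq> xvars c n" using S by (simp add: indep_set_def)
  let ?\<L> = "{L \<in> Pow {1..c}. c - g < card L}"
  have "{j \<in> {Suc i..n}. c - g < card (column S j)} \<subseteq> (\<Union>L\<in>?\<L>. {j \<in> {Suc i..n}. column S j = L})"
    using column_subset[OF Sx] by auto
  then have "card {j \<in> {Suc i..n}. c - g < card (column S j)} \<le> card (\<Union>L\<in>?\<L>. {j \<in> {Suc i..n}. column S j = L})"
    by (intro card_mono) auto
  also have "\<dots> \<le> (\<Sum>L\<in>?\<L>. card {j \<in> {Suc i..n}. column S j = L})" by (rule card_UN_le) simp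
  also have "\<dots> \<le> (\<Sum>L\<in>?\<L>. r)"
    using few_repetitions[OF n S] by (intro sum_mono) (auto intro: less_imp_le)
  also have "\<dots> = card ?\<L> * r" by simp
  also have "card ?\<L> \<le> card (Pow {1..c})" by (intro card_mono) auto
  also have "card (Pow {1..c}) = 2 ^ c" by (simp add: card_Pow)
  finally show ?thesis by simp
qed

text \<open>The first \<open>i\<close> columns hold at most \<open>c\<close> elements each, a heavy
  column exceeds c - g by at most \<open>c\<close>, and a light one falls short by at least 1, which
  pays for the second term on the left. This bounds card S and, together with
  \<open>lower_bound\<close>, the number of light columns of a largest set.\<close>

lemma column_counts:
  assumes n: "r \<le> n" "i \<le> n" and S: "indep_set (xvars c n) (M n) S"
  shows "card S + card {j \<in> {Suc i..n}. card (column S j) < c - g}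
    \<le> c * i + (c - g) * (n - i) + c * (2 ^ c * r)"
proof -
  have Sx: "S \<subseteq> xvars c n" using S by (simp add: indep_set_def)
  let ?W = "{Suc i..n}" and ?f = "\<lambda>j. card (column S j)"
  let ?H = "{j \<in> ?W. c - g < ?f j}" and ?L = "{j \<in> ?W. ?f j < c - g}"
  have "{1..n} = {1..i} \<union> ?W" "{1..i} \<inter> ?W = {}" using n(2) by auto
  then have "card S = (\<Sum>j\<in>{1..i}. ?f j) + (\<Sum>j\<in>?W. ?f j)"
    unfolding card_columns[OF Sx] by (simp add: sum.union_disjoint)
  moreover have "(\<Sum>j\<in>{1..i}. ?f j) \<le> (\<Sum>j\<in>{1..i}. c)" by (intro sum_mono card_column_le[OF Sx])
  moreover have "(\<Sum>j\<in>?W. ?f j) + card ?L \<le> (c - g) * (n - i) + c * (2 ^ c * r)"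
  proof -
    have "(\<Sum>j\<in>?W. ?f j) + card ?L = (\<Sum>j\<in>?W. ?f j + (if ?f j < c - g then 1 else 0))"
      by (simp add: sum.distrib sum.If_cases Int_def)
    also have "\<dots> \<le> (\<Sum>j\<in>?W. (c - g) + (if c - g < ?f j then c else 0))"
      using card_column_le[OF Sx] by (intro sum_mono) (auto intro: trans_le_add2)
    also have "\<dots> = (c - g) * (n - i) + c * card ?H"
      by (simp add: sum.distrib sum.If_cases Int_def mult.commute)
    also have "c * card ?H \<le> c * (2 ^ c * r)" by (intro mult_left_mono few_heavy_columns[OF n S]) simp
    finally show ?thesis by simp
  qed
  ultimately show ?thesis by (simp add: mult.commute)
qed

text \<open>
  Between the occurrences of a column \<open>L\<close> of size \<open>c - g\<close> that is repeated \<open>r\<close> times, all columns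
  may be replaced by \<open>L\<close>, and the resulting block may be lengthened, because independence is
  tested on \<open>r\<close> columns at a time.
\<close>

lemma extend_block:
  assumes n: "r \<le> n" "i \<le> n" and S: "indep_set (xvars c n) (M n) S"
    and P: "P \<subseteq> {Suc i..n}" "r \<le> card P" and L: "\<And>j. j \<in> P \<Longrightarrow> column S j = L" "card L = c - g"
    and light: "\<And>j. Min P \<le> j \<Longrightarrow> j \<le> Max P \<Longrightarrow> card (column S j) \<le> c - g"
  shows "\<exists>S'. indep_set (xvars c (Suc n)) (M (Suc n)) S' \<and> card S + (c - g) \<le> card S'"
proof -
  have Sx: "S \<subseteq> xvars c n" using S by (simp add: indep_set_def)
  have finP: "finite P" using P(1) finite_subset by blast
  have "P \<noteq> {}" using P(2) r1 by auto
  define a where "a = Min P"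
  define b where "b = Max P"
  have aP: "a \<in> P" "b \<in> P" unfolding a_def b_def using finP \<open>P \<noteq> {}\<close> by auto
  have ab: "a \<le> j \<and> j \<le> b" if "j \<in> P" for j using that finP by (simp add: a_def b_def)
  have ai: "i < a" "a \<le> b" "b \<le> n" using aP P(1) ab[OF aP(1)] by auto
  have Lc: "L \<subseteq> {1..c}" using L(1)[OF aP(1)] column_subset[OF Sx] by blast
  \<comment> \<open>The columns from \<open>a\<close> to b + 1 become \<open>L\<close>; those left
    of \<open>a\<close> stay, and those right of \<open>b\<close> move one step.\<close>
  define S' where "S' = {(k, j) \<in> xvars c (Suc n). (j < a \<and> (k, j) \<in> S) \<or>
    (a \<le> j \<and> j \<le> Suc b \<and> k \<in> L) \<or> (Suc b < j \<and> (k, j - 1) \<in> S)}"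
  have S'x: "S' \<subseteq> xvars c (Suc n)" by (auto simp: S'_def)
  have col: "column S' j = (if j < a then column S j else if j \<le> Suc b then L else column S (j - 1))"
    if j: "1 \<le> j" "j \<le> Suc n" for j
    using j Sx Lc ai(2) by (auto simp: column_def S'_def xvars_def)
  have "card S + (c - g) \<le> card S'"
  proof -
    \<comment> \<open>Old columns are matched with new columns of at least their size; the new
      column \<open>a\<close> is left over, and its c - g elements are the gain.\<close>
    define h where "h j = (if j < a then j else Suc j)" for j
    have inj: "inj_on h {1..n}" by (auto simp: h_def inj_on_def split: if_splits)
    have im: "h ` {1..n} = {1..Suc n} - {a}"
    proof (intro equalityI subsetI)
      fix l assume l: "l \<in> {1..Suc n} - {a}"
      show "l \<in> h ` {1..n}"
      proof (cases "l < a")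
        case True then show ?thesis using l ai by (intro image_eqI[of _ _ l]) (auto simp: h_def)
      next
        case False then show ?thesis using l ai by (intro image_eqI[of _ _ "l - 1"]) (auto simp: h_def)
      qed
    qed (use ai in \<open>auto simp: h_def split: if_splits\<close>)
    have "card (column S j) \<le> card (column S' (h j))" if j: "j \<in> {1..n}" for j
    proof -
      have hj: "1 \<le> h j" "h j \<le> Suc n" using j by (auto simp: h_def)
      consider "j < a" | "a \<le> j" "j \<le> b" | "b < j" by linarith
      then show ?thesis
      proof cases
        case 1 then show ?thesis using col[OF hj] by (simp add: h_def)
      next
        case 2
        then show ?thesis using col[OF hj] light[of j] L(2) by (simp add: h_def a_def b_def)
      next
        case 3
        then show ?thesis using col[OF hj] ai by (simp add: h_def)
      qed
    qed
    then have "(\<Sum>j\<in>{1..n}. card (column S j)) \<le> (\<Sum>j\<in>{1..n}. card (column S' (h j)))"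
      by (rule sum_mono)
    also have "\<dots> = (\<Sum>j\<in>{1..Suc n} - {a}. card (column S' j))"
      unfolding im[symmetric] sum.reindex[OF inj] by simp
    finally have "card S + card (column S' a) \<le>
        card (column S' a) + (\<Sum>j\<in>{1..Suc n} - {a}. card (column S' j))"
      unfolding card_columns[OF Sx] by simp
    also have "\<dots> = card S'"
      unfolding card_columns[OF S'x] by (rule sum.remove[symmetric]) (use ai in auto)
    finally show ?thesis using col[of a] ai L(2) by simp
  qed
  moreover have "indep_set (xvars c (Suc n)) (M (Suc n)) S'"
    unfolding indep_iff[OF le_SucI[OF n(1)]]
  proof (intro conjI ballI S'x)
    fix \<rho> assume \<rho>: "\<rho> \<in> Inc_mn i r (Suc n)"
    then have I: "\<rho> \<in> Inc i" "\<rho> r \<le> Suc n" by (auto simp: Inc_mn_def)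
    obtain p where p: "\<And>j. j < card P \<Longrightarrow> p j \<in> P" "\<And>j l. j < l \<Longrightarrow> l < card P \<Longrightarrow> p j < p l"
      by (rule finite_nat_enumeration[OF finP]) (rule that)
    have pP: "p (j - 1) \<in> P" if "1 \<le> j" "j \<le> r" for j using p(1)[of "j - 1"] that P(2) by simp
    \<comment> \<open>Any \<open>r\<close> columns of \<open>S'\<close> are imitated by columns of
      \<open>S\<close>: those in the block go to distinct occurrences of \<open>L\<close>, of which
      there are at least \<open>r\<close>, and those beyond it go back one step.\<close>
    define h where "h j = (if \<rho> j < a then \<rho> j else if \<rho> j \<le> Suc b then p (j - 1) else \<rho> j - 1)" for j
    obtain \<pi> where \<pi>: "\<pi> \<in> Inc_mn i r n" "\<And>j. 1 \<le> j \<Longrightarrow> j \<le> r \<Longrightarrow> \<pi> j = h j"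
    proof (rule Inc_mn_extend[of r h n i])
      show "1 \<le> h j \<and> h j \<le> n" if j: "1 \<le> j" "j \<le> r" for j
        using ab[OF pP[OF j]] ai Inc_ge1[OF I(1) j(1)] Inc_le[OF I(1) j] I(2) by (auto simp: h_def)
      show "h j < h l" if jl: "1 \<le> j" "j < l" "l \<le> r" for j l
      proof -
        have "p (j - 1) < p (l - 1)" using p(2)[of "j - 1" "l - 1"] jl P(2) by simp
        then show ?thesis
          using ab[OF pP[of j]] ab[OF pP[of l]] Inc_less[OF I(1) jl(1,2)] jl ai by (auto simp: h_def)
      qed
      show "h j = j" if "1 \<le> j" "j \<le> i" for j
        using Inc_fix[OF I(1) that] that ai by (simp add: h_def)
    qed (use n r1 in auto)
    have "{(k, j) \<in> xvars c r. (k, \<rho> j) \<in> S'} \<subseteq> {(k, j) \<in> xvars c r. (k, \<pi> j) \<in> S}"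
    proof (intro subsetI, clarify)
      fix k j assume kj: "(k, j) \<in> xvars c r" "(k, \<rho> j) \<in> S'"
      then have j: "1 \<le> j" "j \<le> r" by (auto simp: xvars_def)
      have "k \<in> column S (p (j - 1)) \<longleftrightarrow> k \<in> L" using L(1)[OF pP[OF j]] by simp
      then show "(k, \<pi> j) \<in> S"
        using kj(2) ai(2) unfolding \<pi>(2)[OF j] by (auto simp: h_def S'_def column_def)
    qed
    moreover have "indep_set (xvars c r) (M r) {(k, j) \<in> xvars c r. (k, \<pi> j) \<in> S}"
      using S \<pi>(1) unfolding indep_iff[OF n(1)] by blast
    ultimately show "indep_set (xvars c r) (M r) {(k, j) \<in> xvars c r. (k, \<rho> j) \<in> S'}"
      by (rule indep_set_mono[rotated])
  qed
  ultimately show ?thesis by blast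
qed

text \<open>Heavy and light columns are bounded in number, so for large \<open>n\<close> most
  columns have size exactly c - g. The pigeonhole principle finds many equal ones with no heavy
  column in between, and \<open>extend_block\<close> inserts one more.\<close>

lemma growth_step:
  assumes n: "r \<le> n" "i \<le> n"
    and large: "n > i + c * i + c * (2 ^ c * r) + 2 ^ c * r + 2 ^ c * (2 ^ c * r + 1) * r"
  shows "\<alpha> n + (c - g) \<le> \<alpha> (Suc n)"
proof -
  obtain S where S: "indep_set (xvars c n) (M n) S" "card S = \<alpha> n"
    using max_indep_\<alpha>[OF n(1)] by (auto simp: max_indep_def)
  have Sx: "S \<subseteq> xvars c n" using S by (simp add: indep_set_def)
  let ?W = "{Suc i..n}" and ?f = "\<lambda>j. card (column S j)"
  define H where "H = {j \<in> ?W. c - g < ?f j}"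
  define E where "E = {j \<in> ?W. ?f j = c - g}"
  define Lo where "Lo = {j \<in> ?W. ?f j < c - g}"
  have fin: "finite H" "finite E" "finite Lo" by (auto simp: H_def E_def Lo_def)
  have H: "card H \<le> 2 ^ c * r" unfolding H_def by (rule few_heavy_columns[OF n S(1)])
  have "card Lo \<le> c * i + c * (2 ^ c * r)"
    using column_counts[OF n S(1)] lower_bound[OF n(1)] S(2) by (simp add: Lo_def)
  moreover have "card ?W \<le> card E + card Lo + card H"
  proof -
    have "?W \<subseteq> E \<union> Lo \<union> H" by (auto simp: E_def Lo_def H_def)
    then have "card ?W \<le> card (E \<union> Lo \<union> H)" using fin by (intro card_mono) auto
    also have "\<dots> \<le> card (E \<union> Lo) + card H" by (rule card_Un_le)
    also have "card (E \<union> Lo) \<le> card E + card Lo" by (rule card_Un_le)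
    finally show ?thesis by simp
  qed
  \<comment> \<open>From the n - i later columns, subtract the bounds on light and heavy ones;
    \<open>large\<close> leaves more than the pigeonhole principle below requires.\<close>
  ultimately have E: "2 ^ c * (2 ^ c * r + 1) * r < card E" using H large n(2) by simp
  \<comment> \<open>Besides its content, a column records how many heavy columns occur up to it, so
    that no heavy column separates two columns of the same class.\<close>
  define q where "q j = (column S j, card (H \<inter> {..j}))" for j
  let ?T = "Pow {1..c} \<times> {..2 ^ c * r}"
  have "q ` E \<subseteq> ?T"
  proof
    fix y assume "y \<in> q ` E"
    then obtain j where "y = q j" by blast
    moreover have "card (H \<inter> {..j}) \<le> 2 ^ c * r"
      using card_mono[of H "H \<inter> {..j}"] fin(1) H by simp
    ultimately show "y \<in> ?T" using column_subset[OF Sx, of j] by (simp add: q_def)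
  qed
  moreover have "card ?T = 2 ^ c * (2 ^ c * r + 1)" by (simp add: card_cartesian_product card_Pow)
  ultimately obtain y where y: "y \<in> ?T" "r < card {j \<in> E. q j = y}"
    using pigeonhole_fibre[of ?T q E r] fin(2) E by auto
  obtain L t where Lt: "y = (L, t)" by (cases y)
  define P where "P = {j \<in> E. q j = y}"
  have P: "P \<subseteq> ?W" "r \<le> card P" "finite P" using y(2) fin by (auto simp: P_def E_def)
  have L: "column S j = L" "card (H \<inter> {..j}) = t" "?f j = c - g" if "j \<in> P" for j
    using that by (auto simp: P_def q_def Lt E_def)
  have "P \<noteq> {}" using P(2) r1 by auto
  then have mm: "Min P \<in> P" "Max P \<in> P" using P(3) by auto
  have light: "?f j \<le> c - g" if j: "Min P \<le> j" "j \<le> Max P" for j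
  proof (rule ccontr)
    assume heavy: "\<not> ?thesis"
    have "Suc i \<le> j" "j \<le> n" using j mm P(1) by fastforce+
    then have jH: "j \<in> H" using heavy by (simp add: H_def)
    have "j \<noteq> Min P" using heavy L(3)[OF mm(1)] by auto
    then have "j \<in> H \<inter> {..Max P}" "j \<notin> H \<inter> {..Min P}" using jH j by auto
    moreover have "H \<inter> {..Min P} \<subseteq> H \<inter> {..Max P}" using j by auto
    ultimately have "H \<inter> {..Min P} \<subset> H \<inter> {..Max P}" by blast
    then have "card (H \<inter> {..Min P}) < card (H \<inter> {..Max P})" using fin(1) by (intro psubset_card_mono) auto
    then show False using L(2)[OF mm(1)] L(2)[OF mm(2)] by simp
  qed
  have "card L = c - g" using L(1,3)[OF mm(1)] by simp
  from extend_block[OF n S(1) P(1,2) L(1) this light] obtain S' where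
    S': "indep_set (xvars c (Suc n)) (M (Suc n)) S'" "card S + (c - g) \<le> card S'" by blast
  have "card S' \<le> \<alpha> (Suc n)"
    using max_indep_\<alpha>[OF le_SucI[OF n(1)]] S'(1) unfolding max_indep_def by blast
  then show ?thesis using S'(2) S(2) by simp
qed

text \<open>\<open>growth_step\<close> makes \<alpha>(n) - (c - g) n eventually nondecreasing and
  \<open>column_counts\<close> bounds it; an integer sequence of this kind is eventually
  constant.\<close>

theorem eventually_affine:
  "\<exists>B :: int. \<forall>\<^sub>F n in sequentially. int (\<alpha> n) = int (c - g) * int n + B"
proof -
  define f where "f n = int (\<alpha> n) - int (c - g) * int n" for n
  define n0 where "n0 = Suc (r + i + c * i + c * (2 ^ c * r) + 2 ^ c * r + 2 ^ c * (2 ^ c * r + 1) * r)"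
  have "\<exists>B. \<forall>\<^sub>F n in sequentially. f n = B"
  proof (rule eventually_constant_int)
    fix n assume "n \<ge> n0"
    then have n: "r \<le> n" "i \<le> n"
      "n > i + c * i + c * (2 ^ c * r) + 2 ^ c * r + 2 ^ c * (2 ^ c * r + 1) * r"
      by (simp_all add: n0_def)
    have "int (\<alpha> n) + int (c - g) \<le> int (\<alpha> (Suc n))" using growth_step[OF n] by linarith
    then show "f n \<le> f (Suc n)" by (simp add: f_def algebra_simps)
    obtain S where S: "indep_set (xvars c n) (M n) S" "card S = \<alpha> n"
      using max_indep_\<alpha>[OF n(1)] by (auto simp: max_indep_def)
    have "\<alpha> n \<le> c * i + (c - g) * (n - i) + c * (2 ^ c * r)"
      using column_counts[OF n(1,2) S(1)] S(2) by simp
    also have "(c - g) * (n - i) \<le> (c - g) * n" by (intro mult_left_mono) auto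
    finally have "\<alpha> n \<le> (c * i + c * (2 ^ c * r)) + (c - g) * n" by simp
    then have "int (\<alpha> n) \<le> int (c * i + c * (2 ^ c * r)) + int (c - g) * int n"
      by (metis of_nat_add of_nat_le_iff of_nat_mult)
    then show "f n \<le> int (c * i + c * (2 ^ c * r))" by (simp add: f_def)
  qed
  then obtain B where "\<forall>\<^sub>F n in sequentially. f n = B" by blast
  then show ?thesis by (intro exI[of _ B]) (auto elim!: eventually_mono simp: f_def)
qed

end


section \<open>Stability of covers and minimal monomial generators\<close>

section \<open>Covers and minimal generators\<close>

lemma act_mon_id: "u \<in> Mons c \<Longrightarrow> act_mon (\<lambda>j. j) u = u"
  by (rule act_mon_eqI[where i = 0 and c = c]) (force simp: Inc_def strict_mono_on_def Mons_def)+

text \<open>Testing all monomials of the ideal makes the cover condition easy to transport along the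
  chain; for proper ideals \<open>is_cover_iff\<close> identifies it with the condition on minimal
  generators.\<close>

definition row_cover :: "nat \<Rightarrow> nat \<Rightarrow> mon set \<Rightarrow> nat set \<Rightarrow> bool" where
  "row_cover c i N C \<longleftrightarrow> C \<subseteq> {1..c} \<and>
    (\<forall>u\<in>N. (\<forall>(k, j)\<in>keys u. i < j) \<longrightarrow> (\<exists>k\<in>C. \<exists>j. (k, j) \<in> keys u))"

text \<open>Increasing maps preserve rows, and they preserve whether a column lies beyond
  \<open>i\<close>. Hence the covers, and with them the minimum cover size, agree at all levels from
  a generating one on.\<close>

lemma (in monomial_chain) row_cover_stable:
  assumes gen: "generated_from r" and r: "1 \<le> r" "r \<le> n"
  shows "row_cover c i (M n) C \<longleftrightarrow> row_cover c i (M r) C"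
proof (intro iffI)
  assume C: "row_cover c i (M n) C"
  have "u \<in> M n" if u: "u \<in> M r" for u
    using act[OF r(1,2) u id_Inc_mn[OF r(2)]] act_mon_id[OF Mons_of_xvars[OF xvars[OF r(1) u]]] by simp
  then show "row_cover c i (M r) C" using C unfolding row_cover_def by blast
next
  assume C: "row_cover c i (M r) C"
  have "\<exists>k\<in>C. \<exists>j. (k, j) \<in> keys v" if v: "v \<in> M n" "\<forall>(k, j)\<in>keys v. i < j" for v
  proof -
    obtain u \<pi> w where *: "u \<in> M r" "\<pi> \<in> Inc_mn i r n" "v = act_mon \<pi> u + w"
      using gen r(2) v(1) unfolding generated_from_def by blast
    have I: "\<pi> \<in> Inc i" using *(2) by (simp add: Inc_mn_def)
    have ux: "keys u \<subseteq> xvars c r" by (rule xvars[OF r(1) *(1)])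
    have sub: "(k, \<pi> j) \<in> keys v" if "(k, j) \<in> keys u" for k j
      using that unfolding *(3) keys_add_mon lookup_act_mon(2)[OF I Mons_of_xvars[OF ux]] by force
    have "i < j" if kj: "(k, j) \<in> keys u" for k j
    proof -
      have "1 \<le> j" using ux kj by (auto simp: xvars_def)
      then show ?thesis using sub[OF kj] v(2) Inc_gt_iff[OF I, of j] by auto
    qed
    then obtain k j where "k \<in> C" "(k, j) \<in> keys u" using C *(1) unfolding row_cover_def by blast
    then show ?thesis using sub by blast
  qed
  then show "row_cover c i (M n) C" using C unfolding row_cover_def by blast
qed

definition minimal_mons :: "mon set \<Rightarrow> mon set" where
  "minimal_mons N = {u \<in> N. \<forall>v\<in>N. \<forall>w. u = v + w \<longrightarrow> w = 0}"

lemma minimal_mons_below: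
  assumes "\<And>u. u \<in> N \<Longrightarrow> keys u \<subseteq> X" "finite X" "u \<in> N"
  shows "\<exists>v\<in>minimal_mons N. \<exists>w. u = v + w"
  using assms(3)
proof (induction "\<Sum>x\<in>X. lookup u x" arbitrary: u rule: less_induct)
  case less
  show ?case
  proof (cases "u \<in> minimal_mons N")
    case True
    then show ?thesis by (intro bexI[of _ u] exI[of _ 0]) auto
  next
    case False
    then obtain v w where vw: "v \<in> N" "u = v + w" "w \<noteq> 0" using less.prems by (auto simp: minimal_mons_def)
    obtain x where x: "x \<in> keys w" using vw(3) by (metis keys_eq_empty all_not_in_conv)
    have "keys u \<subseteq> X" by (rule assms(1)[OF less.prems])
    then have xX: "x \<in> X" using x vw(2) by (auto simp: keys_add_mon)
    have "(\<Sum>x\<in>X. lookup v x) < (\<Sum>x\<in>X. lookup u x)"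
    proof (rule sum_strict_mono_ex1[OF assms(2)])
      show "\<exists>x\<in>X. lookup v x < lookup u x"
        using x xX by (intro bexI[of _ x]) (auto simp: vw(2) lookup_add in_keys_iff)
    qed (auto simp: vw(2) lookup_add)
    from less.hyps[OF this vw(1)] obtain v' w' where "v' \<in> minimal_mons N" "v = v' + w'" by blast
    then show ?thesis using vw(2) by (intro bexI[of _ v'] exI[of _ "w' + w"]) (auto simp: add.assoc)
  qed
qed

context
  fixes c n :: nat and N :: "mon set" and J :: "'a::field mpoly set"
  assumes N: "\<And>u. u \<in> N \<Longrightarrow> keys u \<subseteq> xvars c n"
    and up: "\<And>u w. u \<in> N \<Longrightarrow> keys w \<subseteq> xvars c n \<Longrightarrow> u + w \<in> N"
    and J: "J = {f \<in> polys (xvars c n). keys f \<subseteq> N}"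
begin

lemma mono_poly_in_iff: "mono_poly u \<in> J \<longleftrightarrow> u \<in> N"
  using N[of u] by (auto simp: J intro: polys_single)

lemma eq_mono_ideal_iff:
  assumes "G \<subseteq> N"
  shows "J = mono_ideal (xvars c n) G \<longleftrightarrow> (\<forall>v\<in>N. \<exists>g\<in>G. \<exists>w. v = g + w)"
proof
  assume eq: "J = mono_ideal (xvars c n) G"
  have "\<exists>g\<in>G. \<exists>w. v = g + w" if "v \<in> N" for v
  proof -
    have "mono_poly v \<in> (mono_ideal (xvars c n) G :: 'a mpoly set)"
      using that mono_poly_in_iff eq by blast
    then show ?thesis by (auto simp: mono_ideal_def)
  qed
  then show "\<forall>v\<in>N. \<exists>g\<in>G. \<exists>w. v = g + w" by blast
next
  assume gen: "\<forall>v\<in>N. \<exists>g\<in>G. \<exists>w. v = g + w"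
  show "J = mono_ideal (xvars c n) G"
  proof (intro equalityI subsetI)
    fix f assume "f \<in> J"
    then show "f \<in> mono_ideal (xvars c n) G" using gen by (auto simp: J mono_ideal_def)
  next
    fix f :: "'a mpoly" assume f: "f \<in> mono_ideal (xvars c n) G"
    have "u \<in> N" if u: "u \<in> keys f" for u
    proof -
      obtain g w where gw: "g \<in> G" "u = g + w" using f u by (auto simp: mono_ideal_def)
      have "keys u \<subseteq> xvars c n" using f u polys_keysD by (auto simp: mono_ideal_def)
      then show ?thesis using gw assms by (auto intro!: up simp: keys_add_mon)
    qed
    then show "f \<in> J" using f by (auto simp: J mono_ideal_def)
  qed
qed

text \<open>Every set of monomials generating the ideal contains the divisibility-minimal ones,
  which already generate. So they are the only irredundant generating set, as the definite
  description requires.\<close>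

lemma min_gens_eq: "min_gens c n J = minimal_mons N"
  unfolding min_gens_def
proof (rule the_equality)
  let ?G = "minimal_mons N"
  have Mu: "G \<subseteq> Mons_upto c n \<longleftrightarrow> (\<forall>u\<in>G. keys u \<subseteq> xvars c n)" for G
    by (auto simp: Mons_upto_def xvars_def)
  have GN: "?G \<subseteq> N" by (auto simp: minimal_mons_def)
  have GM: "?G \<subseteq> Mons_upto c n" using GN N unfolding Mu by blast
  have IG: "Idl\<^bsub>Rn c n\<^esub> (mono_poly ` ?G) = J"
  proof -
    have "Idl\<^bsub>Rn c n\<^esub> (mono_poly ` ?G) = (mono_ideal (xvars c n) ?G :: 'a mpoly set)"
      by (rule Idl_mono_poly) (use GN N in blast)
    also have "\<dots> = J"
      using eq_mono_ideal_iff[OF GN] minimal_mons_below[OF N finite_xvars] by blast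
    finally show ?thesis .
  qed
  have least: "?G \<subseteq> G" if G: "G \<subseteq> Mons_upto c n" "Idl\<^bsub>Rn c n\<^esub> (mono_poly ` G) = J" for G
  proof -
    have eq: "mono_ideal (xvars c n) G = J"
      using G Idl_mono_poly[of G c n] unfolding Mu by metis
    have "G \<subseteq> N"
    proof
      fix g assume g: "g \<in> G"
      have "mono_poly g \<in> (mono_ideal (xvars c n) G :: 'a mpoly set)"
        using g G(1) unfolding Mu mono_ideal_def
        by (auto intro!: polys_single bexI[of _ g] exI[of _ 0])
      then show "g \<in> N" unfolding eq mono_poly_in_iff .
    qed
    then have gen: "\<forall>v\<in>N. \<exists>g\<in>G. \<exists>w. v = g + w" using eq_mono_ideal_iff eq by metis
    show ?thesis
    proof
      fix u assume u: "u \<in> ?G"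
      then obtain g w where gw: "g \<in> G" "u = g + w" using gen GN by blast
      then have "w = 0" using u \<open>G \<subseteq> N\<close> unfolding minimal_mons_def by blast
      then show "u \<in> G" using gw by simp
    qed
  qed
  show "?G \<subseteq> Mons_upto c n \<and> Idl\<^bsub>Rn c n\<^esub> (mono_poly ` ?G) = J \<and>
    (\<forall>G'. G' \<subset> ?G \<longrightarrow> Idl\<^bsub>Rn c n\<^esub> (mono_poly ` G') \<noteq> J)"
  proof (intro conjI GM IG allI impI notI)
    fix G' assume "G' \<subset> ?G" "Idl\<^bsub>Rn c n\<^esub> (mono_poly ` G') = J"
    then show False using least[of G'] GM by blast
  qed
  fix G assume G: "G \<subseteq> Mons_upto c n \<and> Idl\<^bsub>Rn c n\<^esub> (mono_poly ` G) = J \<and>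
    (\<forall>G'. G' \<subset> G \<longrightarrow> Idl\<^bsub>Rn c n\<^esub> (mono_poly ` G') \<noteq> J)"
  then have "?G \<subseteq> G" using least by blast
  then show "G = ?G" using G IG by blast
qed

text \<open>A monomial with all columns beyond \<open>i\<close> is divisible by a minimal generator
  with the same property, and whatever covers the divisor covers the multiple.\<close>

lemma is_cover_iff:
  assumes "0 \<notin> N"
  shows "is_cover c i n J C \<longleftrightarrow> row_cover c i N C"
proof -
  have mi: "min_index u > i \<longleftrightarrow> (\<forall>(k, j)\<in>keys u. i < j)" if "u \<noteq> 0" for u
  proof
    assume "min_index u > i"
    then show "\<forall>(k, j)\<in>keys u. i < j" unfolding min_index_def
      by (auto intro: less_le_trans Least_le)
  next
    assume all: "\<forall>(k, j)\<in>keys u. i < j"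
    have "keys u \<noteq> {}" using that by simp
    then have "\<exists>j k. (k, j) \<in> keys u" by fast
    then have "\<exists>k. (k, min_index u) \<in> keys u" unfolding min_index_def by (rule LeastI_ex)
    then show "min_index u > i" using all by auto
  qed
  have cov: "covers C u \<longleftrightarrow> (\<exists>k\<in>C. \<exists>j. (k, j) \<in> keys u)" if "u \<in> N" for u
    using N[OF that] unfolding covers_def xvars_def by fastforce
  have sub: "minimal_mons N \<subseteq> N" by (auto simp: minimal_mons_def)
  have "is_cover c i n J C \<longleftrightarrow> C \<subseteq> {1..c} \<and> (\<forall>u\<in>minimal_mons N. (\<forall>(k, j)\<in>keys u. i < j) \<longrightarrow>
      (\<exists>k\<in>C. \<exists>j. (k, j) \<in> keys u))"
  proof -
    have "(i < min_index u) = (\<forall>(k, j)\<in>keys u. i < j)" "covers C u = (\<exists>k\<in>C. \<exists>j. (k, j) \<in> keys u)"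
      if u: "u \<in> minimal_mons N" for u
      using mi[of u] cov[of u] u sub assms by auto
    then show ?thesis unfolding is_cover_def G_plus_def min_gens_eq by auto
  qed
  also have "\<dots> \<longleftrightarrow> row_cover c i N C"
    unfolding row_cover_def
  proof (intro conj_cong refl iffI ballI impI)
    fix u assume *: "\<forall>u\<in>minimal_mons N. (\<forall>(k, j)\<in>keys u. i < j) \<longrightarrow> (\<exists>k\<in>C. \<exists>j. (k, j) \<in> keys u)"
      "u \<in> N" "\<forall>(k, j)\<in>keys u. i < j"
    obtain v w where "v \<in> minimal_mons N" "u = v + w"
      using minimal_mons_below[OF N finite_xvars *(2)] by blast
    moreover from this have "keys v \<subseteq> keys u" by (simp add: keys_add_mon)
    ultimately show "\<exists>k\<in>C. \<exists>j. (k, j) \<in> keys u" using * by blast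
  qed (use sub in blast)
  finally show ?thesis .
qed

end

section \<open>The chain of initial ideals and the dimension formula\<close>

section \<open>The chain of initial ideals\<close>

context
  fixes c i :: nat and I :: "nat \<Rightarrow> 'a::field mpoly set" and r :: "mon rel"
  assumes chain: "inc_invariant_chain c i I" and ord: "monomial_order c r" and resp: "respects_Inc i r"
begin

lemma chain_pideal: "1 \<le> n \<Longrightarrow> pideal (xvars c n) (I n)"
  using chain by (simp add: inc_invariant_chain_def ideal_Rn_iff)

lemma chain_act: "1 \<le> m \<Longrightarrow> m \<le> n \<Longrightarrow> f \<in> I m \<Longrightarrow> \<pi> \<in> Inc_mn i m n \<Longrightarrow> act \<pi> f \<in> I n"
  using chain unfolding inc_invariant_chain_def by blast

text \<open>An order that respects the action keeps the initial term in front, so the image of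
  \<open>f\<close> has the image of \<open>u\<close> as its initial monomial.\<close>

lemma init_mons_act:
  assumes mn: "1 \<le> m" "m \<le> n" and u: "u \<in> init_mons r (I m)" and \<pi>: "\<pi> \<in> Inc_mn i m n"
  shows "act_mon \<pi> u \<in> init_mons r (I n)"
proof -
  have I: "\<pi> \<in> Inc i" using \<pi> by (simp add: Inc_mn_def)
  note id = chain_pideal[OF mn(1)]
  obtain f where f: "f \<in> I m" "u \<in> keys f" "\<And>v. v \<in> keys f \<Longrightarrow> (v, u) \<in> r"
    by (rule init_monsE[OF ord id u]) (rule that)
  have k: "keys (act \<pi> f) = act_mon \<pi> ` keys f" by (rule keys_act[OF I keys_Mons[OF ord id f(1)]])
  have "init_mon r (act \<pi> f) = act_mon \<pi> u"
  proof (rule init_mon_eqI[OF ord])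
    show "act_mon \<pi> u \<in> keys (act \<pi> f)" using f(2) by (simp add: k)
    fix v assume "v \<in> keys (act \<pi> f)"
    then obtain v' where "v' \<in> keys f" "v = act_mon \<pi> v'" by (auto simp: k)
    then show "(v, act_mon \<pi> u) \<in> r" using f(3) resp I unfolding respects_Inc_def by blast
  qed
  moreover have "act \<pi> f \<noteq> 0" using k f(2) by auto
  ultimately show ?thesis
    using chain_act[OF mn f(1) \<pi>] unfolding init_mons_def by (intro CollectI exI[of _ "act \<pi> f"]) simp
qed

lemma monomial_chain_init: "monomial_chain c i (\<lambda>n. init_mons r (I n))"
proof
  show "keys u \<subseteq> xvars c n" if "1 \<le> n" "u \<in> init_mons r (I n)" for n u
    by (rule init_mons_xvars[OF ord chain_pideal[OF that(1)] that(2)])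
  show "u + w \<in> init_mons r (I n)" if "1 \<le> n" "u \<in> init_mons r (I n)" "keys w \<subseteq> xvars c n" for n u w
    by (rule init_mons_add[OF ord chain_pideal[OF that(1)] that(2,3)])
qed (rule init_mons_act)

interpretation M: monomial_chain c i "\<lambda>n. init_mons r (I n)"
  by (rule monomial_chain_init)

lemma init_chain_eq: "1 \<le> n \<Longrightarrow> init_chain c r I n = {f \<in> polys (xvars c n). keys f \<subseteq> init_mons r (I n)}"
  unfolding init_chain_def by (rule init_ideal_eq[OF ord chain_pideal])

text \<open>The images of all elements of an initial ideal generate the same ideal as the images of
  its monomials. This turns the condition defining \<open>ind\<close> into divisibility of
  monomials.\<close>

lemma generated_iff:
  assumes r0: "1 \<le> r0"
  shows "(\<forall>n\<ge>r0. init_chain c r I n = Idl\<^bsub>Rn c n\<^esub> {act \<pi> f | \<pi> f. f \<in> init_chain c r I r0 \<and> \<pi> \<in> Inc_mn i r0 n})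
    \<longleftrightarrow> M.generated_from r0"
proof -
  have "init_chain c r I n = Idl\<^bsub>Rn c n\<^esub> {act \<pi> f | \<pi> f. f \<in> init_chain c r I r0 \<and> \<pi> \<in> Inc_mn i r0 n} \<longleftrightarrow>
    (\<forall>v\<in>init_mons r (I n). \<exists>u\<in>init_mons r (I r0). \<exists>\<pi>\<in>Inc_mn i r0 n. \<exists>w. v = act_mon \<pi> u + w)"
    if n: "r0 \<le> n" for n
  proof -
    have n1: "1 \<le> n" using r0 n by simp
    let ?G = "{act_mon \<pi> u | \<pi> u. u \<in> init_mons r (I r0) \<and> \<pi> \<in> Inc_mn i r0 n}"
    let ?F = "{act \<pi> f | \<pi> f. f \<in> init_chain c r I r0 \<and> \<pi> \<in> Inc_mn i r0 n}"
    have GN: "?G \<subseteq> init_mons r (I n)" using M.act[OF r0 n] by blast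
    have "Idl\<^bsub>Rn c n\<^esub> ?F = mono_ideal (xvars c n) ?G"
    proof (rule Idl_eq_mono_ideal)
      show "mono_poly ` ?G \<subseteq> ?F"
      proof
        fix p :: "'a mpoly" assume "p \<in> mono_poly ` ?G"
        then obtain \<pi> u where u: "p = mono_poly (act_mon \<pi> u)" "u \<in> init_mons r (I r0)" "\<pi> \<in> Inc_mn i r0 n"
          by blast
        have "mono_poly u \<in> init_chain c r I r0"
          using u(2) M.xvars[OF r0 u(2)] by (auto simp: init_chain_eq[OF r0] intro: polys_single)
        moreover have "p = act \<pi> (mono_poly u)" by (simp add: u(1) act_single)
        ultimately show "p \<in> ?F" using u(3) by blast
      qed
      show "?F \<subseteq> mono_ideal (xvars c n) ?G"
      proof
        fix p :: "'a mpoly" assume "p \<in> ?F"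
        then obtain \<pi> f where f: "p = act \<pi> f" "f \<in> init_chain c r I r0" "\<pi> \<in> Inc_mn i r0 n" by blast
        have I: "\<pi> \<in> Inc i" using f(3) by (simp add: Inc_mn_def)
        have kf: "keys f \<subseteq> init_mons r (I r0)" using f(2) by (simp add: init_chain_eq[OF r0])
        have "keys f \<subseteq> Mons c" using kf M.xvars[OF r0] Mons_of_xvars by blast
        then have k: "keys p = act_mon \<pi> ` keys f" unfolding f(1) by (rule keys_act[OF I])
        have kG: "v \<in> ?G" if "v \<in> keys p" for v using that kf f(3) unfolding k by blast
        then have "p \<in> polys (xvars c n)" using GN M.xvars[OF n1] unfolding polys_def by blast
        moreover have "\<exists>g\<in>?G. \<exists>w. v = g + w" if "v \<in> keys p" for v
          using kG[OF that] by (intro bexI[of _ v] exI[of _ 0]) auto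
        ultimately show "p \<in> mono_ideal (xvars c n) ?G" unfolding mono_ideal_def by blast
      qed
    qed
    then have "init_chain c r I n = Idl\<^bsub>Rn c n\<^esub> ?F \<longleftrightarrow> init_chain c r I n = mono_ideal (xvars c n) ?G"
      by simp
    also have "\<dots> \<longleftrightarrow> (\<forall>v\<in>init_mons r (I n). \<exists>g\<in>?G. \<exists>w. v = g + w)"
      by (rule eq_mono_ideal_iff[OF M.xvars[OF n1] M.add[OF n1] init_chain_eq[OF n1] GN])
    also have "\<dots> \<longleftrightarrow> (\<forall>v\<in>init_mons r (I n). \<exists>u\<in>init_mons r (I r0). \<exists>\<pi>\<in>Inc_mn i r0 n. \<exists>w. v = act_mon \<pi> u + w)"
      by blast
    finally show ?thesis .
  qed
  then show ?thesis unfolding M.generated_from_def by blast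
qed

text \<open>\<open>generated_from_exists\<close> provides some admissible index, so the least one
  has its defining property.\<close>

lemma ind_init_chain:
  "1 \<le> ind c i (init_chain c r I)" "M.generated_from (ind c i (init_chain c r I))"
proof -
  define R where "R r0 \<longleftrightarrow> 1 \<le> r0 \<and> (\<forall>n\<ge>r0. init_chain c r I n =
    Idl\<^bsub>Rn c n\<^esub> {act \<pi> f | \<pi> f. f \<in> init_chain c r I r0 \<and> \<pi> \<in> Inc_mn i r0 n})" for r0
  have "\<exists>r0. R r0" using M.generated_from_exists generated_iff unfolding R_def by blast
  then have "R (LEAST r0. R r0)" by (rule LeastI_ex)
  moreover have "ind c i (init_chain c r I) = (LEAST r0. R r0)" by (simp add: ind_def R_def)
  ultimately have "R (ind c i (init_chain c r I))" by simp
  then show "1 \<le> ind c i (init_chain c r I)" "M.generated_from (ind c i (init_chain c r I))"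
    using generated_iff unfolding R_def by blast+
qed

lemma one_in_iff: "1 \<le> n \<Longrightarrow> 1 \<in> I n \<longleftrightarrow> 0 \<in> init_mons r (I n)"
  using zero_in_init_mons_iff[OF ord chain_pideal] by blast

lemma init_chain_unit_iff:
  assumes "1 \<le> n"
  shows "init_chain c r I n = carrier (Rn c n) \<longleftrightarrow> 0 \<in> init_mons r (I n)"
proof -
  have "init_chain c r I n = carrier (Rn c n) \<longleftrightarrow> (\<forall>f \<in> polys (xvars c n). keys (f :: 'a mpoly) \<subseteq> init_mons r (I n))"
    unfolding init_chain_eq[OF assms] carrier_Rn by blast
  also have "\<dots> \<longleftrightarrow> 0 \<in> init_mons r (I n)"
  proof
    assume "\<forall>f \<in> polys (xvars c n). keys (f :: 'a mpoly) \<subseteq> init_mons r (I n)"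
    from bspec[OF this polys_one] show "0 \<in> init_mons r (I n)" by simp
  next
    assume "0 \<in> init_mons r (I n)"
    then have "u \<in> init_mons r (I n)" if "keys u \<subseteq> xvars c n" for u
      using M.add[OF assms _ that, of 0] by simp
    then show "\<forall>f \<in> polys (xvars c n). keys (f :: 'a mpoly) \<subseteq> init_mons r (I n)"
      using polys_keysD by blast
  qed
  finally show ?thesis .
qed

lemma gamma_unit:
  assumes "0 \<in> init_mons r (I (ind c i (init_chain c r I)))"
  shows "gamma c i (init_chain c r I) = \<infinity>" "\<forall>n\<ge>ind c i (init_chain c r I). 1 \<in> I n"
proof -
  let ?r = "ind c i (init_chain c r I)"
  have 0: "0 \<in> init_mons r (I n)" if n: "n \<ge> ?r" for n
    using M.act[OF ind_init_chain(1) n assms id_Inc_mn[OF n]] by simp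
  then show "\<forall>n\<ge>?r. 1 \<in> I n" using one_in_iff ind_init_chain(1) by auto
  have inf: "gamma_ideal c i n (init_chain c r I n) = \<infinity>" if "n \<ge> ?r" for n
    using 0[OF that] init_chain_unit_iff[of n] ind_init_chain(1) that by (simp add: gamma_ideal_def)
  show "gamma c i (init_chain c r I) = \<infinity>"
    unfolding gamma_def
  proof (rule the_equality)
    show "\<forall>n\<ge>?r. gamma_ideal c i n (init_chain c r I n) = \<infinity>" using inf by blast
  qed (use inf in force)
qed

text \<open>The minimum cover size at level \<open>ind\<close> agrees with \<gamma>_i at all later
  levels, and it is the number \<open>g\<close> that the counting locale
  \<open>generated_chain\<close> asks for.\<close>

lemma gamma_proper:
  assumes nz: "0 \<notin> init_mons r (I (ind c i (init_chain c r I)))"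
  obtains g where "gamma c i (init_chain c r I) = enat g"
    "generated_chain c i (\<lambda>n. init_mons r (I n)) (ind c i (init_chain c r I)) g"
proof -
  define r0 where "r0 = ind c i (init_chain c r I)"
  have r0: "1 \<le> r0" "M.generated_from r0" using ind_init_chain by (simp_all add: r0_def)
  have nz0: "0 \<notin> init_mons r (I r0)" using nz by (simp add: r0_def)
  define g where "g = Min {card C | C. row_cover c i (init_mons r (I r0)) C}"
  have "row_cover c i (init_mons r (I r0)) {1..c}"
    unfolding row_cover_def
  proof (intro conjI ballI impI)
    fix u assume u: "u \<in> init_mons r (I r0)"
    then have "keys u \<noteq> {}" using nz0 by auto
    then obtain k j where "(k, j) \<in> keys u" by fast
    then show "\<exists>k\<in>{1..c}. \<exists>j. (k, j) \<in> keys u" using M.xvars[OF r0(1) u] by (force simp: xvars_def)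
  qed simp
  then have ne: "{card C | C. row_cover c i (init_mons r (I r0)) C} \<noteq> {}" by blast
  have "{card C | C. row_cover c i (init_mons r (I r0)) C} \<subseteq> card ` Pow {1..c}"
    by (auto simp: row_cover_def)
  then have fin: "finite {card C | C. row_cover c i (init_mons r (I r0)) C}" by (rule finite_subset) simp
  have g1: "\<exists>C. row_cover c i (init_mons r (I r0)) C \<and> card C = g"
  proof -
    have "g \<in> {card C | C. row_cover c i (init_mons r (I r0)) C}"
      unfolding g_def by (rule Min_in[OF fin ne])
    then show ?thesis by auto
  qed
  have g2: "g \<le> card C" if "row_cover c i (init_mons r (I r0)) C" for C
    unfolding g_def by (rule Min_le[OF fin]) (intro CollectI exI[of _ C] conjI refl that)
  have gc: "generated_chain c i (\<lambda>n. init_mons r (I n)) r0 g"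
  proof
    show "\<exists>C\<subseteq>{1..c}. card C = g \<and> (\<forall>u\<in>init_mons r (I r0). (\<forall>(k, j)\<in>keys u. i < j) \<longrightarrow>
      (\<exists>k\<in>C. \<exists>j. (k, j) \<in> keys u))" using g1 unfolding row_cover_def by blast
    show "g \<le> card C" if "C \<subseteq> {1..c}" "\<forall>u\<in>init_mons r (I r0). (\<forall>(k, j)\<in>keys u. i < j) \<longrightarrow>
      (\<exists>k\<in>C. \<exists>j. (k, j) \<in> keys u)" for C by (rule g2) (use that in \<open>simp add: row_cover_def\<close>)
  qed (use r0 nz0 in auto)
  then interpret G: generated_chain c i "\<lambda>n. init_mons r (I n)" r0 g .
  have eq: "gamma_ideal c i n (init_chain c r I n) = enat g" if n: "n \<ge> r0" for n
  proof -
    have n1: "1 \<le> n" using n r0(1) by simp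
    have "is_cover c i n (init_chain c r I n) C \<longleftrightarrow> row_cover c i (init_mons r (I r0)) C" for C
      using is_cover_iff[OF M.xvars[OF n1] M.add[OF n1] init_chain_eq[OF n1] G.zero_notin[OF n]]
        M.row_cover_stable[OF r0(2,1) n] by blast
    then show ?thesis
      using init_chain_unit_iff[OF n1] G.zero_notin[OF n] by (simp add: gamma_ideal_def g_def)
  qed
  have "gamma c i (init_chain c r I) = enat g"
    unfolding gamma_def r0_def[symmetric]
  proof (rule the_equality)
    show "\<forall>n\<ge>r0. gamma_ideal c i n (init_chain c r I n) = enat g" using eq by blast
  qed (use eq in force)
  then show ?thesis using that gc by (simp add: r0_def)
qed

text \<open>Either the chain is eventually the unit ideal, or the one affine formula for
  \<open>\<alpha>\<close> yields both the dimension of R_n/I_n and the codimension of the initial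
  ideal, so the two constants are opposite.\<close>

lemma dimension_formula:
  "(gamma c i (init_chain c r I) = \<infinity> \<and> (\<forall>\<^sub>F n in sequentially. 1 \<le> n \<and> 1 \<in> I n)) \<or>
   (\<exists>g B. gamma c i (init_chain c r I) = enat g \<and> D_const c i (init_chain c r I) = - B \<and>
      (\<forall>\<^sub>F n in sequentially. krull_dim (Rn c n Quot I n) = ereal ((real c - real g) * real n + of_int B)))"
proof (cases "0 \<in> init_mons r (I (ind c i (init_chain c r I)))")
  case True
  have "\<forall>n\<ge>ind c i (init_chain c r I). 1 \<le> n \<and> 1 \<in> I n"
    using gamma_unit(2)[OF True] ind_init_chain(1) by auto
  then show ?thesis using gamma_unit(1)[OF True] unfolding eventually_sequentially by blast
next
  case False
  obtain g where g: "gamma c i (init_chain c r I) = enat g"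
    "generated_chain c i (\<lambda>n. init_mons r (I n)) (ind c i (init_chain c r I)) g"
    by (rule gamma_proper[OF False])
  interpret G: generated_chain c i "\<lambda>n. init_mons r (I n)" "ind c i (init_chain c r I)" g by (rule g(2))
  obtain B where "\<forall>\<^sub>F n in sequentially. int (G.\<alpha> n) = int (c - g) * int n + B"
    using G.eventually_affine by blast
  then have ev: "\<forall>\<^sub>F n in sequentially. ind c i (init_chain c r I) \<le> n \<and> int (G.\<alpha> n) = int (c - g) * int n + B"
    using eventually_ge_at_top eventually_conj by blast
  have \<alpha>: "real (G.\<alpha> n) = (real c - real g) * real n + of_int B"
    if "int (G.\<alpha> n) = int (c - g) * int n + B" for n
  proof -
    have "real_of_int (int (G.\<alpha> n)) = real_of_int (int (c - g) * int n + B)" using that by simp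
    then show ?thesis using G.g_le by (simp add: of_nat_diff)
  qed
  have dim: "\<forall>\<^sub>F n in sequentially. krull_dim (Rn c n Quot I n) = ereal ((real c - real g) * real n + of_int B)"
    using ev
  proof eventually_elim
    case (elim n)
    then have "1 \<le> n" using ind_init_chain(1) by simp
    then show ?case
      using krull_dim_quot[OF ord chain_pideal G.max_indep_\<alpha>[of n]] elim \<alpha> by simp
  qed
  have cod: "\<forall>\<^sub>F n in sequentially. codim (Rn c n) (init_chain c r I n) = ereal (real g * real n - of_int B)"
    using ev
  proof eventually_elim
    case (elim n)
    then have "1 \<le> n" using ind_init_chain(1) by simp
    then have "codim (Rn c n) (init_chain c r I n) = ereal (real (c * n) - real (G.\<alpha> n))"
      using codim_init_ideal[OF ord chain_pideal G.max_indep_\<alpha>[of n]] elim by (simp add: init_chain_def)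
    then show ?case using elim \<alpha> by (simp add: algebra_simps)
  qed
  have "D_const c i (init_chain c r I) = - B"
    unfolding D_const_def g(1)
  proof (rule the_equality)
    show "\<forall>\<^sub>F n in sequentially. codim (Rn c n) (init_chain c r I n) =
      ereal_of_enat (enat g) * ereal (real n) + ereal (real_of_int (- B))"
      using cod by eventually_elim simp
    fix d assume "\<forall>\<^sub>F n in sequentially. codim (Rn c n) (init_chain c r I n) =
      ereal_of_enat (enat g) * ereal (real n) + ereal (real_of_int d)"
    with cod have "\<forall>\<^sub>F n :: nat in sequentially. d = - B"
    proof eventually_elim
      case (elim n)
      then have "real_of_int d = real_of_int (- B)" by simp
      then show ?case by linarith
    qed
    then show "d = - B" by simp
  qed
  then show ?thesis using g(1) dim by blast
qed

text \<open>In the unit case both sides of the defining equation are \<infinity>, so every integer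
  fits. The resulting default value does not depend on the order.\<close>

lemma D_const_infinite:
  assumes "\<forall>\<^sub>F n in sequentially. 1 \<le> n \<and> 1 \<in> I n" "gamma c i (init_chain c r I) = \<infinity>"
  shows "D_const c i (init_chain c r I) = (THE d. True)"
proof -
  have "\<forall>\<^sub>F n in sequentially. codim (Rn c n) (init_chain c r I n) =
    ereal_of_enat (gamma c i (init_chain c r I)) * ereal (real n) + ereal (real_of_int d)" for d
    using assms(1)
  proof eventually_elim
    case (elim n)
    then have "init_chain c r I n = carrier (Rn c n)" using init_chain_unit_iff one_in_iff by blast
    then have "codim (Rn c n) (init_chain c r I n) = \<infinity>"
      using codim_unit[of "init_chain c r I n" c n] by (simp add: carrier_Rn)
    then show ?case using elim by (simp add: assms(2))
  qed
  then show ?thesis unfolding D_const_def by simp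
qed

end

lemma affine_eventually_unique:
  fixes a b a' b' :: real
  assumes "\<forall>\<^sub>F n in sequentially. a * real n + b = a' * real n + b'"
  shows "a = a' \<and> b = b'"
proof -
  obtain N where N: "\<And>n. n \<ge> N \<Longrightarrow> a * real n + b = a' * real n + b'"
    using assms unfolding eventually_sequentially by blast
  have "a * real N + b = a' * real N + b'" "a * real (Suc N) + b = a' * real (Suc N) + b'"
    by (rule N, simp)+
  then show ?thesis by (simp add: algebra_simps)
qed

theorem corollary3p12:
  fixes c i :: nat and I :: "nat \<Rightarrow> 'a::field mpoly set"
  assumes "c \<ge> 1" and "inc_invariant_chain c i I"
  shows "(\<forall>r. monomial_order c r \<and> respects_Inc i r \<longrightarrow>
      (\<forall>\<^sub>F n in sequentially. krull_dim (Rn c n Quot I n) =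
        (ereal (real c) - ereal_of_enat (gamma c i (init_chain c r I))) * ereal (real n)
        + ereal (real_of_int (- D_const c i (init_chain c r I))))) \<and>
    (\<forall>r s. monomial_order c r \<and> respects_Inc i r \<and> monomial_order c s \<and> respects_Inc i s \<longrightarrow>
      gamma c i (init_chain c r I) = gamma c i (init_chain c s I) \<and>
      D_const c i (init_chain c r I) = D_const c i (init_chain c s I))"
proof -
  have unit: "\<forall>\<^sub>F n in sequentially. krull_dim (Rn c n Quot I n) = - \<infinity>"
    if "\<forall>\<^sub>F n in sequentially. 1 \<le> n \<and> 1 \<in> I n"
    using that
  proof eventually_elim
    case (elim n)
    then have "pideal (xvars c n) (I n)" using assms(2) by (simp add: inc_invariant_chain_def ideal_Rn_iff)
    then show ?case by (rule krull_dim_quot_unit) (use elim in simp)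
  qed
  have "\<forall>\<^sub>F n in sequentially. krull_dim (Rn c n Quot I n) =
        (ereal (real c) - ereal_of_enat (gamma c i (init_chain c r I))) * ereal (real n)
        + ereal (real_of_int (- D_const c i (init_chain c r I)))"
    if r: "monomial_order c r" "respects_Inc i r" for r
    using dimension_formula[OF assms(2) r]
  proof (elim disjE exE conjE)
    assume inf: "gamma c i (init_chain c r I) = \<infinity>" "\<forall>\<^sub>F n in sequentially. 1 \<le> n \<and> 1 \<in> I n"
    \<comment> \<open>For n >= 1 the right-hand side is (c - \<infinity>) n plus a real number, that
      is -\<infinity>.\<close>
    show ?thesis
      using unit[OF inf(2)] inf(2) by eventually_elim (simp add: inf(1))
  next
    fix g B assume g: "gamma c i (init_chain c r I) = enat g" "D_const c i (init_chain c r I) = - B"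
      "\<forall>\<^sub>F n in sequentially. krull_dim (Rn c n Quot I n) = ereal ((real c - real g) * real n + of_int B)"
    show ?thesis using g(3) by eventually_elim (simp add: g(1,2))
  qed
  moreover have "gamma c i (init_chain c r I) = gamma c i (init_chain c s I) \<and>
      D_const c i (init_chain c r I) = D_const c i (init_chain c s I)"
    if r: "monomial_order c r" "respects_Inc i r" and s: "monomial_order c s" "respects_Inc i s" for r s
  proof -
    \<comment> \<open>The dimension cannot be -\<infinity> and real at once, so two orders always
      fall under the same case.\<close>
    have mixed: False if inf: "\<forall>\<^sub>F n in sequentially. 1 \<le> n \<and> 1 \<in> I n"
      and fin: "\<forall>\<^sub>F n in sequentially. krull_dim (Rn c n Quot I n) = ereal ((real c - real g) * real n + of_int B)"
      for g :: nat and B :: int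
    proof -
      have "\<forall>\<^sub>F n :: nat in sequentially. False" using unit[OF inf] fin by eventually_elim simp
      then show False by simp
    qed
    show ?thesis
      using dimension_formula[OF assms(2) r] dimension_formula[OF assms(2) s]
    proof (elim disjE exE conjE)
      assume inf: "gamma c i (init_chain c r I) = \<infinity>" "gamma c i (init_chain c s I) = \<infinity>"
        "\<forall>\<^sub>F n in sequentially. 1 \<le> n \<and> 1 \<in> I n"
      show ?thesis
        using D_const_infinite[OF assms(2) r inf(3,1)] D_const_infinite[OF assms(2) s inf(3,2)] inf(1,2)
        by simp
    next
      fix g B h C
      assume g: "gamma c i (init_chain c r I) = enat g" "D_const c i (init_chain c r I) = - B"
        "\<forall>\<^sub>F n in sequentially. krull_dim (Rn c n Quot I n) = ereal ((real c - real g) * real n + of_int B)"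
        and h: "gamma c i (init_chain c s I) = enat h" "D_const c i (init_chain c s I) = - C"
        "\<forall>\<^sub>F n in sequentially. krull_dim (Rn c n Quot I n) = ereal ((real c - real h) * real n + of_int C)"
      have "\<forall>\<^sub>F n in sequentially. (real c - real g) * real n + of_int B = (real c - real h) * real n + of_int C"
        using g(3) h(3) by eventually_elim simp
      then have "real c - real g = real c - real h \<and> real_of_int B = of_int C"
        by (rule affine_eventually_unique)
      then have "g = h" "B = C" by simp_all
      then show ?thesis using g h by simp
    qed (use mixed in blast)+
  qed
  ultimately show ?thesis by blast
qed

end
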